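(* Let $(A,\varphi,D,\Pi)\in T^*\mathcal Q$ be a point in the phase space of the Higgs sector of the Glashow–Weinberg–Salam model, with $\varphi$ nowhere vanishing. The stabilizer of $(A,\varphi,D,\Pi)$ under the action of the group of gauge transformations is conjugate to $K$ if the following conditions are met on $\hat P$ (otherwise it is conjugate to $\mathbb Z_2$): (i) $\tau$ is proportional to $t_-$, i.e. $W_\pm=0$, (ii) $D_{\mathfrak p}$ is proportional to $t_-$, and (iii) the first component of $\Pi$ vanishes.
   Context: $M$ is a compact connected oriented Riemannian $3$-manifold, $G=SU(2)\times U(1)$, $P\to M$ a principal $G$-bundle, and $F=P\times_G\mathbb C^2$ with the $G$-representation $\rho_{a,\vartheta}(z)=a\,e^{\frac i2\vartheta}z$ ($a\in SU(2)$, $\vartheta\in[0,4\pi)$). The configuration space $\mathcal Q$ consists of pairs $(A,\varphi)$ of a connection $A$ on $P$ and a nowhere vanishing section $\varphi$ of $F$; $T^*\mathcal Q$ is the trivial bundle with fiber $\Omega^2(M,\mathrm{Ad}^*P)\times\Omega^3(M,F^* )\ni(D,\Pi)$; via the volume form and the Hermitian structure $\Pi$ is viewed as a section of $F$, i.e. a $G$-equivariant map $P\to\mathbb C^2$ with components $\Pi_1,\Pi_2$. The group of gauge transformations (smooth maps $\lambda\colon P\to G$ with $\lambda(p\cdot g)=g^{-1}\lambda(p)g$) acts in the natural way: $A\mapsto\mathrm{Ad}_\lambda A+\lambda d\lambda^{-1}$, $\varphi\mapsto\lambda\cdot\varphi$, and by the induced linear actions on $D,\Pi$. Let $K=\{(\mathrm{diag}(e^{\frac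 i2\vartheta},e^{-\frac i2\vartheta}),e^{i\vartheta}):\vartheta\in[0,4\pi)\}\subset G$ (the stabilizer of $(0,v)\in\mathbb C^2$, $v\ne0$ a fixed real number) and $\mathbb Z_2=\{(\pm\mathbb 1,1)\}\subset K$. Write $\varphi(p)=\frac{\eta}{\sqrt2}\phi(p)\cdot\binom0v$ with $\eta\colon M\to\mathbb R_{>0}$ and $\phi\colon P\to G/K$ $G$-equivariant; $\hat P=\{p\in P:\phi(p)=[e]\}$ is a principal $K$-bundle. Stabilizers are identified with subgroups of $G$ by evaluating gauge transformations at a fixed point $p_0\in\hat P$ (injective on the stabilizer of $A$). Let $t_a=\frac i2\sigma_a\in\mathfrak{su}(2)$ (Pauli matrices), $i\in\mathfrak u(1)$ and $t_\pm=t_3\pm i$ in $\mathfrak g=\mathfrak{su}(2)\oplus\mathfrak u(1)$. The Lie algebra $\mathfrak k$ of $K$ is spanned by $t_+$, with $\mathrm{Ad}_K$-invariant complement $\mathfrak p=\mathrm{span}\{t_1,t_2,t_-\}$. Restricting to $\hat P$: $A|_{\hat P}=\hat A+\tau$ with $\hat A$ $\mathfrak k$-valued and $\tau$ $\mathfrak p$-valued. With coupling constants $g,g'\neq0$ and $A=gW^at_a+ig'B$ one has $\tau=gW^1t_1+gW^2t_2+\frac12(gW^3-g'B)t_-$ and $W_\pm=\frac1{\sqrt2}(W^1\mp iW^2)$. Using the $\mathrm{Ad}_G$-invariant scalar product in which $\{t_1,t_2,t_3,i\}$ is orthonormal to identify $\mathfrak g^*\simeq\mathfrak g$, decompose $D|_{\hat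 P}=D_{\mathfrak k}+D_{\mathfrak p}$ according to $\mathfrak g=\mathfrak k\oplus\mathfrak p$. *)

theory Defs
  imports "HOL-Analysis.Analysis"
begin

section \<open>Smooth maps and manifolds\<close>

fun Ck_on :: "nat \<Rightarrow> 'a::euclidean_space set \<Rightarrow> ('a \<Rightarrow> 'b::euclidean_space) \<Rightarrow> bool" where
  "Ck_on 0 N f = continuous_on N f"
| "Ck_on (Suc k) N f = ((\<forall>x\<in>N. f differentiable (at x)) \<and>
     (\<forall>v. Ck_on k N (\<lambda>x. frechet_derivative f (at x) v)))"

text \<open>Smoothness on an arbitrary subset of a Euclidean space: locally, \<open>f\<close> is the restriction of
  a smooth function defined on an open set. On open sets and on embedded submanifolds
  this is the usual notion.\<close>

definition smooth_on :: "'a::euclidean_space set \<Rightarrow> ('a \<Rightarrow> 'b::euclidean_space) \<Rightarrow> bool" where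
  "smooth_on S f \<longleftrightarrow> (\<forall>x\<in>S. \<exists>N F. open N \<and> x \<in> N \<and> (\<forall>k. Ck_on k N F) \<and> (\<forall>y\<in>S \<inter> N. F y = f y))"

type_synonym ('m, 'e) chart = "'m set \<times> ('m \<Rightarrow> 'e)"

abbreviation chart_inv :: "('m, 'e) chart \<Rightarrow> 'e \<Rightarrow> 'm" where
  "chart_inv c \<equiv> inv_into (fst c) (snd c)"

definition smooth_manifold ::
  "('m::{t2_space,second_countable_topology}, 'e::euclidean_space) chart set \<Rightarrow> bool" where
  "smooth_manifold A \<longleftrightarrow>
     (\<Union>c\<in>A. fst c) = UNIV \<and>
     (\<forall>c\<in>A. open (fst c) \<and> open (snd c ` fst c) \<and>
            homeomorphism (fst c) (snd c ` fst c) (snd c) (chart_inv c)) \<and>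
     (\<forall>c\<in>A. \<forall>d\<in>A. smooth_on (snd c ` (fst c \<inter> fst d)) (snd d \<circ> chart_inv c))"

definition smooth_map :: "('m::topological_space, 'e::euclidean_space) chart set \<Rightarrow>
    ('n::topological_space, 'f::euclidean_space) chart set \<Rightarrow> 'm set \<Rightarrow> ('m \<Rightarrow> 'n) \<Rightarrow> bool" where
  "smooth_map A B S f \<longleftrightarrow> continuous_on S f \<and>
     (\<forall>c\<in>A. \<forall>d\<in>B. smooth_on (snd c ` (fst c \<inter> S \<inter> f -` fst d)) (snd d \<circ> f \<circ> chart_inv c))"

text \<open>A subset \<open>S\<close> of a Euclidean space, in particular a closed matrix group, carries the smooth
  structure inherited from the ambient space. Since \<^const>\<open>smooth_on\<close> makes sense on arbitrary
  subsets, it is represented by the single chart \<open>(S, id)\<close>.\<close>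

definition sub_atlas :: "'e set \<Rightarrow> ('e, 'e) chart set" where
  "sub_atlas S = {(S, id)}"

definition prod_atlas ::
  "('m, 'e) chart set \<Rightarrow> ('n, 'f) chart set \<Rightarrow> ('m \<times> 'n, 'e \<times> 'f) chart set" where
  "prod_atlas A B = {(fst c \<times> fst d, map_prod (snd c) (snd d)) | c d. c \<in> A \<and> d \<in> B}"

abbreviation smooth_fun :: "('m::topological_space, 'e::euclidean_space) chart set \<Rightarrow>
    'm set \<Rightarrow> ('m \<Rightarrow> 'b::euclidean_space) \<Rightarrow> bool" where
  "smooth_fun A S f \<equiv> smooth_map A (sub_atlas UNIV) S f"

section \<open>Tangent vectors and differential forms\<close>

text \<open>A tangent vector at \<open>p\<close> is the family of its coordinate vectors in all charts around \<open>p\<close>,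
  transforming with the Jacobians of the coordinate changes; the family is \<open>0\<close> on all other
  charts. The vector space structure is pointwise.\<close>

type_synonym ('m, 'e) tvec = "('m, 'e) chart \<Rightarrow> 'e"

definition tangent_space ::
  "('m, 'e::euclidean_space) chart set \<Rightarrow> 'm \<Rightarrow> ('m, 'e) tvec set" where
  "tangent_space A p = {v.
     (\<forall>c. c \<notin> A \<or> p \<notin> fst c \<longrightarrow> v c = 0) \<and>
     (\<forall>c\<in>A. \<forall>d\<in>A. p \<in> fst c \<inter> fst d \<longrightarrow>
        v d = frechet_derivative (snd d \<circ> chart_inv c) (at (snd c p)) (v c))}"

definition chart_at :: "('m, 'e) chart set \<Rightarrow> 'm \<Rightarrow> ('m, 'e) chart" where
  "chart_at A p = (SOME c. c \<in> A \<and> p \<in> fst c)"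

definition coord_vec ::
  "('m, 'e::euclidean_space) chart set \<Rightarrow> ('m, 'e) chart \<Rightarrow> 'm \<Rightarrow> 'e \<Rightarrow> ('m, 'e) tvec" where
  "coord_vec A c p \<xi> = (\<lambda>d. if d \<in> A \<and> p \<in> fst d
     then frechet_derivative (snd d \<circ> chart_inv c) (at (snd c p)) \<xi> else 0)"

definition tderiv :: "('m, 'e::euclidean_space) chart set \<Rightarrow> ('m \<Rightarrow> 'b::euclidean_space) \<Rightarrow>
    'm \<Rightarrow> ('m, 'e) tvec \<Rightarrow> 'b" where
  "tderiv A f p v = (let c = chart_at A p in
     frechet_derivative (f \<circ> chart_inv c) (at (snd c p)) (v c))"

definition pushforward :: "('m, 'e::euclidean_space) chart set \<Rightarrow>
    ('n, 'f::euclidean_space) chart set \<Rightarrow> ('m \<Rightarrow> 'n) \<Rightarrow> 'm \<Rightarrow> ('m, 'e) tvec \<Rightarrow> ('n, 'f) tvec" where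
  "pushforward A B f p v =
     (\<lambda>d. if d \<in> B \<and> f p \<in> fst d then tderiv A (snd d \<circ> f) p v else 0)"

definition velocity ::
  "('m, 'e::euclidean_space) chart set \<Rightarrow> (real \<Rightarrow> 'm) \<Rightarrow> real \<Rightarrow> ('m, 'e) tvec" where
  "velocity A \<gamma> t = (\<lambda>c. if c \<in> A \<and> \<gamma> t \<in> fst c
     then vector_derivative (snd c \<circ> \<gamma>) (at t) else 0)"

text \<open>Tangent space of a submanifold \<open>S\<close>: velocities of smooth curves that stay in \<open>S\<close>.\<close>

definition sub_tangent_space :: "('m::topological_space, 'e::euclidean_space) chart set \<Rightarrow>
    'm set \<Rightarrow> 'm \<Rightarrow> ('m, 'e) tvec set" where
  "sub_tangent_space A S p = {velocity A \<gamma> 0 | \<gamma>. \<gamma> 0 = p \<and>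
     (\<exists>\<epsilon>>0. \<gamma> ` {-\<epsilon><..<\<epsilon>} \<subseteq> S \<and> smooth_map (sub_atlas UNIV) A {-\<epsilon><..<\<epsilon>} \<gamma>)}"

definition tangent_tuples ::
  "('m, 'e::euclidean_space) chart set \<Rightarrow> nat \<Rightarrow> 'm \<Rightarrow> ('m, 'e) tvec list set" where
  "tangent_tuples A k p = {vs. length vs = k \<and> set vs \<subseteq> tangent_space A p}"

text \<open>A \<open>k\<close>-form takes a point and the list of its \<open>k\<close> arguments.
  Only its values on tangent vectors at the given point are relevant.\<close>

definition smooth_form :: "('m, 'e::euclidean_space) chart set \<Rightarrow> nat \<Rightarrow>
    ('m \<Rightarrow> ('m, 'e) tvec list \<Rightarrow> 'b::euclidean_space) \<Rightarrow> bool" where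
  "smooth_form A k \<alpha> \<longleftrightarrow>
     (\<forall>p. \<forall>vs\<in>tangent_tuples A k p. \<forall>i<k.
        (\<forall>v\<in>tangent_space A p. \<forall>w\<in>tangent_space A p.
           \<alpha> p (vs[i := (\<lambda>c. v c + w c)]) = \<alpha> p (vs[i := v]) + \<alpha> p (vs[i := w])) \<and>
        (\<forall>v\<in>tangent_space A p. \<forall>r::real.
           \<alpha> p (vs[i := (\<lambda>c. r *\<^sub>R v c)]) = r *\<^sub>R \<alpha> p (vs[i := v])) \<and>
        (\<forall>j<k. i \<noteq> j \<and> vs ! i = vs ! j \<longrightarrow> \<alpha> p vs = 0)) \<and>
     (\<forall>c\<in>A. \<forall>\<xi>s. length \<xi>s = k \<longrightarrow>
        smooth_on (snd c ` fst c)
          (\<lambda>u. \<alpha> (chart_inv c u) (map (coord_vec A c (chart_inv c u)) \<xi>s)))"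

section \<open>Oriented Riemannian 3-manifolds\<close>

definition oriented_atlas :: "('m, real^'n) chart set \<Rightarrow> bool" where
  "oriented_atlas A \<longleftrightarrow> (\<forall>c\<in>A. \<forall>d\<in>A. \<forall>p\<in>fst c \<inter> fst d.
     det (matrix (frechet_derivative (snd d \<circ> chart_inv c) (at (snd c p)))) > 0)"

definition riemannian_metric :: "('m, 'e::euclidean_space) chart set \<Rightarrow>
    ('m \<Rightarrow> ('m, 'e) tvec \<Rightarrow> ('m, 'e) tvec \<Rightarrow> real) \<Rightarrow> bool" where
  "riemannian_metric A h \<longleftrightarrow>
     (\<forall>x. \<forall>v\<in>tangent_space A x. \<forall>w\<in>tangent_space A x.
        h x v w = h x w v \<and>
        (\<forall>u\<in>tangent_space A x. h x (\<lambda>c. v c + w c) u = h x v u + h x w u) \<and>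
        (\<forall>r::real. h x (\<lambda>c. r *\<^sub>R v c) w = r * h x v w) \<and>
        (v \<noteq> (\<lambda>_. 0) \<longrightarrow> h x v v > 0)) \<and>
     (\<forall>c\<in>A. \<forall>\<xi> \<zeta>. smooth_on (snd c ` fst c)
        (\<lambda>u. h (chart_inv c u) (coord_vec A c (chart_inv c u) \<xi>) (coord_vec A c (chart_inv c u) \<zeta>)))"

text \<open>The Riemannian volume form \<open>sqrt (det h) dx\<^sub>1 \<and> dx\<^sub>2 \<and> dx\<^sub>3\<close>, in any chart of the oriented atlas.\<close>

definition volume_form :: "('m, real^3) chart set \<Rightarrow>
    ('m \<Rightarrow> ('m, real^3) tvec \<Rightarrow> ('m, real^3) tvec \<Rightarrow> real) \<Rightarrow>
    'm \<Rightarrow> ('m, real^3) tvec list \<Rightarrow> real" where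
  "volume_form A h x vs = (let c = chart_at A x in
     sqrt (det (\<chi> i j. h x (coord_vec A c x (axis i 1)) (coord_vec A c x (axis j 1))))
     * det (vector (map (\<lambda>v. v c) vs) :: real^3^3))"

section \<open>The structure group $SU(2) \times U(1)$\<close>

text \<open>The representation \<open>z \<mapsto> a exp (i\<theta>/2) z\<close> with \<open>\<theta> \<in> [0, 4\<pi>)\<close> is well defined only if the
  parameter \<open>\<theta>\<close> of $U(1)$ is taken modulo \<open>4\<pi>\<close>. The element of $U(1)$ with parameter \<open>\<theta>\<close>, which
  is written formally as \<open>exp (i\<theta>)\<close>, is therefore encoded by the unit complex number \<open>cis (\<theta>/2)\<close>.
  Accordingly the generator \<open>d/d\<theta>\<close> of the Lie algebra of $U(1)$, written formally as \<open>i\<close>, is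
  encoded by the complex number \<open>i/2\<close>. Elements of the group and of its Lie algebra are both
  represented inside the algebra of pairs of a complex 2-by-2 matrix and a complex number.\<close>

type_synonym mat_pair = "(complex^2^2) \<times> complex"

definition mat2 :: "complex \<Rightarrow> complex \<Rightarrow> complex \<Rightarrow> complex \<Rightarrow> complex^2^2" where
  "mat2 a b c d = vector [vector [a, b], vector [c, d]]"

definition adjoint_mat :: "complex^2^2 \<Rightarrow> complex^2^2" where
  "adjoint_mat a = (\<chi> i j. cnj (a $ j $ i))"

definition SU2 :: "(complex^2^2) set" where
  "SU2 = {a. a ** adjoint_mat a = mat 1 \<and> det a = 1}"

definition u1 :: "real \<Rightarrow> complex" where
  "u1 \<theta> = cis (\<theta>/2)"

definition Ggrp :: "mat_pair set" where
  "Ggrp = SU2 \<times> u1 ` {0..<4*pi}"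

definition gmult :: "mat_pair \<Rightarrow> mat_pair \<Rightarrow> mat_pair" where
  "gmult g h = (fst g ** fst h, snd g * snd h)"

definition gone :: mat_pair where
  "gone = (mat 1, 1)"

text \<open>On unitary elements this is the group inverse.\<close>

definition ginv :: "mat_pair \<Rightarrow> mat_pair" where
  "ginv g = (adjoint_mat (fst g), cnj (snd g))"

definition rho :: "mat_pair \<Rightarrow> complex^2 \<Rightarrow> complex^2" where
  "rho g z = snd g *s (fst g *v z)"

definition Kgrp :: "mat_pair set" where
  "Kgrp = {(mat2 (cis (\<theta>/2)) 0 0 (cis (-\<theta>/2)), u1 \<theta>) | \<theta>. \<theta> \<in> {0..<4*pi}}"

text \<open>The two elements of \<open>Kgrp\<close> with parameters \<open>\<theta> = 0\<close> and \<open>\<theta> = 2\<pi>\<close>, for which \<open>exp (i\<theta>)\<close> is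
  formally \<open>1\<close>.\<close>

definition Z2grp :: "mat_pair set" where
  "Z2grp = {(mat 1, u1 0), (- mat 1, u1 (2*pi))}"

definition Ad :: "mat_pair \<Rightarrow> mat_pair \<Rightarrow> mat_pair" where
  "Ad g X = gmult (gmult g X) (ginv g)"

definition lie :: "mat_pair set" where
  "lie = {(X, x). adjoint_mat X = - X \<and> trace X = 0 \<and> Re x = 0}"

definition t1 :: mat_pair where "t1 = (mat2 0 (\<i>/2) (\<i>/2) 0, 0)"
definition t2 :: mat_pair where "t2 = (mat2 0 (1/2) (-1/2) 0, 0)"
definition t3 :: mat_pair where "t3 = (mat2 (\<i>/2) 0 0 (-\<i>/2), 0)"
definition tU :: mat_pair where "tU = (0, \<i>/2)"

definition tplus :: mat_pair where "tplus = t3 + tU"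
definition tminus :: mat_pair where "tminus = t3 - tU"

definition lie_k :: "mat_pair set" where "lie_k = span {tplus}"
definition lie_p :: "mat_pair set" where "lie_p = span {t1, t2, tminus}"

definition proj_p :: "mat_pair \<Rightarrow> mat_pair" where
  "proj_p X = (THE Y. Y \<in> lie_p \<and> X - Y \<in> lie_k)"

text \<open>The invariant scalar product on the Lie algebra for which \<open>t1, t2, t3, tU\<close> are orthonormal.\<close>

definition lie_inner :: "mat_pair \<Rightarrow> mat_pair \<Rightarrow> real" where
  "lie_inner X Y = 2 * Re (trace (adjoint_mat (fst X) ** fst Y)) + 4 * Re (cnj (snd X) * snd Y)"

definition lie_sharp :: "(mat_pair \<Rightarrow> real) \<Rightarrow> mat_pair" where
  "lie_sharp \<xi> = (THE Y. Y \<in> lie \<and> (\<forall>X\<in>lie. \<xi> X = lie_inner Y X))"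

lemma lie_basis_orthonormal:
  "lie_inner t1 t1 = 1" "lie_inner t2 t2 = 1" "lie_inner t3 t3 = 1" "lie_inner tU tU = 1"
  "lie_inner t1 t2 = 0" "lie_inner t1 t3 = 0" "lie_inner t1 tU = 0"
  "lie_inner t2 t3 = 0" "lie_inner t2 tU = 0" "lie_inner t3 tU = 0"
  by (simp_all add: lie_inner_def t1_def t2_def t3_def tU_def mat2_def adjoint_mat_def trace_def
      matrix_matrix_mult_def sum_2)

lemma Kgrp_stabilizer:
  assumes "v \<noteq> 0"
  shows "Kgrp = {g \<in> Ggrp. rho g (vector [0, of_real v]) = vector [0, of_real v]}"
proof (intro set_eqI iffI)
  fix g assume "g \<in> Kgrp"
  then obtain \<theta> where "\<theta> \<in> {0..<4*pi}"
    and g: "g = (mat2 (cis (\<theta>/2)) 0 0 (cis (-\<theta>/2)), u1 \<theta>)" by (auto simp: Kgrp_def)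
  then show "g \<in> {g \<in> Ggrp. rho g (vector [0, of_real v]) = vector [0, of_real v]}"
    by (auto simp: Ggrp_def SU2_def mat2_def adjoint_mat_def u1_def rho_def det_2 vec_eq_iff forall_2
        matrix_matrix_mult_def matrix_vector_mult_def sum_2 mat_def cis_cnj cis_mult)
next
  fix g assume "g \<in> {g \<in> Ggrp. rho g (vector [0, of_real v]) = vector [0, of_real v]}"
  then obtain a \<theta> where g: "g = (a, u1 \<theta>)" and \<theta>: "\<theta> \<in> {0..<4*pi}" and a: "a \<in> SU2"
    and fix_v: "rho (a, u1 \<theta>) (vector [0, of_real v]) = vector [0, of_real v]"
    by (auto simp: Ggrp_def)
  have e1: "cis (\<theta>/2) * a$1$2 = 0" and e2: "cis (\<theta>/2) * a$2$2 = 1"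
    using fix_v assms
    by (auto simp: rho_def u1_def vec_eq_iff forall_2 matrix_vector_mult_def sum_2)
  have a12: "a$1$2 = 0" using e1 by simp
  have a22: "a$2$2 = cis (-\<theta>/2)"
  proof -
    have "a$2$2 = cis (-\<theta>/2) * (cis (\<theta>/2) * a$2$2)"
      by (simp add: cis_mult mult.assoc[symmetric])
    then show ?thesis using e2 by simp
  qed
  have "a$1$1 * a$2$2 = 1" using a a12 by (simp add: SU2_def det_2)
  then have "a$1$1 * cis (-\<theta>/2) * cis (\<theta>/2) = cis (\<theta>/2)" by (simp add: a22)
  then have a11: "a$1$1 = cis (\<theta>/2)" by (simp add: cis_mult mult.assoc)
  have "(a ** adjoint_mat a)$1$2 = 0" using a by (simp add: SU2_def mat_def)
  then have "a$1$1 * cnj (a$2$1) = 0"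
    using a12 by (simp add: matrix_matrix_mult_def adjoint_mat_def sum_2)
  then have a21: "a$2$1 = 0" using a11 by simp
  have "a = mat2 (cis (\<theta>/2)) 0 0 (cis (-\<theta>/2))"
    using a11 a12 a21 a22 by (simp add: mat2_def vec_eq_iff forall_2)
  with g \<theta> show "g \<in> Kgrp" by (auto simp: Kgrp_def)
qed

section \<open>Principal bundles, connections, and tensorial forms\<close>

definition principal_bundle ::
  "('m::{t2_space,second_countable_topology}, real^3) chart set \<Rightarrow>
   ('p::{t2_space,second_countable_topology}, real^7) chart set \<Rightarrow>
   ('p \<Rightarrow> 'm) \<Rightarrow> ('p \<Rightarrow> mat_pair \<Rightarrow> 'p) \<Rightarrow> bool" where
  "principal_bundle AM AP \<pi> act \<longleftrightarrow>
     smooth_manifold AM \<and> smooth_manifold AP \<and>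
     surj \<pi> \<and> smooth_map AP AM UNIV \<pi> \<and>
     (\<forall>p. act p gone = p) \<and>
     (\<forall>p. \<forall>g\<in>Ggrp. \<forall>h\<in>Ggrp. act (act p g) h = act p (gmult g h)) \<and>
     (\<forall>p. \<forall>g\<in>Ggrp. \<pi> (act p g) = \<pi> p) \<and>
     smooth_map (prod_atlas AP (sub_atlas Ggrp)) AP (UNIV \<times> Ggrp) (\<lambda>(p, g). act p g) \<and>
     (\<forall>x. \<exists>U \<psi>. open U \<and> x \<in> U \<and>
        bij_betw (\<lambda>p. (\<pi> p, \<psi> p)) (\<pi> -` U) (U \<times> Ggrp) \<and>
        smooth_fun AP (\<pi> -` U) \<psi> \<and>
        smooth_map (prod_atlas AM (sub_atlas Ggrp)) AP (U \<times> Ggrp)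
          (inv_into (\<pi> -` U) (\<lambda>p. (\<pi> p, \<psi> p))) \<and>
        (\<forall>p\<in>\<pi> -` U. \<forall>g\<in>Ggrp. \<psi> (act p g) = gmult (\<psi> p) g))"

text \<open>Every element \<open>X\<close> of the Lie algebra is \<open>c' 0\<close> for a smooth curve \<open>c\<close> in the group with
  \<open>c 0 = 1\<close>, and the velocity of \<open>p \<cdot> c t\<close> at \<open>t = 0\<close> is the value at \<open>p\<close> of the
  fundamental vector field of \<open>X\<close>.\<close>

definition connection_form ::
  "('p::topological_space, real^7) chart set \<Rightarrow> ('p \<Rightarrow> mat_pair \<Rightarrow> 'p) \<Rightarrow>
   ('p \<Rightarrow> ('p, real^7) tvec list \<Rightarrow> mat_pair) \<Rightarrow> bool" where
  "connection_form AP act A \<longleftrightarrow>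
     smooth_form AP 1 A \<and>
     (\<forall>p. \<forall>v\<in>tangent_space AP p. A p [v] \<in> lie) \<and>
     (\<forall>p c. smooth_on UNIV c \<and> range c \<subseteq> Ggrp \<and> c 0 = gone \<longrightarrow>
        A p [velocity AP (\<lambda>t. act p (c t)) 0] = vector_derivative c (at (0::real))) \<and>
     (\<forall>p. \<forall>v\<in>tangent_space AP p. \<forall>g\<in>Ggrp.
        A (act p g) [pushforward AP AP (\<lambda>q. act q g) p v] = Ad (ginv g) (A p [v]))"

definition horizontal_form ::
  "('m, real^3) chart set \<Rightarrow> ('p, real^7) chart set \<Rightarrow> ('p \<Rightarrow> 'm) \<Rightarrow> nat \<Rightarrow>
   ('p \<Rightarrow> ('p, real^7) tvec list \<Rightarrow> 'b::zero) \<Rightarrow> bool" where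
  "horizontal_form AM AP \<pi> k \<alpha> \<longleftrightarrow> (\<forall>p. \<forall>vs\<in>tangent_tuples AP k p.
     (\<exists>v\<in>set vs. pushforward AP AM \<pi> p v = (\<lambda>_. 0)) \<longrightarrow> \<alpha> p vs = 0)"

text \<open>The space $\Omega^2(M, Ad^*P)$, as horizontal equivariant 2-forms on the bundle with values
  in the dual of the Lie algebra.\<close>

definition coad_2form ::
  "('m, real^3) chart set \<Rightarrow> ('p, real^7) chart set \<Rightarrow> ('p \<Rightarrow> 'm) \<Rightarrow> ('p \<Rightarrow> mat_pair \<Rightarrow> 'p) \<Rightarrow>
   ('p \<Rightarrow> ('p, real^7) tvec list \<Rightarrow> mat_pair \<Rightarrow> real) \<Rightarrow> bool" where
  "coad_2form AM AP \<pi> act D \<longleftrightarrow>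
     (\<forall>p. \<forall>vs\<in>tangent_tuples AP 2 p. \<forall>X\<in>lie.
        (\<forall>Y\<in>lie. D p vs (X + Y) = D p vs X + D p vs Y) \<and>
        (\<forall>r. D p vs (r *\<^sub>R X) = r * D p vs X)) \<and>
     (\<forall>X\<in>lie. smooth_form AP 2 (\<lambda>p vs. D p vs X) \<and>
               horizontal_form AM AP \<pi> 2 (\<lambda>p vs. D p vs X)) \<and>
     (\<forall>p. \<forall>vs\<in>tangent_tuples AP 2 p. \<forall>g\<in>Ggrp. \<forall>X\<in>lie.
        D (act p g) (map (pushforward AP AP (\<lambda>q. act q g) p) vs) X = D p vs (Ad g X))"

text \<open>The space $\Omega^3(M, F^*)$, as horizontal equivariant 3-forms on the bundle with values in
  the complex dual of $\mathbb{C}^2$. Its elements, the momenta conjugate to the Higgs field, are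
  denoted \<open>\<Omega>\<close>.\<close>

definition dual_3form ::
  "('m, real^3) chart set \<Rightarrow> ('p, real^7) chart set \<Rightarrow> ('p \<Rightarrow> 'm) \<Rightarrow> ('p \<Rightarrow> mat_pair \<Rightarrow> 'p) \<Rightarrow>
   ('p \<Rightarrow> ('p, real^7) tvec list \<Rightarrow> complex^2 \<Rightarrow> complex) \<Rightarrow> bool" where
  "dual_3form AM AP \<pi> act \<Omega> \<longleftrightarrow>
     (\<forall>p. \<forall>vs\<in>tangent_tuples AP 3 p. \<forall>u.
        (\<forall>w. \<Omega> p vs (u + w) = \<Omega> p vs u + \<Omega> p vs w) \<and>
        (\<forall>s. \<Omega> p vs (s *s u) = s * \<Omega> p vs u)) \<and>
     (\<forall>u. smooth_form AP 3 (\<lambda>p vs. \<Omega> p vs u) \<and>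
          horizontal_form AM AP \<pi> 3 (\<lambda>p vs. \<Omega> p vs u)) \<and>
     (\<forall>p. \<forall>vs\<in>tangent_tuples AP 3 p. \<forall>g\<in>Ggrp. \<forall>u.
        \<Omega> (act p g) (map (pushforward AP AP (\<lambda>q. act q g) p) vs) u = \<Omega> p vs (rho g u))"

definition higgs_field ::
  "('p::topological_space, real^7) chart set \<Rightarrow> ('p \<Rightarrow> mat_pair \<Rightarrow> 'p) \<Rightarrow> ('p \<Rightarrow> complex^2) \<Rightarrow> bool" where
  "higgs_field AP act \<phi> \<longleftrightarrow> smooth_fun AP UNIV \<phi> \<and>
     (\<forall>p. \<forall>g\<in>Ggrp. \<phi> (act p g) = rho (ginv g) (\<phi> p)) \<and> (\<forall>p. \<phi> p \<noteq> 0)"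

definition phase_point ::
  "('m, real^3) chart set \<Rightarrow> ('p::topological_space, real^7) chart set \<Rightarrow>
   ('p \<Rightarrow> 'm) \<Rightarrow> ('p \<Rightarrow> mat_pair \<Rightarrow> 'p) \<Rightarrow>
   ('p \<Rightarrow> ('p, real^7) tvec list \<Rightarrow> mat_pair) \<Rightarrow> ('p \<Rightarrow> complex^2) \<Rightarrow>
   ('p \<Rightarrow> ('p, real^7) tvec list \<Rightarrow> mat_pair \<Rightarrow> real) \<Rightarrow>
   ('p \<Rightarrow> ('p, real^7) tvec list \<Rightarrow> complex^2 \<Rightarrow> complex) \<Rightarrow> bool" where
  "phase_point AM AP \<pi> act A \<phi> D \<Omega> \<longleftrightarrow>
     connection_form AP act A \<and> higgs_field AP act \<phi> \<and>
     coad_2form AM AP \<pi> act D \<and> dual_3form AM AP \<pi> act \<Omega>"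

text \<open>The section of \<open>F\<close>, as a map to $\mathbb{C}^2$, that corresponds to \<open>\<Omega>\<close> under the
  volume form and the Hermitian structure: \<open>\<Omega> = vol \<otimes> \<langle>z, -\<rangle>\<close>.\<close>

definition momentum_section ::
  "('m, real^3) chart set \<Rightarrow> ('m \<Rightarrow> ('m, real^3) tvec \<Rightarrow> ('m, real^3) tvec \<Rightarrow> real) \<Rightarrow>
   ('p, real^7) chart set \<Rightarrow> ('p \<Rightarrow> 'm) \<Rightarrow>
   ('p \<Rightarrow> ('p, real^7) tvec list \<Rightarrow> complex^2 \<Rightarrow> complex) \<Rightarrow> 'p \<Rightarrow> complex^2" where
  "momentum_section AM h AP \<pi> \<Omega> p = (THE z. \<forall>vs\<in>tangent_tuples AP 3 p. \<forall>u.
     \<Omega> p vs u = of_real (volume_form AM h (\<pi> p) (map (pushforward AP AM \<pi> p) vs))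
                * (\<Sum>i\<in>UNIV. cnj (z $ i) * u $ i))"

section \<open>Gauge transformations and stabilizers\<close>

definition gauge_group ::
  "('p::topological_space, real^7) chart set \<Rightarrow> ('p \<Rightarrow> mat_pair \<Rightarrow> 'p) \<Rightarrow> ('p \<Rightarrow> mat_pair) set" where
  "gauge_group AP act = {l. range l \<subseteq> Ggrp \<and> smooth_map AP (sub_atlas Ggrp) UNIV l \<and>
     (\<forall>p. \<forall>g\<in>Ggrp. l (act p g) = gmult (gmult (ginv g) (l p)) g)}"

definition gauge_conn :: "('p, real^7) chart set \<Rightarrow> ('p \<Rightarrow> mat_pair) \<Rightarrow>
    ('p \<Rightarrow> ('p, real^7) tvec list \<Rightarrow> mat_pair) \<Rightarrow> 'p \<Rightarrow> ('p, real^7) tvec list \<Rightarrow> mat_pair" where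
  "gauge_conn AP l A p vs =
     Ad (l p) (A p vs) + gmult (l p) (tderiv AP (\<lambda>q. ginv (l q)) p (hd vs))"

definition gauge_field :: "('p \<Rightarrow> mat_pair) \<Rightarrow> ('p \<Rightarrow> complex^2) \<Rightarrow> 'p \<Rightarrow> complex^2" where
  "gauge_field l \<phi> p = rho (l p) (\<phi> p)"

definition gauge_D :: "('p \<Rightarrow> mat_pair) \<Rightarrow> ('p \<Rightarrow> 't \<Rightarrow> mat_pair \<Rightarrow> real) \<Rightarrow>
    'p \<Rightarrow> 't \<Rightarrow> mat_pair \<Rightarrow> real" where
  "gauge_D l D p vs X = D p vs (Ad (ginv (l p)) X)"

definition gauge_Pi :: "('p \<Rightarrow> mat_pair) \<Rightarrow> ('p \<Rightarrow> 't \<Rightarrow> complex^2 \<Rightarrow> complex) \<Rightarrow>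
    'p \<Rightarrow> 't \<Rightarrow> complex^2 \<Rightarrow> complex" where
  "gauge_Pi l \<Omega> p vs u = \<Omega> p vs (rho (ginv (l p)) u)"

text \<open>Forms are compared on tangent vectors (and on the Lie algebra) only.\<close>

definition stabilizer ::
  "('p::topological_space, real^7) chart set \<Rightarrow> ('p \<Rightarrow> mat_pair \<Rightarrow> 'p) \<Rightarrow>
   ('p \<Rightarrow> ('p, real^7) tvec list \<Rightarrow> mat_pair) \<Rightarrow> ('p \<Rightarrow> complex^2) \<Rightarrow>
   ('p \<Rightarrow> ('p, real^7) tvec list \<Rightarrow> mat_pair \<Rightarrow> real) \<Rightarrow>
   ('p \<Rightarrow> ('p, real^7) tvec list \<Rightarrow> complex^2 \<Rightarrow> complex) \<Rightarrow> ('p \<Rightarrow> mat_pair) set" where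
  "stabilizer AP act A \<phi> D \<Omega> = {l \<in> gauge_group AP act. \<forall>p.
     (\<forall>vs\<in>tangent_tuples AP 1 p. gauge_conn AP l A p vs = A p vs) \<and>
     gauge_field l \<phi> p = \<phi> p \<and>
     (\<forall>vs\<in>tangent_tuples AP 2 p. \<forall>X\<in>lie. gauge_D l D p vs X = D p vs X) \<and>
     (\<forall>vs\<in>tangent_tuples AP 3 p. \<forall>u. gauge_Pi l \<Omega> p vs u = \<Omega> p vs u)}"

text \<open>A group \<open>S\<close> of gauge transformations, identified with a subgroup of the structure group by
  evaluation at \<open>p\<^sub>0\<close>, is conjugate to \<open>H\<close>. Injectivity of the evaluation is what makes the
  identification meaningful.\<close>

definition conjugate_at :: "'p \<Rightarrow> ('p \<Rightarrow> mat_pair) set \<Rightarrow> mat_pair set \<Rightarrow> bool" where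
  "conjugate_at p\<^sub>0 S H \<longleftrightarrow> inj_on (\<lambda>l. l p\<^sub>0) S \<and>
     (\<exists>g\<in>Ggrp. (\<lambda>l. l p\<^sub>0) ` S = (\<lambda>k. gmult (gmult g k) (ginv g)) ` H)"

section \<open>The reduced bundle\<close>

definition coset :: "mat_pair \<Rightarrow> mat_pair set" where
  "coset h = gmult h ` Kgrp"

text \<open>The decomposition \<open>\<phi> p = \<eta> / sqrt 2 \<cdot> \<phi>' p \<cdot> (0, v)\<close> with \<open>\<eta> > 0\<close> on the base and an equivariant
  map \<open>\<phi>'\<close> into the space of left cosets of \<open>Kgrp\<close>. It determines \<open>\<eta>\<close> and \<open>\<phi>'\<close> uniquely.\<close>

definition polar_decomposition :: "('p \<Rightarrow> 'm) \<Rightarrow> ('p \<Rightarrow> mat_pair \<Rightarrow> 'p) \<Rightarrow> real \<Rightarrow>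
    ('p \<Rightarrow> complex^2) \<Rightarrow> ('m \<Rightarrow> real) \<Rightarrow> ('p \<Rightarrow> mat_pair set) \<Rightarrow> bool" where
  "polar_decomposition \<pi> act v \<phi> \<eta> \<phi>' \<longleftrightarrow>
     (\<forall>x. \<eta> x > 0) \<and>
     (\<forall>p. \<phi>' p \<in> coset ` Ggrp) \<and>
     (\<forall>p. \<forall>g\<in>Ggrp. \<phi>' (act p g) = gmult (ginv g) ` \<phi>' p) \<and>
     (\<forall>p. \<forall>h\<in>\<phi>' p. \<phi> p = (\<eta> (\<pi> p) / sqrt 2) *\<^sub>R rho h (vector [0, of_real v]))"

definition reduced_bundle :: "('p \<Rightarrow> mat_pair set) \<Rightarrow> 'p set" where
  "reduced_bundle \<phi>' = {p. \<phi>' p = coset gone}"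

definition tau :: "('p \<Rightarrow> 't \<Rightarrow> mat_pair) \<Rightarrow> 'p \<Rightarrow> 't \<Rightarrow> mat_pair" where
  "tau A p vs = proj_p (A p vs)"

definition D_p :: "('p \<Rightarrow> 't \<Rightarrow> mat_pair \<Rightarrow> real) \<Rightarrow> 'p \<Rightarrow> 't \<Rightarrow> mat_pair" where
  "D_p D p vs = proj_p (lie_sharp (D p vs))"

definition prop_tminus_on :: "('p::topological_space, real^7) chart set \<Rightarrow> 'p set \<Rightarrow> nat \<Rightarrow>
    ('p \<Rightarrow> ('p, real^7) tvec list \<Rightarrow> mat_pair) \<Rightarrow> bool" where
  "prop_tminus_on AP S k \<alpha> \<longleftrightarrow> (\<forall>p\<in>S. \<forall>vs. length vs = k \<and> set vs \<subseteq> sub_tangent_space AP S p \<longrightarrow>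
     (\<exists>r::real. \<alpha> p vs = r *\<^sub>R tminus))"

definition W_plus :: "('p \<Rightarrow> 't \<Rightarrow> real) \<Rightarrow> ('p \<Rightarrow> 't \<Rightarrow> real) \<Rightarrow> 'p \<Rightarrow> 't \<Rightarrow> complex" where
  "W_plus W1 W2 p vs = (of_real (W1 p vs) - \<i> * of_real (W2 p vs)) / of_real (sqrt 2)"

definition W_minus :: "('p \<Rightarrow> 't \<Rightarrow> real) \<Rightarrow> ('p \<Rightarrow> 't \<Rightarrow> real) \<Rightarrow> 'p \<Rightarrow> 't \<Rightarrow> complex" where
  "W_minus W1 W2 p vs = (of_real (W1 p vs) + \<i> * of_real (W2 p vs)) / of_real (sqrt 2)"

end

theory Submission
  imports Defs
begin

text \<open>
  A gauge transformation \<open>l\<close> that fixes the configuration is determined by a single unit complex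
  number \<open>s\<close>. On the reduced bundle it fixes \<open>(0, v)\<close>, so that its values there lie in the circle
  \<open>Kgrp\<close>, whose elements \<open>kdiag s = (diag (s, cnj s), s)\<close> are determined by their \<open>U(1)\<close> component
  \<open>s\<close>; by equivariance these values determine \<open>l\<close>. As \<open>U(1)\<close> is abelian, the \<open>U(1)\<close> component of
  \<open>l\<cdot>A = A\<close> says that the \<open>U(1)\<close> component of \<open>l\<close> has zero derivative on the whole bundle; it is
  constant along the fibres for the same reason, hence constant because the base is connected
  (lemma \<open>gauge_snd_constant\<close>). So \<open>l\<close> is the transformation \<open>kgauge s\<close> that equals \<open>kdiag s\<close>
  on the reduced bundle (lemma \<open>gauge_eq_kgauge\<close>).

  It remains to see which \<open>kgauge s\<close> fix the phase space point. The group \<open>SU(2)\<close> acts simply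
  transitively on spheres, so that for every point \<open>p\<close> there is an explicit element
  \<open>gauge_frame p\<close>, smooth in \<open>p\<close>, that moves \<open>p\<close> into the reduced bundle. The resulting
  map \<open>retr\<close> is a smooth retraction onto the reduced bundle along the fibres. Its derivative
  takes all tangent vectors to tangent vectors of the reduced bundle, up to vertical vectors it is
  a right translation, and it is the identity on vectors tangent to the reduced bundle. Pulling back by it turns
  the conditions on \<open>A\<close>, \<open>D\<close> and \<open>\<Omega>\<close> at arbitrary points and tangent vectors into
  invariance under the constant \<open>kdiag s\<close> of their values on the reduced bundle (lemmas
  \<open>gauge_conn_kgauge\<close>, \<open>D_retr\<close>, \<open>\<Omega>_retr\<close>); for the connection the inhomogeneous term
  disappears because \<open>kgauge s\<close> is constant there.

  Now \<open>kdiag s\<close> acts on the Lie algebra by rotating the plane of \<open>t1\<close> and \<open>t2\<close> by \<open>s\<^sup>2\<close> and fixing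
  \<open>t3\<close> and \<open>tU\<close>, and on pairs of complex numbers as \<open>diag (s\<^sup>2, 1)\<close>. If \<open>s\<^sup>2 = 1\<close>, both
  actions are trivial: this is \<open>Z2grp\<close>. If \<open>s\<^sup>2 \<noteq> 1\<close>, invariance means that the components of \<open>A\<close>
  and \<open>D\<close> on the reduced bundle along \<open>t1\<close> and \<open>t2\<close> and the first component of the momentum section vanish,
  independently of \<open>s\<close>. The last point needs that \<open>\<Omega>\<close>, being horizontal, is a
  multiple of the volume form (lemma \<open>momentum_section\<close>).
\<close>

section \<open>Calculus of smooth maps between Euclidean spaces\<close>

lemma Ck_on_subset: "Ck_on k N f \<Longrightarrow> M \<subseteq> N \<Longrightarrow> Ck_on k M f"
  by (induction k arbitrary: f) (auto intro: continuous_on_subset)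

lemma Ck_on_cong:
  assumes "open N" "\<And>x. x \<in> N \<Longrightarrow> f x = g x" "Ck_on k N f"
  shows "Ck_on k N g"
  using assms(2,3)
proof (induction k arbitrary: f g)
  case 0
  then show ?case using continuous_on_cong[of N N f g] by simp
next
  case (Suc k)
  have der: "(g has_derivative frechet_derivative f (at x)) (at x)" if "x \<in> N" for x
  proof -
    have "(f has_derivative frechet_derivative f (at x)) (at x)"
      using Suc.prems that by (auto simp: frechet_derivative_works)
    then show ?thesis
      by (rule has_derivative_transform_within_open[OF _ assms(1) that]) (use Suc.prems in auto)
  qed
  have "frechet_derivative f (at x) v = frechet_derivative g (at x) v" if "x \<in> N" for x v
    using frechet_derivative_at[OF der[OF that]] by simp
  with Suc.IH Suc.prems(2)
  have "\<forall>v. Ck_on k N (\<lambda>x. frechet_derivative g (at x) v)"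
    by (metis (no_types, lifting) Ck_on.simps(2))
  with der show ?case by (auto simp: differentiable_def)
qed

lemma Ck_on_continuous: "Ck_on k N f \<Longrightarrow> continuous_on N f"
  by (cases k) (auto simp: continuous_at_imp_continuous_on differentiable_imp_continuous_within)

lemma Ck_on_pred: "Ck_on (Suc k) N f \<Longrightarrow> Ck_on k N f"
proof (induction k arbitrary: f)
  case 0
  then show ?case using Ck_on_continuous[of "Suc 0" N f] by simp
next
  case (Suc k)
  have a: "\<forall>x\<in>N. f differentiable (at x)"
    and b: "\<And>v. Ck_on (Suc k) N (\<lambda>x. frechet_derivative f (at x) v)"
    using Suc.prems by simp_all
  show ?case using a Suc.IH[OF b] by simp
qed

lemma Ck_on_SucI:
  assumes "open N" "\<And>x. x \<in> N \<Longrightarrow> (f has_derivative f' x) (at x)" "\<And>v. Ck_on k N (\<lambda>x. f' x v)"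
  shows "Ck_on (Suc k) N f"
proof -
  have "Ck_on k N (\<lambda>x. frechet_derivative f (at x) v)" for v
    by (rule Ck_on_cong[OF assms(1) _ assms(3)[of v]]) (use frechet_derivative_at[OF assms(2)] in auto)
  then show ?thesis using assms(2) by (auto simp: differentiable_def)
qed

lemma Ck_on_SucD:
  assumes "Ck_on (Suc k) N f"
  obtains f' where "\<And>x. x \<in> N \<Longrightarrow> (f has_derivative f' x) (at x)" "\<And>v. Ck_on k N (\<lambda>x. f' x v)"
  using assms by (intro that[of "\<lambda>x. frechet_derivative f (at x)"]) (auto simp: frechet_derivative_works)

lemma Ck_on_const: "open N \<Longrightarrow> Ck_on k N (\<lambda>x. c)"
  by (induction k arbitrary: c) (auto intro!: Ck_on_SucI[where f'="\<lambda>x v. 0"])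

lemma Ck_on_linear: "open N \<Longrightarrow> bounded_linear L \<Longrightarrow> Ck_on k N L"
  by (cases k)
    (auto intro!: Ck_on_SucI[where f'="\<lambda>x. L"] Ck_on_const bounded_linear_imp_has_derivative
      simp: linear_continuous_on simp del: Ck_on.simps(2))

lemma Ck_on_add: "open N \<Longrightarrow> Ck_on k N f \<Longrightarrow> Ck_on k N g \<Longrightarrow> Ck_on k N (\<lambda>x. f x + g x)"
proof (induction k arbitrary: f g)
  case (Suc k)
  obtain f' where "\<And>x. x \<in> N \<Longrightarrow> (f has_derivative f' x) (at x)" "\<And>v. Ck_on k N (\<lambda>x. f' x v)"
    by (rule Ck_on_SucD[OF Suc.prems(2)]) metis
  moreover obtain g' where "\<And>x. x \<in> N \<Longrightarrow> (g has_derivative g' x) (at x)" "\<And>v. Ck_on k N (\<lambda>x. g' x v)"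
    by (rule Ck_on_SucD[OF Suc.prems(3)]) metis
  ultimately show ?case using Suc
    by (intro Ck_on_SucI[where f'="\<lambda>x v. f' x v + g' x v"]) (auto intro!: has_derivative_add simp del: Ck_on.simps)
qed (auto intro: continuous_on_add)

lemma Ck_on_sum:
  assumes "open N" "finite I" "\<And>i. i \<in> I \<Longrightarrow> Ck_on k N (f i)"
  shows "Ck_on k N (\<lambda>x. \<Sum>i\<in>I. f i x)"
  using assms(2,3)
  by (induction I rule: finite_induct) (auto intro!: Ck_on_const Ck_on_add assms(1))

lemma Ck_on_bilinear:
  assumes B: "bounded_bilinear B" and N: "open N"
  shows "Ck_on k N f \<Longrightarrow> Ck_on k N g \<Longrightarrow> Ck_on k N (\<lambda>x. B (f x) (g x))"
proof (induction k arbitrary: f g)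
  case 0
  then show ?case using bounded_bilinear.continuous_on[OF B] by auto
next
  case (Suc k)
  obtain f' where f': "\<And>x. x \<in> N \<Longrightarrow> (f has_derivative f' x) (at x)" "\<And>v. Ck_on k N (\<lambda>x. f' x v)"
    by (rule Ck_on_SucD[OF Suc.prems(1)]) metis
  obtain g' where g': "\<And>x. x \<in> N \<Longrightarrow> (g has_derivative g' x) (at x)" "\<And>v. Ck_on k N (\<lambda>x. g' x v)"
    by (rule Ck_on_SucD[OF Suc.prems(2)]) metis
  show ?case
  proof (rule Ck_on_SucI[OF N, where f'="\<lambda>x v. B (f x) (g' x v) + B (f' x v) (g x)"])
    show "((\<lambda>x. B (f x) (g x)) has_derivative (\<lambda>v. B (f x) (g' x v) + B (f' x v) (g x))) (at x)"
      if "x \<in> N" for x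
      by (rule bounded_bilinear.FDERIV[OF B f'(1)[OF that] g'(1)[OF that]])
    show "Ck_on k N (\<lambda>x. B (f x) (g' x v) + B (f' x v) (g x))" for v
      using Ck_on_pred[OF Suc.prems(1)] Ck_on_pred[OF Suc.prems(2)] f'(2) g'(2)
      by (intro Ck_on_add[OF N] Suc.IH)
  qed
qed

text \<open>By the chain rule the directional derivative of \<open>g \<circ> f\<close> along \<open>v\<close> is a sum, over a basis, of
  products of a component of the derivative of \<open>f\<close> along \<open>v\<close> with a partial derivative of \<open>g\<close>
  at \<open>f x\<close>, so that the induction on \<open>k\<close> closes.\<close>

lemma Ck_on_compose:
  assumes N: "open N" and M: "open M" and sub: "f ` N \<subseteq> M"
  shows "Ck_on k N f \<Longrightarrow> Ck_on k M g \<Longrightarrow> Ck_on k N (\<lambda>x. g (f x))"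
proof (induction k arbitrary: g)
  case 0
  then show ?case using continuous_on_compose2[of M g N f] sub by auto
next
  case (Suc k)
  obtain f' where f': "\<And>x. x \<in> N \<Longrightarrow> (f has_derivative f' x) (at x)" "\<And>v. Ck_on k N (\<lambda>x. f' x v)"
    by (rule Ck_on_SucD[OF Suc.prems(1)]) metis
  obtain g' where g': "\<And>x. x \<in> M \<Longrightarrow> (g has_derivative g' x) (at x)" "\<And>v. Ck_on k M (\<lambda>x. g' x v)"
    by (rule Ck_on_SucD[OF Suc.prems(2)]) metis
  have fk: "Ck_on k N f" by (rule Ck_on_pred[OF Suc.prems(1)])
  show ?case
  proof (rule Ck_on_SucI[OF N, where f'="\<lambda>x v. \<Sum>b\<in>Basis. (f' x v \<bullet> b) *\<^sub>R g' (f x) b"])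
    fix x assume x: "x \<in> N"
    then have fx: "f x \<in> M" using sub by auto
    have der: "((\<lambda>x. g (f x)) has_derivative (\<lambda>v. g' (f x) (f' x v))) (at x)"
      by (rule has_derivative_compose[OF f'(1)[OF x] g'(1)[OF fx]])
    have rep: "g' (f x) w = (\<Sum>b\<in>Basis. (w \<bullet> b) *\<^sub>R g' (f x) b)" for w
    proof -
      have lin: "linear (g' (f x))" by (rule has_derivative_linear[OF g'(1)[OF fx]])
      have "g' (f x) w = g' (f x) (\<Sum>b\<in>Basis. (w \<bullet> b) *\<^sub>R b)"
        by (simp add: euclidean_representation)
      also have "\<dots> = (\<Sum>b\<in>Basis. (w \<bullet> b) *\<^sub>R g' (f x) b)"
        unfolding linear_sum[OF lin] linear_cmul[OF lin] ..
      finally show ?thesis .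
    qed
    show "((\<lambda>x. g (f x)) has_derivative (\<lambda>v. \<Sum>b\<in>Basis. (f' x v \<bullet> b) *\<^sub>R g' (f x) b)) (at x)"
      by (rule has_derivative_eq_rhs[OF der]) (rule ext, rule rep)
  next
    fix v
    have "Ck_on k N (\<lambda>x. f' x v \<bullet> b)" for b
      by (rule Ck_on_bilinear[OF bounded_bilinear_inner N f'(2) Ck_on_const[OF N]])
    moreover have "Ck_on k N (\<lambda>x. g' (f x) b)" for b
      by (rule Suc.IH[OF fk g'(2)])
    ultimately show "Ck_on k N (\<lambda>x. \<Sum>b\<in>Basis. (f' x v \<bullet> b) *\<^sub>R g' (f x) b)"
      by (intro Ck_on_sum[OF N] Ck_on_bilinear[OF bounded_bilinear_scaleR N]) auto
  qed
qed

lemma Ck_on_Pair: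
  assumes N: "open N" and "Ck_on k N f" "Ck_on k N g"
  shows "Ck_on k N (\<lambda>x. (f x, g x))"
proof -
  have "Ck_on k N (\<lambda>x. (f x, 0) + (0, g x))"
  proof (rule Ck_on_add[OF N])
    show "Ck_on k N (\<lambda>x. (f x, 0))"
      by (rule Ck_on_compose[OF N open_UNIV _ assms(2) Ck_on_linear])
        (auto intro!: bounded_linear_Pair bounded_linear_ident bounded_linear_zero)
    show "Ck_on k N (\<lambda>x. (0, g x))"
      by (rule Ck_on_compose[OF N open_UNIV _ assms(3) Ck_on_linear])
        (auto intro!: bounded_linear_Pair bounded_linear_ident bounded_linear_zero)
  qed
  then show ?thesis by simp
qed

lemma Ck_on_sin_cos: "Ck_on k UNIV (\<lambda>x::real. a * sin x + b * cos x)"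
proof (induction k arbitrary: a b)
  case 0
  then show ?case by (auto intro!: continuous_intros)
next
  case (Suc k)
  have "Ck_on k UNIV (\<lambda>x::real. (- b * v) * sin x + (a * v) * cos x)" for v
    by (rule Suc)
  then have "Ck_on k UNIV (\<lambda>x::real. (a * cos x - b * sin x) * v)" for v
    by (rule Ck_on_cong[rotated 2]) (auto simp: algebra_simps)
  then show ?case
    by (intro Ck_on_SucI[where f'="\<lambda>x v. (a * cos x - b * sin x) * v"])
      (auto intro!: derivative_eq_intros simp: algebra_simps)
qed

lemma Ck_on_powr: "Ck_on k {0<..} (\<lambda>x::real. c * x powr a)"
proof (induction k arbitrary: a c)
  case 0
  then show ?case by (auto intro!: continuous_intros)
next
  case (Suc k)
  have "Ck_on k {0<..} (\<lambda>x::real. (c * a * v) * x powr (a - 1))" for v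
    by (rule Suc)
  moreover have "((\<lambda>x. c * x powr a) has_derivative (\<lambda>v. (c * a * v) * x powr (a - 1))) (at x)"
    if "x > 0" for x :: real
  proof -
    have "((\<lambda>x. c * x powr a) has_field_derivative c * (a * x powr (a - 1))) (at x)"
      using that by (intro DERIV_cmult has_real_derivative_powr)
    then show ?thesis
      by (rule has_derivative_eq_rhs[OF has_field_derivative_imp_has_derivative]) (auto simp: algebra_simps)
  qed
  ultimately show ?case
    by (intro Ck_on_SucI[where f'="\<lambda>x v. (c * a * v) * x powr (a - 1)"]) auto
qed

lemma smooth_onI_open:
  "open S \<Longrightarrow> (\<And>k. Ck_on k S f) \<Longrightarrow> smooth_on S f"
  unfolding smooth_on_def by blast

lemma smooth_onE:
  assumes "smooth_on S f" "x \<in> S"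
  obtains N F where "open N" "x \<in> N" "\<And>k. Ck_on k N F" "\<And>y. y \<in> S \<Longrightarrow> y \<in> N \<Longrightarrow> F y = f y"
proof -
  have "\<exists>N F. open N \<and> x \<in> N \<and> (\<forall>k. Ck_on k N F) \<and> (\<forall>y\<in>S \<inter> N. F y = f y)"
    using assms(1)[unfolded smooth_on_def] assms(2) by (rule bspec)
  then obtain N F where "open N \<and> x \<in> N \<and> (\<forall>k. Ck_on k N F) \<and> (\<forall>y\<in>S \<inter> N. F y = f y)"
    by (elim exE)
  then show ?thesis by (intro that[of N F]) auto
qed

lemma smooth_on_subset:
  assumes "smooth_on S f" "T \<subseteq> S"
  shows "smooth_on T f"
  unfolding smooth_on_def
proof
  fix x assume "x \<in> T"
  then have "x \<in> S" using assms(2) by auto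
  from smooth_onE[OF assms(1) this]
  obtain N F where "open N" "x \<in> N" "\<And>k. Ck_on k N F" "\<And>y. y \<in> S \<Longrightarrow> y \<in> N \<Longrightarrow> F y = f y" by metis
  then show "\<exists>N F. open N \<and> x \<in> N \<and> (\<forall>k. Ck_on k N F) \<and> (\<forall>y\<in>T \<inter> N. F y = f y)"
    using assms(2) by (intro exI[of _ N] exI[of _ F]) auto
qed

lemma smooth_on_cong:
  assumes "\<And>x. x \<in> S \<Longrightarrow> f x = g x" "smooth_on S f"
  shows "smooth_on S g"
  unfolding smooth_on_def
proof
  fix x assume "x \<in> S"
  from smooth_onE[OF assms(2) this]
  obtain N F where "open N" "x \<in> N" "\<And>k. Ck_on k N F" "\<And>y. y \<in> S \<Longrightarrow> y \<in> N \<Longrightarrow> F y = f y" by metis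
  then show "\<exists>N F. open N \<and> x \<in> N \<and> (\<forall>k. Ck_on k N F) \<and> (\<forall>y\<in>S \<inter> N. F y = g y)"
    using assms(1) by (intro exI[of _ N] exI[of _ F]) auto
qed

lemma smooth_on_local:
  assumes "\<And>x. x \<in> S \<Longrightarrow> \<exists>N. open N \<and> x \<in> N \<and> smooth_on (S \<inter> N) f"
  shows "smooth_on S f"
  unfolding smooth_on_def
proof
  fix x assume x: "x \<in> S"
  obtain N where N: "open N" "x \<in> N" "smooth_on (S \<inter> N) f" using assms[OF x] by blast
  with x obtain M F where M: "open M" "x \<in> M" "\<And>k. Ck_on k M F"
    "\<And>y. y \<in> S \<inter> N \<Longrightarrow> y \<in> M \<Longrightarrow> F y = f y"
    by (metis IntI smooth_onE)
  then show "\<exists>N F. open N \<and> x \<in> N \<and> (\<forall>k. Ck_on k N F) \<and> (\<forall>y\<in>S \<inter> N. F y = f y)"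
    using N by (intro exI[of _ "N \<inter> M"] exI[of _ F]) (auto intro: Ck_on_subset)
qed

lemma smooth_on_compose:
  assumes f: "smooth_on S f" and g: "smooth_on T g" and sub: "g ` T \<subseteq> S"
  shows "smooth_on T (\<lambda>x. f (g x))"
  unfolding smooth_on_def
proof
  fix x assume x: "x \<in> T"
  obtain N G where N: "open N" "x \<in> N" "\<And>k. Ck_on k N G" "\<And>y. y \<in> T \<Longrightarrow> y \<in> N \<Longrightarrow> G y = g y"
    by (rule smooth_onE[OF g x]) metis
  have "g x \<in> S" using x sub by auto
  then obtain M F where M: "open M" "g x \<in> M" "\<And>k. Ck_on k M F" "\<And>y. y \<in> S \<Longrightarrow> y \<in> M \<Longrightarrow> F y = f y"
    by (rule smooth_onE[OF f]) metis
  have "continuous_on N G" using N(3)[of 0] by simp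
  then have op: "open (N \<inter> G -` M)" using N(1) M(1) by (rule continuous_open_preimage)
  show "\<exists>N F. open N \<and> x \<in> N \<and> (\<forall>k. Ck_on k N F) \<and> (\<forall>y\<in>T \<inter> N. F y = f (g y))"
  proof (intro exI conjI ballI allI)
    show "open (N \<inter> G -` M)" by fact
    show "x \<in> N \<inter> G -` M" using N x M by auto
    show "Ck_on k (N \<inter> G -` M) (\<lambda>y. F (G y))" for k
      by (rule Ck_on_compose[OF op M(1)]) (use N M in \<open>auto intro: Ck_on_subset\<close>)
    show "F (G y) = f (g y)" if "y \<in> T \<inter> (N \<inter> G -` M)" for y
      using that N M sub by auto
  qed
qed

lemma smooth_on_const: "smooth_on S (\<lambda>x. c)"
  using smooth_on_subset[OF smooth_onI_open[OF open_UNIV Ck_on_const[OF open_UNIV]]] by blast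

lemma smooth_on_linear: "bounded_linear L \<Longrightarrow> smooth_on S L"
  using smooth_on_subset[OF smooth_onI_open[OF open_UNIV Ck_on_linear[OF open_UNIV]]] by blast

lemma smooth_on_ident: "smooth_on S (\<lambda>x. x)"
  by (rule smooth_on_linear[OF bounded_linear_ident])

lemma smooth_on_Pair:
  assumes "smooth_on S f" "smooth_on S g"
  shows "smooth_on S (\<lambda>x. (f x, g x))"
  unfolding smooth_on_def
proof
  fix x assume x: "x \<in> S"
  obtain N F where N: "open N" "x \<in> N" "\<And>k. Ck_on k N F" "\<And>y. y \<in> S \<Longrightarrow> y \<in> N \<Longrightarrow> F y = f y"
    by (rule smooth_onE[OF assms(1) x]) metis
  obtain M G where M: "open M" "x \<in> M" "\<And>k. Ck_on k M G" "\<And>y. y \<in> S \<Longrightarrow> y \<in> M \<Longrightarrow> G y = g y"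
    by (rule smooth_onE[OF assms(2) x]) metis
  show "\<exists>N F. open N \<and> x \<in> N \<and> (\<forall>k. Ck_on k N F) \<and> (\<forall>y\<in>S \<inter> N. F y = (f y, g y))"
    using N M
    by (intro exI[of _ "N \<inter> M"] exI[of _ "\<lambda>x. (F x, G x)"]) (auto intro!: Ck_on_Pair intro: Ck_on_subset)
qed

lemma smooth_on_bilinear:
  assumes "bounded_bilinear B" "smooth_on S f" "smooth_on S g"
  shows "smooth_on S (\<lambda>x. B (f x) (g x))"
proof -
  have "smooth_on UNIV (\<lambda>z. B (fst z) (snd z))"
    by (intro smooth_onI_open Ck_on_bilinear[OF assms(1)] Ck_on_linear bounded_linear_fst
        bounded_linear_snd open_UNIV)
  from smooth_on_compose[OF this smooth_on_Pair[OF assms(2,3)]] show ?thesis by simp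
qed

lemma smooth_on_add: "smooth_on S f \<Longrightarrow> smooth_on S g \<Longrightarrow> smooth_on S (\<lambda>x. f x + g x)"
  using smooth_on_compose[OF smooth_on_linear[OF bounded_linear_add[OF bounded_linear_fst bounded_linear_snd]] smooth_on_Pair, of S f g]
  by auto

lemma smooth_on_continuous: 
  assumes "smooth_on S f" shows "continuous_on S f"
  unfolding continuous_on_eq_continuous_within
proof
  fix x assume x: "x \<in> S"
  obtain N F where N: "open N" "x \<in> N" "\<And>k. Ck_on k N F" "\<And>y. y \<in> S \<Longrightarrow> y \<in> N \<Longrightarrow> F y = f y"
    by (rule smooth_onE[OF assms x]) metis
  have "continuous_on N F" using N(3)[of 0] by simp
  then have "continuous (at x within S) F"
    using N continuous_on_eq_continuous_at continuous_at_imp_continuous_at_within by blast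
  then show "continuous (at x within S) f"
    by (rule continuous_transform_within_openin[where T=S and S="S \<inter> N"])
      (use N x in \<open>auto simp: openin_open_Int\<close>)
qed

lemma smooth_on_differentiable:
  assumes "smooth_on S f" "open S" "x \<in> S" shows "f differentiable (at x)"
proof -
  obtain N F where N: "open N" "x \<in> N" "\<And>k. Ck_on k N F" "\<And>y. y \<in> S \<Longrightarrow> y \<in> N \<Longrightarrow> F y = f y"
    by (rule smooth_onE[OF assms(1,3)]) metis
  have "F differentiable (at x)" using N(3)[of 1] N(2) by simp
  then obtain D where "(F has_derivative D) (at x)" unfolding differentiable_def by blast
  then have "(f has_derivative D) (at x)"
    by (rule has_derivative_transform_within_open[of _ _ _ _ "S \<inter> N"]) (use N assms in auto)
  then show ?thesis unfolding differentiable_def by blast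
qed

section \<open>Smooth maps between manifolds\<close>

lemma manifold_chart:
  assumes "smooth_manifold A" "c \<in> A"
  shows chart_open: "open (fst c)"
    and chart_open_image: "open (snd c ` fst c)"
    and chart_cont: "continuous_on (fst c) (snd c)"
    and chart_inv_cont: "continuous_on (snd c ` fst c) (chart_inv c)"
    and chart_inv_left: "\<And>p. p \<in> fst c \<Longrightarrow> chart_inv c (snd c p) = p"
proof -
  have "homeomorphism (fst c) (snd c ` fst c) (snd c) (chart_inv c)"
    and o: "open (fst c)" "open (snd c ` fst c)"
    using assms unfolding smooth_manifold_def by blast+
  then show "continuous_on (fst c) (snd c)" "continuous_on (snd c ` fst c) (chart_inv c)"
    "\<And>p. p \<in> fst c \<Longrightarrow> chart_inv c (snd c p) = p" "open (fst c)" "open (snd c ` fst c)"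
    by (auto simp: homeomorphism_def)
qed

lemma chart_exists:
  assumes "smooth_manifold A"
  obtains c where "c \<in> A" "p \<in> fst c"
  using assms unfolding smooth_manifold_def by blast

lemma chart_at:
  assumes "smooth_manifold A"
  shows "chart_at A p \<in> A" "p \<in> fst (chart_at A p)"
proof -
  have "\<exists>c. c \<in> A \<and> p \<in> fst c" using chart_exists[OF assms] by metis
  then have "chart_at A p \<in> A \<and> p \<in> fst (chart_at A p)"
    unfolding chart_at_def by (rule someI_ex)
  then show "chart_at A p \<in> A" "p \<in> fst (chart_at A p)" by auto
qed

lemma chart_open_image_Int:
  assumes "smooth_manifold A" "c \<in> A" "open T"
  shows "open (snd c ` (fst c \<inter> T))"
proof -
  have "snd c ` (fst c \<inter> T) = snd c ` fst c \<inter> chart_inv c -` T"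
    using chart_inv_left[OF assms(1,2)] by force
  then show ?thesis
    using continuous_open_preimage[OF chart_inv_cont chart_open_image] assms by metis
qed

lemma chart_isCont:
  assumes "smooth_manifold A" "c \<in> A" "p \<in> fst c"
  shows "isCont (snd c) p" "isCont (chart_inv c) (snd c p)"
  using assms continuous_on_eq_continuous_at chart_cont chart_inv_cont chart_open chart_open_image
  by (metis, metis imageI)

lemma smooth_manifold_euclidean: "smooth_manifold (sub_atlas (UNIV :: 'a::euclidean_space set))"
  by (auto simp: smooth_manifold_def sub_atlas_def inv_id homeomorphism_def o_def id_def
      intro!: smooth_on_ident)

lemma smooth_mapD:
  assumes "smooth_map A B S f"
  shows "continuous_on S f"
    "\<And>c d. c \<in> A \<Longrightarrow> d \<in> B \<Longrightarrow>
      smooth_on (snd c ` (fst c \<inter> S \<inter> f -` fst d)) (\<lambda>u. snd d (f (chart_inv c u)))"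
  using assms unfolding smooth_map_def by (auto simp: o_def)

lemma smooth_map_subset:
  assumes "smooth_map A B S f" "T \<subseteq> S" shows "smooth_map A B T f"
  unfolding smooth_map_def
proof (intro conjI ballI)
  show "continuous_on T f" using continuous_on_subset[OF smooth_mapD(1)[OF assms(1)] assms(2)] .
  fix c d assume "c \<in> A" "d \<in> B"
  from smooth_mapD(2)[OF assms(1) this] 
  have "smooth_on (snd c ` (fst c \<inter> T \<inter> f -` fst d)) (\<lambda>u. snd d (f (chart_inv c u)))"
    by (rule smooth_on_subset) (use assms(2) in blast)
  then show "smooth_on (snd c ` (fst c \<inter> T \<inter> f -` fst d)) (snd d \<circ> f \<circ> chart_inv c)" by (simp add: o_def)
qed

lemma smooth_map_sub_atlas:
  assumes "f ` S \<subseteq> G"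
  shows "smooth_map A (sub_atlas G) S f \<longleftrightarrow> continuous_on S f \<and>
    (\<forall>c\<in>A. smooth_on (snd c ` (fst c \<inter> S)) (\<lambda>u. f (chart_inv c u)))"
proof -
  have *: "fst c \<inter> S \<inter> f -` G = fst c \<inter> S" for c using assms by auto
  show ?thesis unfolding smooth_map_def sub_atlas_def by (simp add: o_def *)
qed

lemma smooth_curve_sub_atlas:
  assumes "f ` S \<subseteq> G" "smooth_on S f"
  shows "smooth_map (sub_atlas UNIV) (sub_atlas G) S f"
  using assms smooth_map_sub_atlas[OF assms(1), of "sub_atlas UNIV"] smooth_on_continuous[OF assms(2)]
  by (simp add: sub_atlas_def inv_id)

lemma smooth_map_const: "smooth_map A B S (\<lambda>_. q)"
  by (auto simp: smooth_map_def o_def intro!: smooth_on_const)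

lemma smooth_map_ident: "smooth_manifold A \<Longrightarrow> smooth_map A A S (\<lambda>p. p)"
  unfolding smooth_map_def
proof (intro conjI ballI)
  fix c d assume A: "smooth_manifold A" "c \<in> A" "d \<in> A"
  then have "smooth_on (snd c ` (fst c \<inter> fst d)) (snd d \<circ> chart_inv c)"
    by (auto simp: smooth_manifold_def)
  then show "smooth_on (snd c ` (fst c \<inter> S \<inter> (\<lambda>p. p) -` fst d)) (snd d \<circ> (\<lambda>p. p) \<circ> chart_inv c)"
    by (rule smooth_on_subset[THEN smooth_on_cong[rotated]]) auto
qed auto

text \<open>Maps into a product with a subset of a Euclidean space, followed by a smooth map. The action of
  the structure group, its orbit maps and the inverses of local trivializations are all
  composed by this rule.\<close>

lemma smooth_map_compose_prod:
  assumes A: "smooth_manifold A" and B: "smooth_manifold B"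
    and f: "smooth_map A B S f" "f ` S \<subseteq> U"
    and b: "smooth_map A (sub_atlas G) S b" "b ` S \<subseteq> G"
    and F: "smooth_map (prod_atlas B (sub_atlas G)) C (U \<times> G) F"
  shows "smooth_map A C S (\<lambda>p. F (f p, b p))"
  unfolding smooth_map_def
proof (intro conjI ballI)
  have "continuous_on S (\<lambda>p. (f p, b p))"
    by (intro continuous_on_Pair smooth_mapD(1)[OF f(1)] smooth_mapD(1)[OF b(1)])
  then show "continuous_on S (\<lambda>p. F (f p, b p))"
    by (rule continuous_on_compose2[OF smooth_mapD(1)[OF F]]) (use f b in auto)
next
  fix c d assume c: "c \<in> A" and d: "d \<in> C"
  define T where "T = snd c ` (fst c \<inter> S \<inter> (\<lambda>p. F (f p, b p)) -` fst d)"
  have "smooth_on T (\<lambda>u. snd d (F (f (chart_inv c u), b (chart_inv c u))))"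
  proof (rule smooth_on_local)
    fix u assume "u \<in> T"
    then obtain p where p: "p \<in> fst c" "p \<in> S" "u = snd c p" by (auto simp: T_def)
    obtain e where e: "e \<in> B" "f p \<in> fst e" using chart_exists[OF B] by metis
    obtain W where W: "open W" "W \<inter> S = f -` fst e \<inter> S"
      using smooth_mapD(1)[OF f(1)] chart_open[OF B e(1)] unfolding continuous_on_open_invariant by metis
    define N where "N = snd c ` (fst c \<inter> W)"
    define pc where "pc = (fst e \<times> G, map_prod (snd e) (id :: 'e \<Rightarrow> 'e))"
    have pc: "pc \<in> prod_atlas B (sub_atlas G)"
      unfolding prod_atlas_def sub_atlas_def pc_def
      by (intro CollectI exI[of _ e] exI[of _ "(G, id)"]) (simp add: e)
    have inj: "inj_on (map_prod (snd e) id) (fst e \<times> G)"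
      by (intro map_prod_inj_on) (use chart_inv_left[OF B e(1)] in \<open>auto intro: inj_on_inverseI\<close>)
    have inv: "chart_inv pc (snd e x, y) = (x, y)" if "x \<in> fst e" "y \<in> G" for x y
      using inv_into_f_f[OF inj, of "(x, y)"] that by (simp add: pc_def)
    define H where "H = (\<lambda>u. (snd e (f (chart_inv c u)), b (chart_inv c u)))"
    have mem: "\<exists>q. u = snd c q \<and> chart_inv c u = q \<and> q \<in> fst c \<and> q \<in> S \<and> f q \<in> fst e \<and> F (f q, b q) \<in> fst d"
      if u: "u \<in> T \<inter> N" for u
    proof -
      obtain q q' where q: "q \<in> fst c" "q \<in> S" "u = snd c q" "F (f q, b q) \<in> fst d"
        "q' \<in> fst c" "q' \<in> W" "u = snd c q'"
        using u unfolding T_def N_def by blast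
      then have "q = q'" using chart_inv_left[OF A c] by metis
      then show ?thesis using q W chart_inv_left[OF A c] by blast
    qed
    have "smooth_on (T \<inter> N) H"
      unfolding H_def
    proof (rule smooth_on_Pair)
      show "smooth_on (T \<inter> N) (\<lambda>u. snd e (f (chart_inv c u)))"
        by (rule smooth_on_subset[OF smooth_mapD(2)[OF f(1) c e(1)]]) (use mem in blast)
      have "smooth_on (snd c ` (fst c \<inter> S)) (\<lambda>u. b (chart_inv c u))"
        using b c smooth_map_sub_atlas[OF b(2)] by blast
      then show "smooth_on (T \<inter> N) (\<lambda>u. b (chart_inv c u))"
        by (rule smooth_on_subset) (use mem in blast)
    qed
    moreover have "smooth_on (snd pc ` (fst pc \<inter> (U \<times> G) \<inter> F -` fst d)) (\<lambda>u. snd d (F (chart_inv pc u)))"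
      by (rule smooth_mapD(2)[OF F pc d])
    moreover have "H ` (T \<inter> N) \<subseteq> snd pc ` (fst pc \<inter> (U \<times> G) \<inter> F -` fst d)"
    proof
      fix z assume "z \<in> H ` (T \<inter> N)"
      then obtain u where u: "u \<in> T \<inter> N" "z = H u" by blast
      from mem[OF u(1)] obtain q where q: "u = snd c q" "chart_inv c u = q" "q \<in> fst c" "q \<in> S"
        "f q \<in> fst e" "F (f q, b q) \<in> fst d" by blast
      have "z = snd pc (f q, b q)" using q u by (simp add: H_def pc_def)
      moreover have "(f q, b q) \<in> fst pc \<inter> (U \<times> G) \<inter> F -` fst d"
        using q f(2) b(2) by (auto simp: pc_def)
      ultimately show "z \<in> snd pc ` (fst pc \<inter> (U \<times> G) \<inter> F -` fst d)" by blast
    qed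
    ultimately have "smooth_on (T \<inter> N) (\<lambda>u. snd d (F (chart_inv pc (H u))))"
      using smooth_on_compose[of _ "\<lambda>u. snd d (F (chart_inv pc u))"] by blast
    then have "smooth_on (T \<inter> N) (\<lambda>u. snd d (F (f (chart_inv c u), b (chart_inv c u))))"
    proof (rule smooth_on_cong[rotated])
      fix u assume "u \<in> T \<inter> N"
      from mem[OF this] obtain q where "u = snd c q" "chart_inv c u = q" "q \<in> S"
        "f q \<in> fst e" by blast
      then show "snd d (F (chart_inv pc (H u))) = snd d (F (f (chart_inv c u), b (chart_inv c u)))"
        using b(2) inv by (auto simp: H_def)
    qed
    moreover have "open N" unfolding N_def by (rule chart_open_image_Int[OF A c W(1)])
    moreover have "u \<in> N" using p e W by (auto simp: N_def)
    ultimately show "\<exists>N. open N \<and> u \<in> N \<and>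
        smooth_on (T \<inter> N) (\<lambda>u. snd d (F (f (chart_inv c u), b (chart_inv c u))))" by blast
  qed
  then show "smooth_on (snd c ` (fst c \<inter> S \<inter> (\<lambda>p. F (f p, b p)) -` fst d))
     (snd d \<circ> (\<lambda>p. F (f p, b p)) \<circ> chart_inv c)"
    by (simp add: T_def o_def)
qed

text \<open>Differentiability at a single point, in terms of charts. It is what the chain rule for
  velocities and pushforwards needs.\<close>

definition mdiff :: "('m::t2_space, 'e::euclidean_space) chart set \<Rightarrow>
    ('n::topological_space, 'f::euclidean_space) chart set \<Rightarrow> ('m \<Rightarrow> 'n) \<Rightarrow> 'm \<Rightarrow> bool" where
  "mdiff A B f p \<longleftrightarrow> isCont f p \<and> (\<forall>c\<in>A. \<forall>d\<in>B. p \<in> fst c \<and> f p \<in> fst d \<longrightarrow>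
     (\<lambda>u. snd d (f (chart_inv c u))) differentiable (at (snd c p)))"

lemma smooth_map_mdiff:
  assumes A: "smooth_manifold A" and B: "smooth_manifold B" and f: "smooth_map A B S f"
    and S: "open S" "p \<in> S"
  shows "mdiff A B f p"
  unfolding mdiff_def
proof (intro conjI ballI impI)
  show "isCont f p" using smooth_mapD(1)[OF f] S continuous_on_eq_continuous_at by blast
  fix c d assume cd: "c \<in> A" "d \<in> B" "p \<in> fst c \<and> f p \<in> fst d"
  have "open (S \<inter> f -` fst d)"
    by (rule continuous_open_preimage[OF smooth_mapD(1)[OF f] S(1) chart_open[OF B cd(2)]])
  from chart_open_image_Int[OF A cd(1) this]
  have "open (snd c ` (fst c \<inter> S \<inter> f -` fst d))" by (simp add: Int_assoc)
  then show "(\<lambda>u. snd d (f (chart_inv c u))) differentiable (at (snd c p))"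
    by (rule smooth_on_differentiable[OF smooth_mapD(2)[OF f cd(1,2)]]) (use cd S in auto)
qed

lemma mdiff_ident: "smooth_manifold A \<Longrightarrow> mdiff A A (\<lambda>p. p) p"
  by (rule smooth_map_mdiff[OF _ _ smooth_map_ident[where S=UNIV]]) auto

lemma mdiff_chain:
  assumes A: "smooth_manifold A" and B: "smooth_manifold B"
    and f: "mdiff A B f p" and g: "mdiff B C g (f p)"
    and c: "c \<in> A" "p \<in> fst c" and e: "e \<in> B" "f p \<in> fst e" and d: "d \<in> C" "g (f p) \<in> fst d"
  shows "((\<lambda>u. snd d (g (f (chart_inv c u)))) has_derivative
    (\<lambda>v. frechet_derivative (\<lambda>w. snd d (g (chart_inv e w))) (at (snd e (f p)))
       (frechet_derivative (\<lambda>u. snd e (f (chart_inv c u))) (at (snd c p)) v))) (at (snd c p))"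
proof -
  have pc: "chart_inv c (snd c p) = p" by (rule chart_inv_left[OF A c])
  have F: "((\<lambda>u. snd e (f (chart_inv c u))) has_derivative
      frechet_derivative (\<lambda>u. snd e (f (chart_inv c u))) (at (snd c p))) (at (snd c p))"
    using f c e unfolding mdiff_def frechet_derivative_works[symmetric] by blast
  have "((\<lambda>w. snd d (g (chart_inv e w))) has_derivative
      frechet_derivative (\<lambda>w. snd d (g (chart_inv e w))) (at (snd e (f p)))) (at (snd e (f p)))"
    using g d e unfolding mdiff_def frechet_derivative_works[symmetric] by blast
  then have G: "((\<lambda>w. snd d (g (chart_inv e w))) has_derivative
      frechet_derivative (\<lambda>w. snd d (g (chart_inv e w))) (at (snd e (f p))))
      (at (snd e (f (chart_inv c (snd c p)))))"
    by (simp add: pc)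
  have comp: "((\<lambda>u. snd d (g (chart_inv e (snd e (f (chart_inv c u)))))) has_derivative
    (\<lambda>v. frechet_derivative (\<lambda>w. snd d (g (chart_inv e w))) (at (snd e (f p)))
       (frechet_derivative (\<lambda>u. snd e (f (chart_inv c u))) (at (snd c p)) v))) (at (snd c p))"
    by (rule has_derivative_compose[OF F G])
  have "isCont (\<lambda>u. f (chart_inv c u)) (snd c p)"
    by (rule isCont_o2[OF chart_isCont(2)[OF A c]]) (use f pc in \<open>simp add: mdiff_def\<close>)
  then have ev: "eventually (\<lambda>u. f (chart_inv c u) \<in> fst e) (at (snd c p))"
    unfolding isCont_def pc using chart_open[OF B e(1)] e(2) topological_tendstoD by fast
  show ?thesis
  proof (rule has_derivative_transform_eventually[OF comp])
    show "\<forall>\<^sub>F u in at (snd c p). snd d (g (chart_inv e (snd e (f (chart_inv c u))))) = snd d (g (f (chart_inv c u)))"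
      using ev by eventually_elim (simp add: chart_inv_left[OF B e(1)])
  qed (use e in \<open>auto simp: pc chart_inv_left[OF B e(1)]\<close>)
qed

lemma mdiff_compose:
  assumes "smooth_manifold A" "smooth_manifold B"
    "mdiff A B f p" "mdiff B C g (f p)"
  shows "mdiff A C (\<lambda>x. g (f x)) p"
  unfolding mdiff_def
proof (intro conjI ballI impI)
  show "isCont (\<lambda>x. g (f x)) p" using assms(3,4) isCont_o2 unfolding mdiff_def by blast
  fix c d assume "c \<in> A" "d \<in> C" "p \<in> fst c \<and> g (f p) \<in> fst d"
  moreover obtain e where "e \<in> B" "f p \<in> fst e" using chart_exists[OF assms(2)] by metis
  ultimately show "(\<lambda>u. snd d (g (f (chart_inv c u)))) differentiable (at (snd c p))"
    using mdiff_chain[OF assms] unfolding differentiable_def by blast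
qed

section \<open>Tangent vectors and velocities\<close>

lemma transition_chain:
  assumes A: "smooth_manifold A" and c: "c \<in> A" "p \<in> fst c" and e: "e \<in> A" "p \<in> fst e"
    and d: "d \<in> A" "p \<in> fst d"
  shows "frechet_derivative (snd d \<circ> chart_inv c) (at (snd c p)) =
    (\<lambda>v. frechet_derivative (snd d \<circ> chart_inv e) (at (snd e p))
       (frechet_derivative (snd e \<circ> chart_inv c) (at (snd c p)) v))"
  using frechet_derivative_at[OF mdiff_chain[OF A A mdiff_ident[OF A] mdiff_ident[OF A] c e d]]
  by (simp add: o_def)

lemma transition_linear:
  assumes A: "smooth_manifold A" and c: "c \<in> A" "p \<in> fst c" and d: "d \<in> A" "p \<in> fst d"
  shows "linear (frechet_derivative (snd d \<circ> chart_inv c) (at (snd c p)))"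
  using mdiff_ident[OF A, of p] c d
  by (intro linear_frechet_derivative) (auto simp: mdiff_def o_def)

lemma transition_self:
  assumes A: "smooth_manifold A" and c: "c \<in> A" "p \<in> fst c"
  shows "frechet_derivative (snd c \<circ> chart_inv c) (at (snd c p)) = (\<lambda>v. v)"
proof -
  have "((\<lambda>u. u) has_derivative (\<lambda>v. v)) (at (snd c p))" by (rule has_derivative_ident)
  then have "((snd c \<circ> chart_inv c) has_derivative (\<lambda>v. v)) (at (snd c p))"
    by (rule has_derivative_transform_within_open[OF _ chart_open_image[OF A c(1)]])
      (use c chart_inv_left[OF A c(1)] in auto)
  from frechet_derivative_at[OF this] show ?thesis by simp
qed

lemma tangent_spaceD:
  assumes "v \<in> tangent_space A p"
  shows "\<And>c. \<not> (c \<in> A \<and> p \<in> fst c) \<Longrightarrow> v c = 0"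
    "\<And>c d. c \<in> A \<Longrightarrow> p \<in> fst c \<Longrightarrow> d \<in> A \<Longrightarrow> p \<in> fst d \<Longrightarrow>
      v d = frechet_derivative (snd d \<circ> chart_inv c) (at (snd c p)) (v c)"
  using assms unfolding tangent_space_def by blast+

lemma tangent_spaceI:
  assumes "\<And>c. \<not> (c \<in> A \<and> p \<in> fst c) \<Longrightarrow> v c = 0"
    "\<And>c d. c \<in> A \<Longrightarrow> p \<in> fst c \<Longrightarrow> d \<in> A \<Longrightarrow> p \<in> fst d \<Longrightarrow>
      v d = frechet_derivative (snd d \<circ> chart_inv c) (at (snd c p)) (v c)"
  shows "v \<in> tangent_space A p"
  using assms unfolding tangent_space_def by blast

lemma coord_vec_tangent:
  assumes A: "smooth_manifold A" and c: "c \<in> A" "p \<in> fst c"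
  shows "coord_vec A c p \<xi> \<in> tangent_space A p" "coord_vec A c p \<xi> c = \<xi>"
proof -
  show "coord_vec A c p \<xi> c = \<xi>" using c transition_self[OF A c] by (simp add: coord_vec_def)
  show "coord_vec A c p \<xi> \<in> tangent_space A p"
  proof (rule tangent_spaceI)
    fix e d assume "e \<in> A" "p \<in> fst e" "d \<in> A" "p \<in> fst d"
    then show "coord_vec A c p \<xi> d =
        frechet_derivative (snd d \<circ> chart_inv e) (at (snd e p)) (coord_vec A c p \<xi> e)"
      using transition_chain[OF A c, of e d] by (simp add: coord_vec_def)
  qed (auto simp: coord_vec_def)
qed

lemma tangent_eq_coord_vec:
  assumes A: "smooth_manifold A" and c: "c \<in> A" "p \<in> fst c" and v: "v \<in> tangent_space A p"
  shows "v = coord_vec A c p (v c)"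
proof
  show "v d = coord_vec A c p (v c) d" for d
    using tangent_spaceD[OF v] c unfolding coord_vec_def by meson
qed

lemma tangent_eqI:
  assumes "smooth_manifold A" "c \<in> A" "p \<in> fst c" "v \<in> tangent_space A p" "w \<in> tangent_space A p"
    "v c = w c"
  shows "v = w"
  using tangent_eq_coord_vec assms by metis

lemma tangent_add:
  assumes A: "smooth_manifold A" and "v \<in> tangent_space A p" "w \<in> tangent_space A p"
  shows "(\<lambda>c. v c + w c) \<in> tangent_space A p"
proof (rule tangent_spaceI)
  fix c d assume "c \<in> A" "p \<in> fst c" "d \<in> A" "p \<in> fst d"
  then show "v d + w d = frechet_derivative (snd d \<circ> chart_inv c) (at (snd c p)) (v c + w c)"
    using tangent_spaceD(2)[OF assms(2)] tangent_spaceD(2)[OF assms(3)]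
      linear_add[OF transition_linear[OF A, of c p d]] by metis
qed (use tangent_spaceD(1)[OF assms(2)] tangent_spaceD(1)[OF assms(3)] in simp)

lemma tangent_scale:
  assumes A: "smooth_manifold A" and "v \<in> tangent_space A p"
  shows "(\<lambda>c. r *\<^sub>R v c) \<in> tangent_space A p"
proof (rule tangent_spaceI)
  fix c d assume "c \<in> A" "p \<in> fst c" "d \<in> A" "p \<in> fst d"
  then show "r *\<^sub>R v d = frechet_derivative (snd d \<circ> chart_inv c) (at (snd c p)) (r *\<^sub>R v c)"
    using tangent_spaceD(2)[OF assms(2)] linear_cmul[OF transition_linear[OF A, of c p d]] by metis
qed (use tangent_spaceD(1)[OF assms(2)] in simp)

lemma tangent_zero: "smooth_manifold A \<Longrightarrow> (\<lambda>c. 0) \<in> tangent_space A p"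
  by (rule tangent_spaceI) (metis linear_0 transition_linear)+

lemma tderiv_chart:
  assumes A: "smooth_manifold A" and f: "mdiff A (sub_atlas UNIV) f p" 
    and c: "c \<in> A" "p \<in> fst c" and v: "v \<in> tangent_space A p"
  shows "tderiv A f p v = frechet_derivative (f \<circ> chart_inv c) (at (snd c p)) (v c)"
proof -
  note cp = chart_at[OF A, of p]
  have "v (chart_at A p) = frechet_derivative (snd (chart_at A p) \<circ> chart_inv c) (at (snd c p)) (v c)"
    by (rule tangent_spaceD(2)[OF v c cp])
  moreover have "(UNIV, id) \<in> sub_atlas UNIV" by (simp add: sub_atlas_def)
  moreover have "frechet_derivative (f \<circ> chart_inv c) (at (snd c p)) =
    (\<lambda>v. frechet_derivative (f \<circ> chart_inv (chart_at A p)) (at (snd (chart_at A p) p))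
       (frechet_derivative (snd (chart_at A p) \<circ> chart_inv c) (at (snd c p)) v))"
    using frechet_derivative_at[OF mdiff_chain[OF A A mdiff_ident[OF A] f c cp, of "(UNIV, id)"]]
    by (simp add: sub_atlas_def comp_def)
  ultimately show ?thesis unfolding tderiv_def Let_def by simp
qed

lemma tderiv_linear:
  assumes A: "smooth_manifold A" and f: "mdiff A (sub_atlas UNIV) f p" 
  shows "tderiv A f p (\<lambda>c. v c + w c) = tderiv A f p v + tderiv A f p w"
    and "tderiv A f p (\<lambda>c. r *\<^sub>R v c) = r *\<^sub>R tderiv A f p v"
proof -
  have "(f \<circ> chart_inv (chart_at A p)) differentiable at (snd (chart_at A p) p)"
    using f chart_at[OF A, of p] by (simp add: mdiff_def sub_atlas_def o_def)
  from linear_frechet_derivative[OF this]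
  show "tderiv A f p (\<lambda>c. v c + w c) = tderiv A f p v + tderiv A f p w"
    and "tderiv A f p (\<lambda>c. r *\<^sub>R v c) = r *\<^sub>R tderiv A f p v"
    unfolding tderiv_def Let_def by (rule linear_add, rule linear_cmul)
qed

lemma mdiff_chart:
  assumes A: "smooth_manifold A" and B: "smooth_manifold B" and f: "mdiff A B f p"
    and d: "d \<in> B" "f p \<in> fst d"
  shows "mdiff A (sub_atlas UNIV) (\<lambda>q. snd d (f q)) p"
proof -
  have "isCont (\<lambda>q. snd d (f q)) p"
    using f chart_isCont(1)[OF B d] isCont_o2 unfolding mdiff_def by blast
  then show ?thesis using f d by (auto simp: mdiff_def sub_atlas_def)
qed

lemma pushforward_linear:
  assumes A: "smooth_manifold A" and B: "smooth_manifold B" and f: "mdiff A B f p" 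
  shows "pushforward A B f p (\<lambda>c. v c + w c) = (\<lambda>d. pushforward A B f p v d + pushforward A B f p w d)"
    and "pushforward A B f p (\<lambda>c. r *\<^sub>R v c) = (\<lambda>d. r *\<^sub>R pushforward A B f p v d)"
  using tderiv_linear[OF A mdiff_chart[OF A B f]]
  by (auto simp: pushforward_def fun_eq_iff o_def)

lemma curve_frechet:
  assumes A: "smooth_manifold A" and \<gamma>: "mdiff (sub_atlas UNIV) A \<gamma> t" and c: "c \<in> A" "\<gamma> t \<in> fst c"
  shows "frechet_derivative (\<lambda>s. snd c (\<gamma> s)) (at t) = (\<lambda>r. r *\<^sub>R velocity A \<gamma> t c)"
    "((\<lambda>s. snd c (\<gamma> s)) has_vector_derivative velocity A \<gamma> t c) (at t)"
proof -
  have d: "(\<lambda>s. snd c (\<gamma> s)) differentiable (at t)"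
    using \<gamma> c by (auto simp: mdiff_def sub_atlas_def inv_id)
  show "frechet_derivative (\<lambda>s. snd c (\<gamma> s)) (at t) = (\<lambda>r. r *\<^sub>R velocity A \<gamma> t c)"
    using frechet_derivative_eq_vector_derivative[OF d] c by (simp add: velocity_def o_def)
  show "((\<lambda>s. snd c (\<gamma> s)) has_vector_derivative velocity A \<gamma> t c) (at t)"
    using vector_derivative_works[THEN iffD1, OF d] c by (simp add: velocity_def o_def)
qed

lemma velocity_chain:
  assumes A: "smooth_manifold A" and \<gamma>: "mdiff (sub_atlas UNIV) A \<gamma> t" and f: "mdiff A B f (\<gamma> t)"
    and c: "c \<in> A" "\<gamma> t \<in> fst c" and d: "d \<in> B" "f (\<gamma> t) \<in> fst d"
  shows "velocity B (\<lambda>s. f (\<gamma> s)) t d =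
    frechet_derivative (\<lambda>u. snd d (f (chart_inv c u))) (at (snd c (\<gamma> t))) (velocity A \<gamma> t c)"
proof -
  have u: "(UNIV, id) \<in> sub_atlas UNIV" "t \<in> fst (UNIV, id)" by (auto simp: sub_atlas_def)
  have "((\<lambda>s. snd d (f (\<gamma> s))) has_derivative
    (\<lambda>v. frechet_derivative (\<lambda>u. snd d (f (chart_inv c u))) (at (snd c (\<gamma> t)))
       (v *\<^sub>R velocity A \<gamma> t c))) (at t)"
    using mdiff_chain[OF smooth_manifold_euclidean A \<gamma> f u c d] curve_frechet(1)[OF A \<gamma> c]
    by (simp add: inv_id)
  moreover have "linear (frechet_derivative (\<lambda>u. snd d (f (chart_inv c u))) (at (snd c (\<gamma> t))))"
    using f c d by (intro linear_frechet_derivative) (auto simp: mdiff_def)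
  ultimately have "((\<lambda>s. snd d (f (\<gamma> s))) has_vector_derivative
    (frechet_derivative (\<lambda>u. snd d (f (chart_inv c u))) (at (snd c (\<gamma> t)))
       (velocity A \<gamma> t c))) (at t)"
    by (simp add: has_vector_derivative_def linear_cmul)
  from vector_derivative_at[OF this] show ?thesis using d by (simp add: velocity_def o_def)
qed

lemma velocity_tangent:
  assumes A: "smooth_manifold A" and \<gamma>: "mdiff (sub_atlas UNIV) A \<gamma> t"
  shows "velocity A \<gamma> t \<in> tangent_space A (\<gamma> t)"
proof -
  have "velocity A \<gamma> t d = frechet_derivative (snd d \<circ> chart_inv c) (at (snd c (\<gamma> t))) (velocity A \<gamma> t c)"
    if "c \<in> A" "d \<in> A" "\<gamma> t \<in> fst c" "\<gamma> t \<in> fst d" for c d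
    using velocity_chain[OF A \<gamma> mdiff_ident[OF A] that(1,3,2,4)] by (simp add: o_def)
  moreover have "velocity A \<gamma> t c = 0" if "\<not> (c \<in> A \<and> \<gamma> t \<in> fst c)" for c
    using that unfolding velocity_def by meson
  ultimately show ?thesis by (intro tangent_spaceI)
qed

lemma pushforward_velocity:
  assumes A: "smooth_manifold A" and \<gamma>: "mdiff (sub_atlas UNIV) A \<gamma> t"
    and f: "mdiff A B f (\<gamma> t)"
  shows "pushforward A B f (\<gamma> t) (velocity A \<gamma> t) = velocity B (\<lambda>s. f (\<gamma> s)) t"
proof
  fix d
  show "pushforward A B f (\<gamma> t) (velocity A \<gamma> t) d = velocity B (\<lambda>s. f (\<gamma> s)) t d"
  proof (cases "d \<in> B \<and> f (\<gamma> t) \<in> fst d")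
    case True
    then show ?thesis using velocity_chain[OF A \<gamma> f chart_at[OF A]]
      by (simp add: pushforward_def tderiv_def Let_def o_def)
  next
    case False
    then show ?thesis by (auto simp: pushforward_def velocity_def)
  qed
qed

lemma tderiv_velocity:
  assumes A: "smooth_manifold A" and \<gamma>: "mdiff (sub_atlas UNIV) A \<gamma> t"
    and f: "mdiff A (sub_atlas UNIV) f (\<gamma> t)"
  shows "tderiv A f (\<gamma> t) (velocity A \<gamma> t) = vector_derivative (\<lambda>s. f (\<gamma> s)) (at t)"
  using velocity_chain[OF A \<gamma> f chart_at[OF A], of "(UNIV, id)"]
  by (simp add: tderiv_def Let_def o_def sub_atlas_def velocity_def)

lemma velocity_cong:
  fixes A :: "('m::topological_space, 'e::euclidean_space) chart set"
  assumes "open N" "t \<in> N" "\<And>s. s \<in> N \<Longrightarrow> \<gamma> s = \<delta> s"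
  shows "velocity A \<gamma> t = velocity A \<delta> t"
proof -
  have "vector_derivative (\<lambda>s. f (\<gamma> s)) (at t) = vector_derivative (\<lambda>s. f (\<delta> s)) (at t)"
    for f :: "'m \<Rightarrow> 'e"
    by (rule vector_derivative_cong_eq) (use assms in \<open>auto simp: eventually_nhds\<close>)
  moreover have "\<gamma> t = \<delta> t" using assms by simp
  ultimately show ?thesis by (simp add: velocity_def o_def fun_eq_iff)
qed

text \<open>The line through \<open>snd c p\<close> in direction \<open>\<xi>\<close> is traversed with the bounded parameter
  \<open>\<delta> sin (t / \<delta>)\<close>, so that the curve is defined for all times and stays in any given
  neighbourhood of \<open>p\<close>.\<close>

lemma tangent_curve:
  assumes A: "smooth_manifold A" and v: "v \<in> tangent_space A p" and U: "open U" "p \<in> U"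
  obtains \<gamma> where "smooth_map (sub_atlas UNIV) A UNIV \<gamma>" "\<gamma> 0 = p" "velocity A \<gamma> 0 = v" "range \<gamma> \<subseteq> U"
proof -
  define c where "c = chart_at A p"
  have c: "c \<in> A" "p \<in> fst c" unfolding c_def by (rule chart_at[OF A])+
  define \<xi> where "\<xi> = v c"
  define x where "x = snd c p"
  have "open (snd c ` (fst c \<inter> U))" by (rule chart_open_image_Int[OF A c(1) U(1)])
  moreover have "x \<in> snd c ` (fst c \<inter> U)" using c U unfolding x_def by (intro imageI IntI)
  ultimately obtain e where e: "e > 0" "ball x e \<subseteq> snd c ` (fst c \<inter> U)"
    by (rule openE)
  define \<delta> where "\<delta> = e / (norm \<xi> + 1)"
  have \<delta>: "\<delta> > 0" "\<delta> * norm \<xi> < e"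
  proof -
    show "\<delta> > 0" using e by (simp add: \<delta>_def add_nonneg_pos)
    have "e * norm \<xi> < e * (norm \<xi> + 1)" using e by simp
    then show "\<delta> * norm \<xi> < e" by (simp add: \<delta>_def divide_less_eq add_nonneg_pos)
  qed
  define l where "l t = x + (\<delta> * sin (t / \<delta>)) *\<^sub>R \<xi>" for t
  define \<gamma> where "\<gamma> t = chart_inv c (l t)" for t
  have lin: "l t \<in> snd c ` (fst c \<inter> U)" for t
  proof -
    have "\<bar>\<delta> * sin (t / \<delta>)\<bar> * norm \<xi> \<le> \<delta> * norm \<xi>"
      using \<delta>(1) abs_sin_le_one[of "t / \<delta>"]
      by (intro mult_right_mono) (auto simp: abs_mult)
    then have "dist x (l t) < e" using \<delta> by (simp add: l_def dist_norm)
    then show ?thesis using e by auto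
  qed
  have \<gamma>: "\<gamma> t \<in> fst c \<inter> U" "snd c (\<gamma> t) = l t" for t
    using lin[of t] chart_inv_left[OF A c(1)] by (auto simp: \<gamma>_def)
  have sl: "smooth_on S l" for S
  proof -
    have s: "smooth_on UNIV (\<lambda>t::real. sin t)"
      using Ck_on_sin_cos[of _ 1 0] by (intro smooth_onI_open) auto
    have "smooth_on S (\<lambda>t. sin (t / \<delta>))"
      by (rule smooth_on_compose[OF s smooth_on_linear]) (auto intro: bounded_linear_divide)
    then have "smooth_on S (\<lambda>t. \<delta> * sin (t / \<delta>))"
      by (rule smooth_on_bilinear[OF bounded_bilinear_mult smooth_on_const])
    then show ?thesis unfolding l_def
      by (intro smooth_on_add smooth_on_const smooth_on_bilinear[OF bounded_bilinear_scaleR])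
  qed
  have "smooth_map (sub_atlas UNIV) A UNIV \<gamma>"
    unfolding smooth_map_def
  proof (intro conjI ballI)
    show "continuous_on UNIV \<gamma>" unfolding \<gamma>_def
      by (rule continuous_on_compose2[OF chart_inv_cont[OF A c(1)] smooth_on_continuous[OF sl]])
        (use lin in auto)
  next
    fix u :: "(real, real) chart" and d assume ud: "u \<in> sub_atlas UNIV" "d \<in> A"
    have u: "u = (UNIV, id)" using ud by (simp add: sub_atlas_def)
    have "smooth_on (snd c ` (fst c \<inter> fst d)) (\<lambda>w. snd d (chart_inv c w))"
      using A c ud by (auto simp: smooth_manifold_def o_def)
    from smooth_on_compose[OF this sl]
    have "smooth_on (\<gamma> -` fst d) (\<lambda>t. snd d (\<gamma> t))"
      unfolding \<gamma>_def[symmetric] using \<gamma> by (metis IntE IntI image_eqI image_subsetI vimageE)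
    then show "smooth_on (snd u ` (fst u \<inter> UNIV \<inter> \<gamma> -` fst d)) (snd d \<circ> \<gamma> \<circ> chart_inv u)"
      by (simp add: u inv_id o_def)
  qed
  moreover have g0: "\<gamma> 0 = p" using chart_inv_left[OF A c] by (simp add: \<gamma>_def l_def x_def)
  moreover have "velocity A \<gamma> 0 = v"
  proof -
    have md: "mdiff (sub_atlas UNIV) A \<gamma> 0"
      using smooth_map_mdiff[OF smooth_manifold_euclidean A \<open>smooth_map (sub_atlas UNIV) A UNIV \<gamma>\<close>] by auto
    have "(l has_vector_derivative \<xi>) (at 0)"
      unfolding l_def using \<delta> by (auto intro!: derivative_eq_intros)
    from vector_derivative_at[OF this] have "velocity A \<gamma> 0 c = \<xi>"
      using c g0 \<gamma> by (simp add: velocity_def o_def)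
    then show ?thesis
      using tangent_eqI[OF A c _ v] velocity_tangent[OF A md] g0 by (simp add: \<xi>_def)
  qed
  moreover have "range \<gamma> \<subseteq> U" using \<gamma> by auto
  ultimately show ?thesis by (rule that)
qed

lemma pushforward_tangent:
  assumes A: "smooth_manifold A" and B: "smooth_manifold B" and f: "mdiff A B f p"
    and v: "v \<in> tangent_space A p"
  shows "pushforward A B f p v \<in> tangent_space B (f p)"
proof -
  obtain \<gamma> where \<gamma>: "smooth_map (sub_atlas UNIV) A UNIV \<gamma>" "\<gamma> 0 = p" "velocity A \<gamma> 0 = v"
    using tangent_curve[OF A v, of UNIV] by auto
  have md: "mdiff (sub_atlas UNIV) A \<gamma> 0"
    using smooth_map_mdiff[OF smooth_manifold_euclidean A \<gamma>(1)] by auto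
  have "mdiff (sub_atlas UNIV) B (\<lambda>s. f (\<gamma> s)) 0"
    using mdiff_compose[OF smooth_manifold_euclidean A md] f \<gamma> by simp
  from velocity_tangent[OF B this] show ?thesis
    using pushforward_velocity[OF A md, of B f] f \<gamma> by simp
qed

lemma sub_tangent_space_subset:
  assumes A: "smooth_manifold A"
  shows "sub_tangent_space A S p \<subseteq> tangent_space A p"
proof
  fix v assume "v \<in> sub_tangent_space A S p"
  then obtain \<gamma> e where "v = velocity A \<gamma> 0" "\<gamma> 0 = p" "e > 0"
    "smooth_map (sub_atlas UNIV) A {-e<..<e} \<gamma>" by (auto simp: sub_tangent_space_def)
  then show "v \<in> tangent_space A p"
    using velocity_tangent[OF A smooth_map_mdiff[OF smooth_manifold_euclidean A, of "{-e<..<e}" \<gamma> 0]]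
    by auto
qed

lemma smooth_on_curve:
  assumes A: "smooth_manifold A" and \<gamma>: "smooth_map (sub_atlas UNIV) A UNIV \<gamma>"
    and f: "smooth_fun A UNIV f"
  shows "smooth_on UNIV (\<lambda>t::real. f (\<gamma> t))"
proof (rule smooth_on_local)
  fix t :: real
  obtain c where c: "c \<in> A" "\<gamma> t \<in> fst c" using chart_exists[OF A] by metis
  have 1: "smooth_on (\<gamma> -` fst c) (\<lambda>s. snd c (\<gamma> s))"
    using smooth_mapD(2)[OF \<gamma>, of "(UNIV, id)" c] c by (simp add: sub_atlas_def inv_id)
  have 2: "smooth_on (snd c ` fst c) (\<lambda>u. f (chart_inv c u))"
    using smooth_map_sub_atlas[of f UNIV UNIV A] f c by simp
  have "smooth_on (\<gamma> -` fst c) (\<lambda>s. f (chart_inv c (snd c (\<gamma> s))))"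
    by (rule smooth_on_compose[OF 2 1]) auto
  then have "smooth_on (\<gamma> -` fst c) (\<lambda>s. f (\<gamma> s))"
    by (rule smooth_on_cong[rotated]) (simp add: chart_inv_left[OF A c(1)])
  moreover have "open (\<gamma> -` fst c)"
    using continuous_open_preimage[OF smooth_mapD(1)[OF \<gamma>] open_UNIV chart_open[OF A c(1)]] by simp
  ultimately show "\<exists>N. open N \<and> t \<in> N \<and> smooth_on (UNIV \<inter> N) (\<lambda>t. f (\<gamma> t))"
    using c by (intro exI[of _ "\<gamma> -` fst c"]) auto
qed

lemma zero_tderiv_locally_constant:
  assumes A: "smooth_manifold A" and f: "\<And>q. mdiff A (sub_atlas UNIV) f q"
    and z: "\<And>q v. v \<in> tangent_space A q \<Longrightarrow> tderiv A f q v = 0"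
  obtains N where "open N" "p \<in> N" "\<And>q. q \<in> N \<Longrightarrow> f q = f p"
proof -
  obtain c where c: "c \<in> A" "p \<in> fst c" using chart_exists[OF A] by metis
  obtain e where e: "e > 0" "ball (snd c p) e \<subseteq> snd c ` fst c"
    using openE[OF chart_open_image[OF A c(1)]] c by blast
  define N where "N = fst c \<inter> snd c -` ball (snd c p) e"
  have "open N" unfolding N_def
    by (rule continuous_open_preimage[OF chart_cont[OF A c(1)] chart_open[OF A c(1)] open_ball])
  moreover have "p \<in> N" using c e by (simp add: N_def)
  moreover have "f q = f p" if q: "q \<in> N" for q
  proof -
    have d: "((\<lambda>u. f (chart_inv c u)) has_derivative (\<lambda>v. 0)) (at u)" if u: "u \<in> ball (snd c p) e" for u
    proof -
      obtain q where q: "q \<in> fst c" "u = snd c q" using u e by blast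
      have "(\<lambda>u. f (chart_inv c u)) differentiable (at (snd c q))"
        using f[of q] c q by (auto simp: mdiff_def sub_atlas_def)
      moreover have "frechet_derivative (\<lambda>u. f (chart_inv c u)) (at (snd c q)) = (\<lambda>v. 0)"
      proof
        show "frechet_derivative (\<lambda>u. f (chart_inv c u)) (at (snd c q)) v = 0" for v
        using z[OF coord_vec_tangent(1)[OF A c(1) q(1)]]
          tderiv_chart[OF A f c(1) q(1) coord_vec_tangent(1)[OF A c(1) q(1)]]
          coord_vec_tangent(2)[OF A c(1) q(1)] by (simp add: o_def)
      qed
      ultimately show ?thesis
        using q frechet_derivative_works[of "\<lambda>u. f (chart_inv c u)" "at u"] by simp
    qed
    have "f (chart_inv c (snd c q)) = f (chart_inv c (snd c p))"
      by (rule has_derivative_zero_unique[OF convex_ball, of "snd c p" e "\<lambda>u. f (chart_inv c u)"])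
        (use d q e in \<open>auto simp: N_def intro: has_derivative_at_withinI\<close>)
    then show ?thesis using q c chart_inv_left[OF A c(1)] by (simp add: N_def)
  qed
  ultimately show ?thesis by (rule that)
qed

text \<open>The derivative of a smooth map of two arguments along a pair of curves is one linear map of the
  two velocities, because in charts the map extends to a differentiable map of an open set.\<close>

lemma velocity_prod_map:
  assumes B: "smooth_manifold B" and C: "smooth_manifold C"
    and F: "smooth_map (prod_atlas B (sub_atlas G)) C (UNIV \<times> G) (\<lambda>(p, g). F p g)"
    and c: "c \<in> B" "p \<in> fst c" and g: "g \<in> G" and d: "d \<in> C" "F p g \<in> fst d"
  shows "\<exists>L. linear L \<and> (\<forall>x y y'. mdiff (sub_atlas UNIV) B x 0 \<and> x 0 = p \<and> range y \<subseteq> G \<and> y 0 = g \<and>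
    (y has_vector_derivative y') (at (0::real)) \<longrightarrow>
    velocity C (\<lambda>t. F (x t) (y t)) 0 d = L (velocity B x 0 c, y'))"
proof -
  define pc where "pc = (fst c \<times> G, map_prod (snd c) (id :: 'e \<Rightarrow> 'e))"
  have pc: "pc \<in> prod_atlas B (sub_atlas G)"
    unfolding prod_atlas_def sub_atlas_def pc_def
    by (intro CollectI exI[of _ c] exI[of _ "(G, id)"]) (simp add: c)
  have inj: "inj_on (map_prod (snd c) id) (fst c \<times> G)"
    by (intro map_prod_inj_on) (use chart_inv_left[OF B c(1)] in \<open>auto intro: inj_on_inverseI\<close>)
  have inv: "chart_inv pc (snd c x, y) = (x, y)" if "x \<in> fst c" "y \<in> G" for x y
    using inv_into_f_f[OF inj, of "(x, y)"] that by (simp add: pc_def)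
  define Z where "Z = snd pc ` (fst pc \<inter> (UNIV \<times> G) \<inter> (\<lambda>(p, g). F p g) -` fst d)"
  have Z: "(snd c x, y) \<in> Z" if "x \<in> fst c" "y \<in> G" "F x y \<in> fst d" for x y
    unfolding Z_def by (rule image_eqI[of _ _ "(x, y)"]) (use that in \<open>auto simp: pc_def\<close>)
  have Fs: "smooth_on Z (\<lambda>u. snd d ((\<lambda>(p, g). F p g) (chart_inv pc u)))"
    unfolding Z_def by (rule smooth_mapD(2)[OF F pc d(1)])
  define z0 where "z0 = (snd c p, g)"
  have "z0 \<in> Z" unfolding z0_def by (rule Z[OF c(2) g d(2)])
  then obtain N E where N: "open N" "z0 \<in> N" "\<And>k. Ck_on k N E"
    and E: "\<And>u. u \<in> Z \<Longrightarrow> u \<in> N \<Longrightarrow> E u = snd d ((\<lambda>(p, g). F p g) (chart_inv pc u))"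
    by (rule smooth_onE[OF Fs]) metis
  have "E differentiable (at z0)" using N(3)[of 1] N(2) by simp
  then obtain L where L: "(E has_derivative L) (at z0)" unfolding differentiable_def by blast
  have "velocity C (\<lambda>t. F (x t) (y t)) 0 d = L (velocity B x 0 c, y')"
    if x: "mdiff (sub_atlas UNIV) B x 0" "x 0 = p" and y: "range y \<subseteq> G" "y 0 = g"
      "(y has_vector_derivative y') (at 0)" for x y and y' :: 'e
  proof -
    have xc: "isCont x 0" using x by (simp add: mdiff_def)
    have yc: "isCont y 0" using y(3) has_vector_derivative_continuous by blast
    have x': "((\<lambda>t. snd c (x t)) has_vector_derivative velocity B x 0 c) (at 0)"
      by (rule curve_frechet(2)[OF B x(1) c(1)]) (use x c in simp)
    have "((\<lambda>t. (snd c (x t), y t)) has_vector_derivative (velocity B x 0 c, y')) (at 0)"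
      by (rule has_vector_derivative_Pair[OF x' y(3)])
    moreover have "(E has_derivative L) (at (snd c (x 0), y 0))" using L x y by (simp add: z0_def)
    ultimately have der: "((\<lambda>t. E (snd c (x t), y t)) has_vector_derivative L (velocity B x 0 c, y')) (at 0)"
      using vector_derivative_diff_chain_within[of "\<lambda>t. (snd c (x t), y t)" _ 0 UNIV E L]
      by (simp add: o_def has_derivative_at_withinI)
    have cont: "isCont (\<lambda>t. (snd c (x t), y t)) 0"
      using xc yc isCont_o2[OF xc] chart_isCont(1)[OF B c] x(2) by (auto intro!: isCont_Pair)
    have "\<forall>\<^sub>F t in at 0. (snd c (x t), y t) \<in> N"
      using topological_tendstoD[OF cont[unfolded isCont_def] N(1)] N(2) x y by (simp add: z0_def)
    moreover have "\<forall>\<^sub>F t in at 0. x t \<in> fst c"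
      using topological_tendstoD[OF xc[unfolded isCont_def] chart_open[OF B c(1)]] x c by simp
    moreover have "\<forall>\<^sub>F t in at 0. F (x t) (y t) \<in> fst d"
    proof -
      have "continuous (at (p, g) within UNIV \<times> G) (\<lambda>(p, g). F p g)"
        using smooth_mapD(1)[OF F] g by (auto simp: continuous_on_eq_continuous_within)
      then have *: "((\<lambda>(p, g). F p g) \<longlongrightarrow> F p g) (at (p, g) within UNIV \<times> G)"
        by (simp add: continuous_within)
      have fl: "((\<lambda>t. (x t, y t)) \<longlongrightarrow> (p, g)) (at 0)"
        using isCont_Pair[OF xc yc] x y by (simp add: isCont_def)
      obtain W where W: "open W" "(p, g) \<in> W" "\<And>q. q \<in> W \<Longrightarrow> q \<in> UNIV \<times> G \<Longrightarrow> (\<lambda>(p, g). F p g) q \<in> fst d"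
      proof -
        have "\<forall>\<^sub>F q in at (p, g) within UNIV \<times> G. (\<lambda>(p, g). F p g) q \<in> fst d"
          by (rule topological_tendstoD[OF * chart_open[OF C d(1)] d(2)])
        then obtain W where "open W" "(p, g) \<in> W" "\<forall>q\<in>W. q \<noteq> (p, g) \<longrightarrow> q \<in> UNIV \<times> G \<longrightarrow> (\<lambda>(p, g). F p g) q \<in> fst d"
          unfolding eventually_at_topological by blast
        then show ?thesis using d(2) by (intro that[of W]) auto
      qed
      have "\<forall>\<^sub>F t in at 0. (x t, y t) \<in> W" by (rule topological_tendstoD[OF fl W(1,2)])
      then show ?thesis by eventually_elim (use W(3) y(1) in force)
    qed
    ultimately have ev: "\<forall>\<^sub>F t in at 0. E (snd c (x t), y t) = snd d (F (x t) (y t))"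
    proof eventually_elim
      case (elim t)
      have "y t \<in> G" using y by auto
      then show ?case using E[OF Z[OF elim(2) _ elim(3)] elim(1)] inv[OF elim(2)] by simp
    qed
    have at0: "E (snd c (x 0), y 0) = snd d (F (x 0) (y 0))"
      using E[OF \<open>z0 \<in> Z\<close> N(2)] inv[OF c(2) g] x y by (simp add: z0_def)
    have "((\<lambda>t. snd d (F (x t) (y t))) has_vector_derivative L (velocity B x 0 c, y')) (at 0)"
      using has_derivative_transform_eventually[OF der[unfolded has_vector_derivative_def] ev at0]
      by (simp add: has_vector_derivative_def)
    from vector_derivative_at[OF this] show ?thesis
      using d x y by (simp add: velocity_def o_def)
  qed
  then show ?thesis using has_derivative_linear[OF L] by blast
qed

lemma mdiff_const: "smooth_manifold A \<Longrightarrow> smooth_manifold B \<Longrightarrow> mdiff A B (\<lambda>_. q) p"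
  by (rule smooth_map_mdiff[OF _ _ smooth_map_const open_UNIV]) auto

lemma velocity_const: "velocity A (\<lambda>_. q) t = (\<lambda>_. 0)"
  by (auto simp: velocity_def o_def fun_eq_iff)

lemma mdiff_bounded_linear:
  assumes A: "smooth_manifold A" and f: "mdiff A (sub_atlas UNIV) f p" and L: "bounded_linear L"
  shows "mdiff A (sub_atlas UNIV) (\<lambda>q. L (f q)) p"
    "tderiv A (\<lambda>q. L (f q)) p v = L (tderiv A f p v)"
proof -
  have d: "((\<lambda>u. L (f (chart_inv c u))) has_derivative
      (\<lambda>v. L (frechet_derivative (\<lambda>u. f (chart_inv c u)) (at (snd c p)) v))) (at (snd c p))"
    if "c \<in> A" "p \<in> fst c" for c
  proof -
    have "(\<lambda>u. f (chart_inv c u)) differentiable (at (snd c p))"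
      using f that by (simp add: mdiff_def sub_atlas_def)
    then show ?thesis
      by (intro bounded_linear.has_derivative[OF L]) (simp add: frechet_derivative_works[symmetric])
  qed
  have "isCont (\<lambda>q. L (f q)) p"
    by (rule bounded_linear.continuous[OF L]) (use f in \<open>simp add: mdiff_def\<close>)
  then show "mdiff A (sub_atlas UNIV) (\<lambda>q. L (f q)) p"
    using d by (auto simp: mdiff_def sub_atlas_def differentiable_def)
  show "tderiv A (\<lambda>q. L (f q)) p v = L (tderiv A f p v)"
    using frechet_derivative_at[OF d[OF chart_at[OF A]], symmetric] by (simp add: tderiv_def Let_def o_def)
qed

section \<open>Values of differential forms\<close>

lemma tangent_tuples_1: "vs \<in> tangent_tuples A 1 p \<longleftrightarrow> (\<exists>v\<in>tangent_space A p. vs = [v])"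
  by (auto simp: tangent_tuples_def length_Suc_conv)

lemma smooth_formD:
  assumes "smooth_form A k \<alpha>" "vs \<in> tangent_tuples A k p" "i < k" "v \<in> tangent_space A p"
  shows "w \<in> tangent_space A p \<Longrightarrow>
      \<alpha> p (vs[i := (\<lambda>c. v c + w c)]) = \<alpha> p (vs[i := v]) + \<alpha> p (vs[i := w])"
    "\<alpha> p (vs[i := (\<lambda>c. r *\<^sub>R v c)]) = r *\<^sub>R \<alpha> p (vs[i := v])"
    "j < k \<Longrightarrow> i \<noteq> j \<Longrightarrow> vs ! i = vs ! j \<Longrightarrow> \<alpha> p vs = 0"
  using assms unfolding smooth_form_def by blast+

text \<open>The values of a horizontal form depend on its arguments modulo vertical vectors only:
  they are exchanged one at a time, and each exchange adds a term with a vertical argument.\<close>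

lemma horizontal_form_cong:
  assumes \<alpha>: "smooth_form AP k \<alpha>" "horizontal_form AM AP \<pi> k \<alpha>"
    and us: "us \<in> tangent_tuples AP k p" and ns: "ns \<in> tangent_tuples AP k p"
    and vert: "\<And>n. n \<in> set ns \<Longrightarrow> pushforward AP AM \<pi> p n = (\<lambda>_. 0)"
    and ws: "ws \<in> tangent_tuples AP k p" "\<And>i. i < k \<Longrightarrow> ws ! i = (\<lambda>c. (us ! i) c + (ns ! i) c)"
  shows "\<alpha> p ws = \<alpha> p us"
proof -
  have len: "length us = k" "length ns = k" "length ws = k"
    using us ns ws by (auto simp: tangent_tuples_def)
  have "\<alpha> p (take i ws @ drop i us) = \<alpha> p us" if "i \<le> k" for i
    using that
  proof (induction i)
    case (Suc i)
    then have i: "i < k" by simp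
    define xs where "xs = take i ws @ drop i us"
    have xs: "xs \<in> tangent_tuples AP k p" using us ws i
      by (auto simp: tangent_tuples_def xs_def dest: in_set_takeD in_set_dropD)
    have T: "us ! i \<in> tangent_space AP p" "ns ! i \<in> tangent_space AP p"
      using us ns i by (auto simp: tangent_tuples_def subset_iff)
    have upd: "xs[i := y] = take i ws @ y # drop (Suc i) us" for y
      using i len by (simp add: xs_def list_update_append Cons_nth_drop_Suc[symmetric])
    have "take (Suc i) ws @ drop (Suc i) us = xs[i := (\<lambda>c. (us ! i) c + (ns ! i) c)]"
      unfolding upd using i len ws(2)[OF i] by (simp add: take_Suc_conv_app_nth)
    then have "\<alpha> p (take (Suc i) ws @ drop (Suc i) us) = \<alpha> p (xs[i := us ! i]) + \<alpha> p (xs[i := ns ! i])"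
      using smooth_formD(1)[OF \<alpha>(1) xs i T] by simp
    moreover have "\<alpha> p (xs[i := ns ! i]) = 0"
    proof -
      have mem: "ns ! i \<in> set (xs[i := ns ! i])" unfolding upd by simp
      have "set (xs[i := ns ! i]) \<subseteq> tangent_space AP p"
        using xs T set_update_subset_insert by (fastforce simp: tangent_tuples_def)
      then have "xs[i := ns ! i] \<in> tangent_tuples AP k p"
        using xs by (simp add: tangent_tuples_def)
      moreover have "pushforward AP AM \<pi> p (ns ! i) = (\<lambda>_. 0)" by (rule vert) (use i len in simp)
      ultimately show ?thesis using \<alpha>(2) mem unfolding horizontal_form_def by blast
    qed
    moreover have "xs[i := us ! i] = xs" unfolding upd using i len by (simp add: xs_def Cons_nth_drop_Suc)
    ultimately show ?case using Suc i by (simp add: xs_def)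
  qed simp
  from this[of k] show ?thesis using len by simp
qed

section \<open>The structure group and its Lie algebra\<close>

lemma mat2_nth [simp]:
  "mat2 a b c d $ 1 $ 1 = a" "mat2 a b c d $ 1 $ 2 = b"
  "mat2 a b c d $ 2 $ 1 = c" "mat2 a b c d $ 2 $ 2 = d"
  by (simp_all add: mat2_def)

lemma adjoint_mat_nth [simp]: "adjoint_mat a $ i $ j = cnj (a $ j $ i)"
  by (simp add: adjoint_mat_def)

lemma mat2_eq_iff: "(a :: complex^2^2) = b \<longleftrightarrow>
    a $ 1 $ 1 = b $ 1 $ 1 \<and> a $ 1 $ 2 = b $ 1 $ 2 \<and> a $ 2 $ 1 = b $ 2 $ 1 \<and> a $ 2 $ 2 = b $ 2 $ 2"
  by (auto simp: vec_eq_iff forall_2)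

lemma mat_mult_2_nth: "((a :: complex^2^2) ** b) $ i $ j = a $ i $ 1 * b $ 1 $ j + a $ i $ 2 * b $ 2 $ j"
  by (simp add: matrix_matrix_mult_def sum_2)

lemma adjoint_mat_mult: "adjoint_mat (a ** b) = adjoint_mat b ** adjoint_mat a"
  by (simp add: mat2_eq_iff mat_mult_2_nth)

lemma adjoint_mat_adjoint_mat [simp]: "adjoint_mat (adjoint_mat a) = a"
  by (simp add: mat2_eq_iff)

lemma adjoint_mat_one [simp]: "adjoint_mat (mat 1) = mat 1"
  by (simp add: mat2_eq_iff mat_def)

lemma SU2_adjoint_left: "a \<in> SU2 \<Longrightarrow> adjoint_mat a ** a = mat 1"
  using matrix_left_right_inverse by (auto simp: SU2_def)

lemma u1_range: "u1 ` {0..<4*pi} = {z. cmod z = 1}"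
proof (intro set_eqI iffI)
  fix z assume "z \<in> {z. cmod z = 1}"
  then have "z = cis (Arg2pi z)" using Arg2pi_eq[of z] by (simp add: cis_conv_exp)
  then have "z = u1 (2 * Arg2pi z)" by (simp add: u1_def)
  then show "z \<in> u1 ` {0..<4*pi}" using Arg2pi[of z] by (intro image_eqI) auto
qed (auto simp: u1_def)

lemma Ggrp_iff: "g \<in> Ggrp \<longleftrightarrow> fst g \<in> SU2 \<and> cmod (snd g) = 1"
  by (cases g) (simp add: Ggrp_def u1_range)

lemma unit_mult_cnj: "cmod z = 1 \<Longrightarrow> z * cnj z = 1"
  by (simp add: complex_norm_square[symmetric])

lemma gmult_assoc: "gmult (gmult g h) k = gmult g (gmult h k)"
  by (simp add: gmult_def matrix_mul_assoc mult.assoc)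

lemma gmult_gone [simp]: "gmult gone g = g" "gmult g gone = g"
  by (simp_all add: gmult_def gone_def)

lemma ginv_gmult: "ginv (gmult g h) = gmult (ginv h) (ginv g)"
  by (simp add: gmult_def ginv_def adjoint_mat_mult mult.commute)

lemma ginv_ginv [simp]: "ginv (ginv g) = g" by (simp add: ginv_def)

lemma ginv_gone [simp]: "ginv gone = gone" by (simp add: ginv_def gone_def)

lemma gmult_ginv: "g \<in> Ggrp \<Longrightarrow> gmult g (ginv g) = gone" "g \<in> Ggrp \<Longrightarrow> gmult (ginv g) g = gone"
  using SU2_adjoint_left unit_mult_cnj
  by (auto simp: Ggrp_iff SU2_def gmult_def ginv_def gone_def mult.commute)

lemma gmult_ginv_assoc:
  "g \<in> Ggrp \<Longrightarrow> gmult g (gmult (ginv g) h) = h" "g \<in> Ggrp \<Longrightarrow> gmult (ginv g) (gmult g h) = h"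
  by (simp_all add: gmult_assoc[symmetric] gmult_ginv)

lemma Ggrp_gone [simp]: "gone \<in> Ggrp"
  by (simp add: Ggrp_iff gone_def SU2_def)

lemma Ggrp_gmult: "g \<in> Ggrp \<Longrightarrow> h \<in> Ggrp \<Longrightarrow> gmult g h \<in> Ggrp"
proof -
  assume g: "g \<in> Ggrp" and h: "h \<in> Ggrp"
  have "gmult (gmult g h) (ginv (gmult g h)) = gone"
    using g h by (simp add: ginv_gmult gmult_assoc gmult_ginv_assoc gmult_ginv)
  then show ?thesis using g h
    by (simp add: Ggrp_iff SU2_def gmult_def ginv_def gone_def det_mul norm_mult)
qed

lemma Ggrp_ginv: "g \<in> Ggrp \<Longrightarrow> ginv g \<in> Ggrp"
  using SU2_adjoint_left[of "fst g"]
  by (auto simp: Ggrp_iff SU2_def ginv_def det_2 mult.commute simp flip: complex_cnj_mult complex_cnj_diff)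

lemma bounded_linear_ginv: "bounded_linear ginv"
  by (intro linear_conv_bounded_linear[THEN iffD1] linearI)
    (auto simp: ginv_def mat2_eq_iff)

lemma bounded_bilinear_gmult: "bounded_bilinear gmult"
  by (intro bilinear_conv_bounded_bilinear[THEN iffD1])
    (auto simp: bilinear_def gmult_def mat2_eq_iff mat_mult_2_nth algebra_simps intro!: linearI)

lemmas gmult_diff_left = bounded_bilinear.diff_left[OF bounded_bilinear_gmult]
lemmas gmult_diff_right = bounded_bilinear.diff_right[OF bounded_bilinear_gmult]

lemma rho_nth:
  "rho g z $ i = snd g * (fst g $ i $ 1 * z $ 1 + fst g $ i $ 2 * z $ 2)"
  by (simp add: rho_def matrix_vector_mult_def sum_2)

lemma rho_gmult: "rho (gmult g h) z = rho g (rho h z)"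
  by (simp add: vec_eq_iff forall_2 rho_nth gmult_def mat_mult_2_nth algebra_simps)

lemma rho_gone [simp]: "rho gone z = z"
  by (simp add: vec_eq_iff forall_2 rho_nth gone_def mat_def)

lemma rho_scaleR: "rho g (r *\<^sub>R z) = r *\<^sub>R rho g z"
  by (simp add: vec_eq_iff forall_2 rho_nth algebra_simps)

lemma rho_ginv: "g \<in> Ggrp \<Longrightarrow> rho g (rho (ginv g) z) = z" "g \<in> Ggrp \<Longrightarrow> rho (ginv g) (rho g z) = z"
  by (simp_all add: rho_gmult[symmetric] gmult_ginv)

text \<open>The subgroup \<open>Kgrp\<close> is a circle, parametrized here by its \<open>U(1)\<close> component. Gauge
  transformations that fix the Higgs field are told apart by this one number.\<close>

definition kdiag :: "complex \<Rightarrow> mat_pair" where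
  "kdiag s = (mat2 s 0 0 (cnj s), s)"

lemma snd_kdiag [simp]: "snd (kdiag s) = s" by (simp add: kdiag_def)

lemma Kgrp_eq: "Kgrp = kdiag ` {s. cmod s = 1}"
proof -
  have "Kgrp = kdiag ` (u1 ` {0..<4*pi})"
    unfolding Kgrp_def kdiag_def u1_def image_image cis_cnj Setcompr_eq_image minus_divide_left ..
  then show ?thesis by (simp add: u1_range)
qed

lemma Z2grp_eq: "Z2grp = {kdiag 1, kdiag (-1)}"
proof -
  have "mat 1 = mat2 1 0 0 1" "- mat 1 = mat2 (-1) 0 0 (-1)"
    by (simp_all add: mat2_eq_iff mat_def)
  then show ?thesis by (simp add: Z2grp_def kdiag_def u1_def)
qed

lemma kdiag_one: "kdiag 1 = gone"
  by (simp add: kdiag_def gone_def mat2_eq_iff mat_def)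

lemma kdiag_Ggrp: "cmod s = 1 \<Longrightarrow> kdiag s \<in> Ggrp"
  using unit_mult_cnj[of s]
  by (simp add: Ggrp_iff SU2_def kdiag_def det_2 mat2_eq_iff mat_mult_2_nth mat_def mult.commute)

lemma ginv_kdiag: "ginv (kdiag s) = kdiag (cnj s)"
  by (simp add: kdiag_def ginv_def mat2_eq_iff)

lemma gmult_kdiag: "gmult (kdiag s) (kdiag t) = kdiag (s * t)"
  by (simp add: kdiag_def gmult_def mat2_eq_iff mat_mult_2_nth)

lemma Kgrp_gmult: "k \<in> Kgrp \<Longrightarrow> k' \<in> Kgrp \<Longrightarrow> gmult k k' \<in> Kgrp"
  by (auto simp: Kgrp_eq gmult_kdiag norm_mult)

lemma Kgrp_ginv: "k \<in> Kgrp \<Longrightarrow> ginv k \<in> Kgrp"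
  by (auto simp: Kgrp_eq ginv_kdiag)

lemma Kgrp_Ggrp: "k \<in> Kgrp \<Longrightarrow> k \<in> Ggrp"
  using kdiag_Ggrp by (auto simp: Kgrp_eq)

lemma Kgrp_gone: "gone \<in> Kgrp"
  unfolding Kgrp_eq kdiag_one[symmetric] by (rule imageI) simp

lemma gone_mem_coset: "h \<in> coset h"
  using Kgrp_gone unfolding coset_def by (metis gmult_gone(2) imageI)

lemma coset_eqI:
  assumes "g \<in> Ggrp" "k \<in> Kgrp" shows "coset (gmult g k) = coset g"
proof -
  have "gmult k ` Kgrp = Kgrp"
  proof (intro set_eqI iffI)
    fix x assume "x \<in> Kgrp"
    then show "x \<in> gmult k ` Kgrp"
      using gmult_ginv_assoc(1)[OF Kgrp_Ggrp[OF assms(2)], of x] Kgrp_gmult[OF Kgrp_ginv[OF assms(2)]]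
      by (intro image_eqI[of _ _ "gmult (ginv k) x"]) auto
  qed (use Kgrp_gmult assms in blast)
  then show ?thesis unfolding coset_def by (metis (no_types, lifting) gmult_assoc image_cong image_image)
qed

lemma Ad_gmult: "Ad (gmult g h) X = Ad g (Ad h X)"
  by (simp add: Ad_def ginv_gmult gmult_assoc)

lemma Ad_diff: "Ad g (X - Y) = Ad g X - Ad g Y"
  by (simp add: Ad_def gmult_diff_left gmult_diff_right)

lemma Ad_ginv: "g \<in> Ggrp \<Longrightarrow> Ad g (Ad (ginv g) X) = X" "g \<in> Ggrp \<Longrightarrow> Ad (ginv g) (Ad g X) = X"
  by (simp_all add: Ad_gmult[symmetric] gmult_ginv) (simp_all add: Ad_def)

definition lie_vec :: "real \<Rightarrow> real \<Rightarrow> real \<Rightarrow> real \<Rightarrow> mat_pair" where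
  "lie_vec a b c d = a *\<^sub>R t1 + b *\<^sub>R t2 + c *\<^sub>R t3 + d *\<^sub>R tU"

lemma lie_vec_eq: "lie_vec a b c d =
    (mat2 (Complex 0 (c/2)) (Complex (b/2) (a/2)) (Complex (-b/2) (a/2)) (Complex 0 (-c/2)), Complex 0 (d/2))"
  by (simp add: lie_vec_def t1_def t2_def t3_def tU_def mat2_eq_iff complex_eq_iff)

lemma lie_iff: "X \<in> lie \<longleftrightarrow> (\<exists>a b c d. X = lie_vec a b c d)"
proof
  assume X: "X \<in> lie"
  have "X = lie_vec (2 * Im (fst X $ 1 $ 2)) (2 * Re (fst X $ 1 $ 2)) (2 * Im (fst X $ 1 $ 1)) (2 * Im (snd X))"
  proof -
    have adj: "adjoint_mat (fst X) = - fst X" and tr: "trace (fst X) = 0" and re: "Re (snd X) = 0"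
      using X by (auto simp: lie_def)
    have "Re (adjoint_mat (fst X) $ i $ j) = - Re (fst X $ i $ j)"
      "Im (adjoint_mat (fst X) $ i $ j) = - Im (fst X $ i $ j)" for i j
      unfolding adj by simp_all
    from this[of 1 1] this[of 1 2] this[of 2 2]
    have "Re (fst X $ 1 $ 1) = 0" "Re (fst X $ 2 $ 2) = 0"
      "Re (fst X $ 2 $ 1) = - Re (fst X $ 1 $ 2)" "Im (fst X $ 2 $ 1) = Im (fst X $ 1 $ 2)" by auto
    moreover have "Im (fst X $ 2 $ 2) = - Im (fst X $ 1 $ 1)"
      using tr by (simp add: trace_def sum_2 complex_eq_iff)
    ultimately show ?thesis
      using re by (simp add: lie_vec_eq prod_eq_iff mat2_eq_iff complex_eq_iff)
  qed
  then show "\<exists>a b c d. X = lie_vec a b c d" by blast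
next
  assume "\<exists>a b c d. X = lie_vec a b c d"
  then show "X \<in> lie"
    by (auto simp: lie_def lie_vec_eq mat2_eq_iff complex_eq_iff trace_def sum_2)
qed

lemma lie_vec_inject: "lie_vec a b c d = lie_vec a' b' c' d' \<longleftrightarrow> a = a' \<and> b = b' \<and> c = c' \<and> d = d'"
  by (auto simp: lie_vec_eq mat2_eq_iff)

lemma lie_Ad: "g \<in> Ggrp \<Longrightarrow> X \<in> lie \<Longrightarrow> Ad g X \<in> lie"
proof -
  assume g: "g \<in> Ggrp" and X: "X \<in> lie"
  have X': "adjoint_mat (fst X) = - fst X" "trace (fst X) = 0" "Re (snd X) = 0"
    using X by (auto simp: lie_def)
  have m: "fst (Ad g X) = fst g ** fst X ** adjoint_mat (fst g)"
    "snd (Ad g X) = snd X"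
    using g unit_mult_cnj[of "snd g"]
    by (simp_all add: Ad_def gmult_def ginv_def Ggrp_iff algebra_simps)
  have neg: "a ** (- b) ** c = - (a ** b ** c)" for a b c :: "complex^2^2"
    by (simp add: mat2_eq_iff mat_mult_2_nth algebra_simps)
  have "adjoint_mat (fst (Ad g X)) = - fst (Ad g X)"
    by (simp add: m adjoint_mat_mult X' matrix_mul_assoc neg)
  moreover have "trace (fst (Ad g X)) = 0"
  proof -
    have "trace (fst (Ad g X)) = trace (adjoint_mat (fst g) ** (fst g ** fst X))"
      unfolding m by (rule trace_mul_sym)
    also have "\<dots> = trace (fst X)"
      using SU2_adjoint_left g by (simp add: matrix_mul_assoc Ggrp_iff)
    finally show ?thesis using X' by simp
  qed
  ultimately show ?thesis using X' m by (cases "Ad g X") (simp add: lie_def)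
qed

lemma rho_kdiag: "cmod s = 1 \<Longrightarrow> rho (kdiag s) u $ 1 = s^2 * u $ 1" "cmod s = 1 \<Longrightarrow> rho (kdiag s) u $ 2 = u $ 2"
  by (simp_all add: rho_nth kdiag_def power2_eq_square mult.assoc[symmetric] unit_mult_cnj)

text \<open>An element \<open>s\<close> of \<open>Kgrp\<close> rotates the plane of \<open>t1\<close> and \<open>t2\<close>, whose coordinate is the
  off-diagonal matrix entry, by \<open>s\<^sup>2\<close>; it fixes the plane of \<open>t3\<close> and \<open>tU\<close>.\<close>

lemma Ad_kdiag_offdiag:
  assumes "cmod s = 1"
  shows "fst (Ad (kdiag s) X) $ 1 $ 2 = s^2 * fst X $ 1 $ 2"
    "fst (Ad (kdiag s) X) $ 2 $ 1 = cnj (s^2) * fst X $ 2 $ 1"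
    "fst (Ad (kdiag s) X) $ 1 $ 1 = fst X $ 1 $ 1"
    "fst (Ad (kdiag s) X) $ 2 $ 2 = fst X $ 2 $ 2"
    "snd (Ad (kdiag s) X) = snd X"
  using unit_mult_cnj[OF assms]
  by (simp_all add: Ad_def gmult_def ginv_def kdiag_def mat_mult_2_nth power2_eq_square algebra_simps)

lemma Ad_kdiag_fixed:
  assumes "cmod s = 1"
  shows "Ad (kdiag s) (lie_vec a b c d) = lie_vec a b c d \<longleftrightarrow> s^2 = 1 \<or> a = 0 \<and> b = 0"
proof -
  have "Ad (kdiag s) (lie_vec a b c d) = lie_vec a b c d \<longleftrightarrow>
    s^2 * Complex b a = Complex b a \<and> cnj (s^2) * Complex (-b) a = Complex (-b) a"
    using Ad_kdiag_offdiag[OF assms, of "lie_vec a b c d"]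
    by (auto simp: prod_eq_iff mat2_eq_iff lie_vec_eq complex_eq_iff simp del: complex_cnj_power)
  moreover have "cnj (s^2) * Complex (-b) a = Complex (-b) a \<longleftrightarrow> s^2 * Complex b a = Complex b a"
    by (auto simp: complex_eq_iff simp del: complex_cnj_power)
  moreover have "s^2 * Complex b a = Complex b a \<longleftrightarrow> s^2 = 1 \<or> Complex b a = 0"
    by (metis mult_cancel_right mult_1)
  ultimately show ?thesis by (auto simp: complex_eq_iff)
qed

lemma lie_p_iff: "Y \<in> lie_p \<longleftrightarrow> (\<exists>a b c. Y = lie_vec a b c (- c))"
proof -
  have "lie_p = {Y. \<exists>a b c. Y - a *\<^sub>R t1 - b *\<^sub>R t2 = c *\<^sub>R tminus}"
    by (auto simp: lie_p_def span_insert span_singleton)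
  moreover have "Y - a *\<^sub>R t1 - b *\<^sub>R t2 = c *\<^sub>R tminus \<longleftrightarrow> Y = lie_vec a b c (- c)" for a b c Y
    by (auto simp: tminus_def lie_vec_def algebra_simps)
  ultimately show ?thesis by blast
qed

lemma lie_k_iff: "Y \<in> lie_k \<longleftrightarrow> (\<exists>c. Y = lie_vec 0 0 c c)"
  by (auto simp: lie_k_def span_singleton tplus_def lie_vec_def algebra_simps)

lemma lie_vec_diff: "lie_vec a b c d - lie_vec a' b' c' d' = lie_vec (a - a') (b - b') (c - c') (d - d')"
  by (simp add: lie_vec_def algebra_simps)

lemma proj_p_lie_vec: "proj_p (lie_vec a b c d) = lie_vec a b ((c - d)/2) (- (c - d)/2)"
  unfolding proj_p_def
proof (rule the_equality)
  have "lie_vec a b c d - lie_vec a b ((c - d)/2) (- (c - d)/2) = lie_vec 0 0 ((c + d)/2) ((c + d)/2)"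
    by (simp add: lie_vec_diff lie_vec_inject field_simps)
  then show "lie_vec a b ((c - d)/2) (- (c - d)/2) \<in> lie_p \<and>
      lie_vec a b c d - lie_vec a b ((c - d)/2) (- (c - d)/2) \<in> lie_k"
    unfolding lie_p_iff lie_k_iff by (metis minus_divide_left)
next
  fix Y assume Y: "Y \<in> lie_p \<and> lie_vec a b c d - Y \<in> lie_k"
  then obtain a' b' c' where Y': "Y = lie_vec a' b' c' (- c')" by (auto simp: lie_p_iff)
  then obtain r where "lie_vec (a - a') (b - b') (c - c') (d + c') = lie_vec 0 0 r r"
    using Y by (auto simp: lie_k_iff lie_vec_diff)
  then show "Y = lie_vec a b ((c - d)/2) (- (c - d)/2)"
    by (auto simp: Y' lie_vec_inject)
qed

lemma proj_p_tminus: "(\<exists>r. proj_p (lie_vec a b c d) = r *\<^sub>R tminus) \<longleftrightarrow> a = 0 \<and> b = 0"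
proof -
  have "r *\<^sub>R tminus = lie_vec 0 0 r (- r)" for r
    by (simp add: tminus_def lie_vec_def algebra_simps)
  then have "(\<exists>r. proj_p (lie_vec a b c d) = r *\<^sub>R tminus) \<longleftrightarrow>
      (\<exists>r. a = 0 \<and> b = 0 \<and> (c - d)/2 = r \<and> - (c - d)/2 = - r)"
    by (simp only: proj_p_lie_vec lie_vec_inject)
  also have "\<dots> \<longleftrightarrow> a = 0 \<and> b = 0" by (auto intro!: exI[of _ "(c - d)/2"] simp: field_simps)
  finally show ?thesis .
qed

lemma lie_inner_lie_vec: "lie_inner (lie_vec a b c d) (lie_vec a' b' c' d') = a * a' + b * b' + c * c' + d * d'"
  by (simp add: lie_inner_def lie_vec_eq trace_def sum_2 mat_mult_2_nth algebra_simps)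

lemma lie_sharp_linear:
  assumes "\<And>X Y. X \<in> lie \<Longrightarrow> Y \<in> lie \<Longrightarrow> \<xi> (X + Y) = \<xi> X + \<xi> Y"
    "\<And>r X. X \<in> lie \<Longrightarrow> \<xi> (r *\<^sub>R X) = r * \<xi> X"
  shows "lie_sharp \<xi> = lie_vec (\<xi> t1) (\<xi> t2) (\<xi> t3) (\<xi> tU)"
    "\<xi> (lie_vec a b c d) = a * \<xi> t1 + b * \<xi> t2 + c * \<xi> t3 + d * \<xi> tU"
proof -
  have e: "t1 = lie_vec 1 0 0 0" "t2 = lie_vec 0 1 0 0" "t3 = lie_vec 0 0 1 0" "tU = lie_vec 0 0 0 1"
    by (simp_all add: lie_vec_def)
  have l: "t1 \<in> lie" "t2 \<in> lie" "t3 \<in> lie" "tU \<in> lie"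
    unfolding lie_iff using e by blast+
  have l2: "lie_vec a b c d \<in> lie" for a b c d unfolding lie_iff by blast
  have 1: "a *\<^sub>R t1 = lie_vec a 0 0 0" "a *\<^sub>R t1 + b *\<^sub>R t2 = lie_vec a b 0 0"
    "a *\<^sub>R t1 + b *\<^sub>R t2 + c *\<^sub>R t3 = lie_vec a b c 0" "b *\<^sub>R t2 = lie_vec 0 b 0 0"
    "c *\<^sub>R t3 = lie_vec 0 0 c 0" "d *\<^sub>R tU = lie_vec 0 0 0 d" for a b c d
    by (simp_all add: lie_vec_def)
  have l3: "a *\<^sub>R t1 \<in> lie" "a *\<^sub>R t1 + b *\<^sub>R t2 \<in> lie" "a *\<^sub>R t1 + b *\<^sub>R t2 + c *\<^sub>R t3 \<in> lie"
    "b *\<^sub>R t2 \<in> lie" "c *\<^sub>R t3 \<in> lie" "d *\<^sub>R tU \<in> lie" for a b c d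
    by (metis 1 l2)+
  show lin: "\<xi> (lie_vec a b c d) = a * \<xi> t1 + b * \<xi> t2 + c * \<xi> t3 + d * \<xi> tU" for a b c d
    unfolding lie_vec_def by (simp add: assms l l3)
  show "lie_sharp \<xi> = lie_vec (\<xi> t1) (\<xi> t2) (\<xi> t3) (\<xi> tU)"
    unfolding lie_sharp_def
  proof (rule the_equality)
    show "lie_vec (\<xi> t1) (\<xi> t2) (\<xi> t3) (\<xi> tU) \<in> lie \<and>
      (\<forall>X\<in>lie. \<xi> X = lie_inner (lie_vec (\<xi> t1) (\<xi> t2) (\<xi> t3) (\<xi> tU)) X)"
      using l2 by (auto simp: lie_iff lin lie_inner_lie_vec algebra_simps)
    fix Y assume Y: "Y \<in> lie \<and> (\<forall>X\<in>lie. \<xi> X = lie_inner Y X)"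
    then obtain a b c d where "Y = lie_vec a b c d" by (auto simp: lie_iff)
    moreover have "\<xi> t1 = lie_inner Y t1" "\<xi> t2 = lie_inner Y t2" "\<xi> t3 = lie_inner Y t3" "\<xi> tU = lie_inner Y tU"
      using Y l by auto
    ultimately show "Y = lie_vec (\<xi> t1) (\<xi> t2) (\<xi> t3) (\<xi> tU)"
      by (simp add: e lie_inner_lie_vec)
  qed
qed

text \<open>For \<open>s\<^sup>2 \<noteq> 1\<close> the map \<open>X \<mapsto> Ad k X - X\<close>, which multiplies the off-diagonal entry by a nonzero complex
  number, is onto the plane of \<open>t1\<close> and \<open>t2\<close>. An invariant functional therefore vanishes on
  this plane, and its dual vector has no component there.\<close>

lemma Ad_kdiag_invariant_functional:
  assumes s: "cmod s = 1" "s^2 \<noteq> 1"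
    and add: "\<And>X Y. X \<in> lie \<Longrightarrow> Y \<in> lie \<Longrightarrow> \<xi> (X + Y) = \<xi> X + \<xi> Y"
    and scale: "\<And>r X. X \<in> lie \<Longrightarrow> \<xi> (r *\<^sub>R X) = r * \<xi> X"
  shows "(\<forall>X\<in>lie. \<xi> (Ad (ginv (kdiag s)) X) = \<xi> X) \<longleftrightarrow> (\<exists>r. proj_p (lie_sharp \<xi>) = r *\<^sub>R tminus)"
proof -
  note sharp = lie_sharp_linear[of \<xi>, OF add scale]
  have s': "cmod (cnj s) = 1" "(cnj s)^2 \<noteq> 1"
    using s by (simp, metis complex_cnj_cnj complex_cnj_one complex_cnj_power)
  define w where "w = (cnj s)^2 - 1"
  have w: "w \<noteq> 0" using s' by (simp add: w_def)
  have diff: "Ad (ginv (kdiag s)) (lie_vec a b c d) =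
      lie_vec (a + Im (w * Complex b a)) (b + Re (w * Complex b a)) c d" for a b c d
  proof -
    have e: "(cnj s)^2 = w + 1" "cnj ((cnj s)^2) = cnj w + 1" by (simp_all add: w_def)
    show ?thesis
      using Ad_kdiag_offdiag[OF s'(1), of "lie_vec a b c d"] unfolding ginv_kdiag
      by (auto simp: prod_eq_iff mat2_eq_iff lie_vec_eq complex_eq_iff e algebra_simps add_divide_distrib diff_divide_distrib
          simp del: complex_cnj_power)
  qed
  have "(\<forall>X\<in>lie. \<xi> (Ad (ginv (kdiag s)) X) = \<xi> X) \<longleftrightarrow>
    (\<forall>a b. Im (w * Complex b a) * \<xi> t1 + Re (w * Complex b a) * \<xi> t2 = 0)"
  proof -
    have "(\<forall>X\<in>lie. P X) \<longleftrightarrow> (\<forall>a b c d. P (lie_vec a b c d))" for P by (metis lie_iff)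
    then show ?thesis by (simp only: diff sharp(2)) (auto simp: algebra_simps)
  qed
  also have "\<dots> \<longleftrightarrow> (\<forall>z. Im (w * z) * \<xi> t1 + Re (w * z) * \<xi> t2 = 0)"
    by (metis complex_surj)
  also have "\<dots> \<longleftrightarrow> (\<forall>z. Im z * \<xi> t1 + Re z * \<xi> t2 = 0)"
    using w by (metis nonzero_mult_div_cancel_left times_divide_eq_right)
  also have "\<dots> \<longleftrightarrow> \<xi> t1 = 0 \<and> \<xi> t2 = 0"
  proof
    assume "\<forall>z. Im z * \<xi> t1 + Re z * \<xi> t2 = 0"
    from this[rule_format, of 1] this[rule_format, of \<i>] show "\<xi> t1 = 0 \<and> \<xi> t2 = 0" by simp
  qed simp
  also have "\<dots> \<longleftrightarrow> (\<exists>r. proj_p (lie_sharp \<xi>) = r *\<^sub>R tminus)"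
    by (simp add: sharp(1) proj_p_tminus)
  finally show ?thesis .
qed

section \<open>A smooth gauge for the Higgs field\<close>

text \<open>The group \<open>SU(2)\<close> acts simply transitively on each sphere about \<open>0\<close>. The frame of \<open>x\<close> is its unique
  element that maps \<open>(0, v)\<close> to a positive multiple of \<open>x\<close>: the second column is \<open>sgn v x / norm x\<close>, and
  the first column is then determined. The real power of \<open>x \<bullet> x\<close> is smooth away from \<open>0\<close>.\<close>

definition frame :: "real \<Rightarrow> complex^2 \<Rightarrow> mat_pair" where
  "frame v x = ((x \<bullet> x) powr (-1/2)) *\<^sub>R (sgn v *\<^sub>R mat2 (cnj (x$2)) (x$1) (- cnj (x$1)) (x$2), 0) + (0, 1)"

lemma frame_eq: 
  assumes "x \<noteq> 0"
  shows "frame v x = ((sgn v / norm x) *\<^sub>R mat2 (cnj (x$2)) (x$1) (- cnj (x$1)) (x$2), 1)"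
proof -
  have "(-1/2 :: real) = - (1/2)" by simp
  then have "(x \<bullet> x) powr (-1/2) = 1 / norm x"
    by (simp only: powr_minus powr_half_sqrt inner_ge_zero norm_eq_sqrt_inner inverse_eq_divide)
  then have "frame v x =
      (1 / norm x) *\<^sub>R (sgn v *\<^sub>R mat2 (cnj (x$2)) (x$1) (- cnj (x$1)) (x$2), 0) + (0, 1)"
    unfolding frame_def by (rule arg_cong)
  then show ?thesis by (simp only: scaleR_Pair scaleR_scaleR add_Pair scaleR_zero_right add_0_right
        add_0_left times_divide_eq_left mult_1)
qed

lemma frame_Ggrp:
  assumes "v \<noteq> 0" "x \<noteq> 0" shows "frame v x \<in> Ggrp"
proof -
  have n: "norm x * norm x = cmod (x$1)^2 + cmod (x$2)^2"
    by (simp add: norm_vec_def L2_set_def sum_2)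
  have "complex_of_real (norm x * norm x) = x$1 * cnj (x$1) + x$2 * cnj (x$2)"
    unfolding n by (simp only: of_real_add complex_norm_square)
  moreover have "complex_of_real (norm x * norm x) \<noteq> 0" using assms by simp
  moreover have "complex_of_real (sgn v) * complex_of_real (sgn v) = 1"
    using assms by (simp add: sgn_if)
  ultimately have "(complex_of_real (sgn v / norm x))^2 * (x$1 * cnj (x$1) + x$2 * cnj (x$2)) = 1"
    by (simp add: power2_eq_square)
  moreover have "r *\<^sub>R mat2 (cnj (x$2)) (x$1) (- cnj (x$1)) (x$2) \<in> SU2"
    if "(complex_of_real r)^2 * (x$1 * cnj (x$1) + x$2 * cnj (x$2)) = 1" for r
    using that
    by (auto simp: SU2_def det_2 mat2_eq_iff mat_mult_2_nth mat_def power2_eq_square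
        scaleR_conv_of_real[where 'a = complex] algebra_simps)
  ultimately show ?thesis by (simp only: frame_eq[OF assms(2)] Ggrp_iff fst_conv snd_conv norm_one)
qed

lemma rho_frame:
  assumes "x \<noteq> 0"
  shows "rho (frame v x) (vector [0, of_real v]) = (\<bar>v\<bar> / norm x) *\<^sub>R x"
proof -
  have "complex_of_real (sgn v) * of_real v = of_real \<bar>v\<bar>"
    by (simp add: sgn_if)
  then have "complex_of_real (sgn v / norm x) * of_real v = of_real (\<bar>v\<bar> / norm x)"
    by simp
  then show ?thesis
    by (simp add: frame_eq[OF assms] vec_eq_iff forall_2 rho_nth mult.commute mult.left_commute
        scaleR_conv_of_real[where 'a = complex] del: of_real_divide)
qed

lemma smooth_on_frame: "smooth_on {x. x \<noteq> 0} (frame v)"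
proof -
  have "linear (\<lambda>x::complex^2. (sgn v *\<^sub>R mat2 (cnj (x$2)) (x$1) (- cnj (x$1)) (x$2), 0::complex))"
    by (rule linearI) (auto simp: mat2_eq_iff algebra_simps)
  then have 1: "smooth_on {x. x \<noteq> 0} (\<lambda>x::complex^2. (sgn v *\<^sub>R mat2 (cnj (x$2)) (x$1) (- cnj (x$1)) (x$2), 0::complex))"
    by (intro smooth_on_linear) (simp add: linear_conv_bounded_linear)
  have "smooth_on {0<..} (\<lambda>r::real. r powr (-1/2))"
    using Ck_on_powr[of _ 1 "-1/2"] by (intro smooth_onI_open) auto
  moreover have "smooth_on {x. x \<noteq> 0} (\<lambda>x::complex^2. x \<bullet> x)"
    by (intro smooth_on_bilinear[OF bounded_bilinear_inner] smooth_on_ident)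
  ultimately have 2: "smooth_on {x. x \<noteq> 0} (\<lambda>x::complex^2. (x \<bullet> x) powr (-1/2))"
    by (rule smooth_on_compose) auto
  show ?thesis
    unfolding frame_def by (intro smooth_on_add smooth_on_const smooth_on_bilinear[OF bounded_bilinear_scaleR] 1 2)
qed

text \<open>An element of \<open>Kgrp\<close> is determined by its \<open>U(1)\<close> component, which is \<open>1\<close> for a frame.\<close>

lemma frame_Kgrp: "frame v x \<in> Kgrp \<Longrightarrow> frame v x = gone"
  by (auto simp: Kgrp_eq frame_def kdiag_def gone_def mat2_eq_iff mat_def prod_eq_iff)

section \<open>Principal bundles\<close>

locale principal =
  fixes AM :: "('m::{t2_space,second_countable_topology}, real^3) chart set"
    and AP :: "('p::{t2_space,second_countable_topology}, real^7) chart set"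
    and \<pi> :: "'p \<Rightarrow> 'm" and act :: "'p \<Rightarrow> mat_pair \<Rightarrow> 'p"
  assumes principal_bundle: "principal_bundle AM AP \<pi> act"
begin

lemma AM: "smooth_manifold AM" and AP: "smooth_manifold AP" and surj_proj: "surj \<pi>"
  and proj_smooth: "smooth_map AP AM UNIV \<pi>" and act_gone [simp]: "act p gone = p"
  and act_act: "g \<in> Ggrp \<Longrightarrow> h \<in> Ggrp \<Longrightarrow> act (act p g) h = act p (gmult g h)"
  and proj_act: "g \<in> Ggrp \<Longrightarrow> \<pi> (act p g) = \<pi> p"
  and act_smooth: "smooth_map (prod_atlas AP (sub_atlas Ggrp)) AP (UNIV \<times> Ggrp) (\<lambda>(p, g). act p g)"
  using principal_bundle unfolding principal_bundle_def by blast+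

lemma mdiff_proj: "mdiff AP AM \<pi> p"
  by (rule smooth_map_mdiff[OF AP AM proj_smooth open_UNIV]) simp

lemma trivialization:
  obtains U \<psi> \<kappa> where "open U" "x \<in> U"
    "smooth_map (prod_atlas AM (sub_atlas Ggrp)) AP (U \<times> Ggrp) \<kappa>"
    "\<And>p. \<pi> p \<in> U \<Longrightarrow> \<psi> p \<in> Ggrp" "\<And>p. \<pi> p \<in> U \<Longrightarrow> \<kappa> (\<pi> p, \<psi> p) = p"
    "\<And>y g. y \<in> U \<Longrightarrow> g \<in> Ggrp \<Longrightarrow> \<pi> (\<kappa> (y, g)) = y"
    "\<And>p g. \<pi> p \<in> U \<Longrightarrow> g \<in> Ggrp \<Longrightarrow> \<psi> (act p g) = gmult (\<psi> p) g"
proof -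
  obtain U \<psi> where U: "open U" "x \<in> U" and bij: "bij_betw (\<lambda>p. (\<pi> p, \<psi> p)) (\<pi> -` U) (U \<times> Ggrp)"
    and sm: "smooth_map (prod_atlas AM (sub_atlas Ggrp)) AP (U \<times> Ggrp)
          (inv_into (\<pi> -` U) (\<lambda>p. (\<pi> p, \<psi> p)))"
    and eq: "\<forall>p\<in>\<pi> -` U. \<forall>g\<in>Ggrp. \<psi> (act p g) = gmult (\<psi> p) g"
    using principal_bundle unfolding principal_bundle_def by blast
  define \<kappa> where "\<kappa> = inv_into (\<pi> -` U) (\<lambda>p. (\<pi> p, \<psi> p))"
  show ?thesis
  proof (rule that[OF U, of \<kappa> \<psi>])
    show "smooth_map (prod_atlas AM (sub_atlas Ggrp)) AP (U \<times> Ggrp) \<kappa>" unfolding \<kappa>_def by (rule sm)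
    show "\<psi> p \<in> Ggrp" if "\<pi> p \<in> U" for p
      using bij_betwE[OF bij] that by auto
    show "\<kappa> (\<pi> p, \<psi> p) = p" if "\<pi> p \<in> U" for p
      using inv_into_f_f[OF bij_betw_imp_inj_on[OF bij], of p] that by (simp add: \<kappa>_def)
    show "\<pi> (\<kappa> (y, g)) = y" if "y \<in> U" "g \<in> Ggrp" for y g
      using f_inv_into_f[of "(y, g)" "\<lambda>p. (\<pi> p, \<psi> p)" "\<pi> -` U"] bij_betw_imp_surj_on[OF bij] that
      by (simp add: \<kappa>_def)
    show "\<psi> (act p g) = gmult (\<psi> p) g" if "\<pi> p \<in> U" "g \<in> Ggrp" for p g
      using eq that by auto
  qed
qed

lemma fibre_transitive:
  assumes "\<pi> p = \<pi> q"
  obtains g where "g \<in> Ggrp" "q = act p g"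
proof (rule trivialization[of "\<pi> p"])
  fix U \<psi> \<kappa>
  assume U: "\<pi> p \<in> U" and \<psi>: "\<And>p. \<pi> p \<in> U \<Longrightarrow> \<psi> p \<in> Ggrp" "\<And>p. \<pi> p \<in> U \<Longrightarrow> \<kappa> (\<pi> p, \<psi> p) = p"
    "\<And>p g. \<pi> p \<in> U \<Longrightarrow> g \<in> Ggrp \<Longrightarrow> \<psi> (act p g) = gmult (\<psi> p) g"
  define g where "g = gmult (ginv (\<psi> p)) (\<psi> q)"
  have q: "\<pi> q \<in> U" using U assms by simp
  have g: "g \<in> Ggrp" unfolding g_def by (intro Ggrp_gmult Ggrp_ginv \<psi>(1) U q)
  have "\<psi> (act p g) = \<psi> q"
    using \<psi>(3)[OF U g] gmult_ginv_assoc(1)[OF \<psi>(1)[OF U]] by (simp add: g_def)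
  moreover have "\<kappa> (\<pi> (act p g), \<psi> (act p g)) = act p g"
    by (rule \<psi>(2)) (simp add: proj_act[OF g] U)
  ultimately have "\<kappa> (\<pi> q, \<psi> q) = act p g" by (simp add: proj_act[OF g] assms)
  then have "q = act p g" unfolding \<psi>(2)[OF q] .
  with g show ?thesis by (rule that)
qed

text \<open>A curve in the base is lifted to the bundle by a local section through \<open>p\<close>.\<close>

lemma pushforward_proj_surj:
  assumes v: "v \<in> tangent_space AM (\<pi> p)"
  obtains w where "w \<in> tangent_space AP p" "pushforward AP AM \<pi> p w = v"
proof (rule trivialization[of "\<pi> p"])
  fix U \<psi> \<kappa>
  assume U: "open U" "\<pi> p \<in> U" and \<kappa>: "smooth_map (prod_atlas AM (sub_atlas Ggrp)) AP (U \<times> Ggrp) \<kappa>"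
    and \<psi>: "\<And>p. \<pi> p \<in> U \<Longrightarrow> \<psi> p \<in> Ggrp" "\<And>p. \<pi> p \<in> U \<Longrightarrow> \<kappa> (\<pi> p, \<psi> p) = p"
    and proj: "\<And>y g. y \<in> U \<Longrightarrow> g \<in> Ggrp \<Longrightarrow> \<pi> (\<kappa> (y, g)) = y"
  obtain \<gamma> where \<gamma>: "smooth_map (sub_atlas UNIV) AM UNIV \<gamma>" "\<gamma> 0 = \<pi> p" "velocity AM \<gamma> 0 = v" "range \<gamma> \<subseteq> U"
    by (rule tangent_curve[OF AM v U])
  define x where "x t = \<kappa> (\<gamma> t, \<psi> p)" for t
  have "smooth_map (sub_atlas UNIV) AP UNIV x"
    unfolding x_def
    by (rule smooth_map_compose_prod[OF smooth_manifold_euclidean AM \<gamma>(1) _ smooth_map_const _ \<kappa>])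
      (use \<gamma> \<psi> U in auto)
  then have md: "mdiff (sub_atlas UNIV) AP x 0"
    by (rule smooth_map_mdiff[OF smooth_manifold_euclidean AP _ open_UNIV]) simp
  have x0: "x 0 = p" using \<psi> U \<gamma> by (simp add: x_def)
  have px: "\<pi> (x t) = \<gamma> t" for t
    unfolding x_def by (rule proj) (use \<gamma> \<psi> U in auto)
  have "pushforward AP AM \<pi> p (velocity AP x 0) = v"
    using pushforward_velocity[OF AP md mdiff_proj] \<gamma> by (simp add: x0 px)
  moreover have "velocity AP x 0 \<in> tangent_space AP p" using velocity_tangent[OF AP md] x0 by simp
  ultimately show ?thesis by (rule that[rotated])
qed

lemma mdiff_act: "g \<in> Ggrp \<Longrightarrow> mdiff AP AP (\<lambda>q. act q g) p"
proof -
  assume g: "g \<in> Ggrp"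
  have "smooth_map AP AP UNIV (\<lambda>q. (\<lambda>(p, g). act p g) (q, g))"
    by (rule smooth_map_compose_prod[OF AP AP smooth_map_ident[OF AP] _ smooth_map_const _ act_smooth])
      (use g in auto)
  then show ?thesis by (intro smooth_map_mdiff[OF AP AP _ open_UNIV]) auto
qed

lemma velocity_act:
  assumes x: "mdiff (sub_atlas UNIV) AP x 0" and y: "range y \<subseteq> Ggrp" "(y has_vector_derivative y') (at 0)"
  shows "velocity AP (\<lambda>t. act (x t) (y t)) 0 =
    (\<lambda>d. velocity AP (\<lambda>t. act (x t) (y 0)) 0 d + velocity AP (\<lambda>t. act (x 0) (y t)) 0 d)"
proof
  fix d
  show "velocity AP (\<lambda>t. act (x t) (y t)) 0 d =
    velocity AP (\<lambda>t. act (x t) (y 0)) 0 d + velocity AP (\<lambda>t. act (x 0) (y t)) 0 d"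
  proof (cases "d \<in> AP \<and> act (x 0) (y 0) \<in> fst d")
    case True
    have g: "y 0 \<in> Ggrp" using y by auto
    obtain c where c: "c \<in> AP" "x 0 \<in> fst c" using chart_exists[OF AP] by metis
    have "act (x 0) (y 0) \<in> fst d" "d \<in> AP" using True by auto
    from velocity_prod_map[OF AP AP act_smooth c g this(2,1)]
    obtain L where lin: "linear L" and "\<forall>u w w'. mdiff (sub_atlas UNIV) AP u 0 \<and> u 0 = x 0 \<and>
        range w \<subseteq> Ggrp \<and> w 0 = y 0 \<and> (w has_vector_derivative w') (at (0::real)) \<longrightarrow>
        velocity AP (\<lambda>t. act (u t) (w t)) 0 d = L (velocity AP u 0 c, w')"
      by (elim exE conjE) (rule that)
    then have L: "mdiff (sub_atlas UNIV) AP u 0 \<Longrightarrow> u 0 = x 0 \<Longrightarrow>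
        range w \<subseteq> Ggrp \<Longrightarrow> w 0 = y 0 \<Longrightarrow> (w has_vector_derivative w') (at (0::real)) \<Longrightarrow>
        velocity AP (\<lambda>t. act (u t) (w t)) 0 d = L (velocity AP u 0 c, w')" for u w w' by blast
    have "velocity AP (\<lambda>t. act (x t) (y t)) 0 d = L (velocity AP x 0 c, y')"
      by (rule L[OF x _ y(1) _ y(2)]) auto
    moreover have "velocity AP (\<lambda>t. act (x t) (y 0)) 0 d = L (velocity AP x 0 c, 0)"
      by (rule L[OF x]) (use g in auto)
    moreover have "velocity AP (\<lambda>t. act (x 0) (y t)) 0 d = L (0, y')"
      using L[OF mdiff_const[OF smooth_manifold_euclidean AP] _ y(1) _ y(2), of "x 0"]
      by (simp add: velocity_const)
    moreover have "L (velocity AP x 0 c, y') = L (velocity AP x 0 c, 0) + L (0, y')"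
      using linear_add[OF lin, of "(velocity AP x 0 c, 0)" "(0, y')"] by simp
    ultimately show ?thesis by simp
  next
    case False
    then show ?thesis by (auto simp: velocity_def)
  qed
qed

lemma orbit_mdiff:
  assumes y: "range y \<subseteq> Ggrp" "smooth_on UNIV y"
  shows "mdiff (sub_atlas UNIV) AP (\<lambda>t::real. act p (y t)) t"
proof -
  have "smooth_map (sub_atlas UNIV) AP UNIV (\<lambda>t. (\<lambda>(p, g). act p g) (p, y t))"
    by (rule smooth_map_compose_prod[OF smooth_manifold_euclidean AP smooth_map_const _
          smooth_curve_sub_atlas[OF y] _ act_smooth]) (use y in auto)
  then show ?thesis by (intro smooth_map_mdiff[OF smooth_manifold_euclidean AP _ open_UNIV]) auto
qed

lemma orbit_vertical:
  assumes y: "range y \<subseteq> Ggrp" "smooth_on UNIV y"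
  shows "pushforward AP AM \<pi> (act p (y 0)) (velocity AP (\<lambda>t. act p (y t)) 0) = (\<lambda>_. 0)"
proof -
  have "\<pi> (act p (y t)) = \<pi> p" for t using proj_act y by blast
  then show ?thesis
    using pushforward_velocity[OF AP orbit_mdiff[OF y] mdiff_proj, of p 0] by (simp add: velocity_const)
qed

text \<open>A function with zero derivative that is constant on the fibres descends to a locally constant
  function on the base.\<close>

lemma fibre_invariant_constant:
  assumes conn: "connected (UNIV :: 'm set)"
    and f: "\<And>q. mdiff AP (sub_atlas UNIV) f q"
    and z: "\<And>q v. v \<in> tangent_space AP q \<Longrightarrow> tderiv AP f q v = 0"
    and inv: "\<And>q g. g \<in> Ggrp \<Longrightarrow> f (act q g) = f q"
  shows "f p = f q"
proof -
  have op: "open {x. \<exists>p. \<pi> p = x \<and> f p \<in> Z}" for Z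
  proof (subst open_subopen, intro ballI)
    fix x assume "x \<in> {x. \<exists>p. \<pi> p = x \<and> f p \<in> Z}"
    then obtain p where p: "\<pi> p = x" "f p \<in> Z" by blast
    obtain N where N: "open N" "p \<in> N" "\<And>q. q \<in> N \<Longrightarrow> f q = f p"
      using zero_tderiv_locally_constant[OF AP f z, of p] by metis
    show "\<exists>T. open T \<and> x \<in> T \<and> T \<subseteq> {x. \<exists>p. \<pi> p = x \<and> f p \<in> Z}"
    proof (rule trivialization[of x])
      fix U \<psi> \<kappa>
      assume U: "open U" "x \<in> U" and \<kappa>: "smooth_map (prod_atlas AM (sub_atlas Ggrp)) AP (U \<times> Ggrp) \<kappa>"
        and \<psi>: "\<And>p. \<pi> p \<in> U \<Longrightarrow> \<psi> p \<in> Ggrp" "\<And>p. \<pi> p \<in> U \<Longrightarrow> \<kappa> (\<pi> p, \<psi> p) = p"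
        and proj: "\<And>y g. y \<in> U \<Longrightarrow> g \<in> Ggrp \<Longrightarrow> \<pi> (\<kappa> (y, g)) = y"
      have pU: "\<pi> p \<in> U" using U p by simp
      have "continuous_on U (\<lambda>y. (y, \<psi> p))"
        by (intro continuous_on_Pair continuous_on_id continuous_on_const)
      then have "continuous_on U (\<lambda>y. \<kappa> (y, \<psi> p))"
        by (rule continuous_on_compose2[OF smooth_mapD(1)[OF \<kappa>]]) (use \<psi>(1)[OF pU] in blast)
      from continuous_open_preimage[OF this U(1) N(1)]
      have "open (U \<inter> (\<lambda>y. \<kappa> (y, \<psi> p)) -` N)" .
      moreover have "x \<in> U \<inter> (\<lambda>y. \<kappa> (y, \<psi> p)) -` N"
        using U(2) N(2) \<psi>(2)[OF pU] unfolding p(1) by simp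
      moreover have "U \<inter> (\<lambda>y. \<kappa> (y, \<psi> p)) -` N \<subseteq> {x. \<exists>p. \<pi> p = x \<and> f p \<in> Z}"
        using N(3) p(2) proj \<psi>(1)[OF pU] by fastforce
      ultimately show ?thesis by blast
    qed
  qed
  have fib: "f p = f q" if pq: "\<pi> p = \<pi> q" for p q
  proof -
    obtain g where "g \<in> Ggrp" "q = act p g" by (rule fibre_transitive[OF pq])
    then show ?thesis using inv by simp
  qed
  define T where "T = {x. \<exists>p. \<pi> p = x \<and> f p \<in> {f q}}"
  have T': "- T = {x. \<exists>p. \<pi> p = x \<and> f p \<in> - {f q}}"
  proof (intro set_eqI iffI)
    fix x assume x: "x \<in> - T"
    obtain p where "\<pi> p = x" using surj_proj by (metis surjD)
    then show "x \<in> {x. \<exists>p. \<pi> p = x \<and> f p \<in> - {f q}}" using x by (auto simp: T_def)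
  next
    fix x assume "x \<in> {x. \<exists>p. \<pi> p = x \<and> f p \<in> - {f q}}"
    then obtain p where p: "\<pi> p = x" "f p \<noteq> f q" by blast
    show "x \<in> - T"
    proof
      assume "x \<in> T"
      then obtain p' where "\<pi> p' = x" "f p' = f q" unfolding T_def by blast
      with p fib[of p' p] show False by simp
    qed
  qed
  have "open T" unfolding T_def by (rule op)
  moreover have "open (- T)" unfolding T' by (rule op)
  moreover have "\<pi> q \<in> T" unfolding T_def by blast
  ultimately have "T = UNIV"
    using connected_clopen[THEN iffD1, OF conn] by (auto simp: closed_def)
  then have "\<pi> p \<in> T" by simp
  then obtain p' where "\<pi> p' = \<pi> p" "f p' = f q" unfolding T_def by blast
  with fib[of p' p] show ?thesis by simp
qed

end

section \<open>Reduction of the bundle by the Higgs field\<close>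

locale higgs = principal AM AP \<pi> act
  for AM :: "('m::{t2_space,second_countable_topology}, real^3) chart set"
    and AP :: "('p::{t2_space,second_countable_topology}, real^7) chart set"
    and \<pi> :: "'p \<Rightarrow> 'm" and act :: "'p \<Rightarrow> mat_pair \<Rightarrow> 'p" +
  fixes \<phi> :: "'p \<Rightarrow> complex^2" and v :: real and \<eta> :: "'m \<Rightarrow> real" and \<phi>' :: "'p \<Rightarrow> mat_pair set"
  assumes higgs: "higgs_field AP act \<phi>" and v: "v \<noteq> 0"
    and polar: "polar_decomposition \<pi> act v \<phi> \<eta> \<phi>'"
begin

definition gauge_frame :: "'p \<Rightarrow> mat_pair" where
  "gauge_frame p = frame v (\<phi> p)"

text \<open>The retraction of the bundle onto the reduced bundle along the fibres. Pulling an equivariant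
  object back by it expresses the object in the gauge given by the frame.\<close>

definition retr :: "'p \<Rightarrow> 'p" where
  "retr p = act p (gauge_frame p)"

lemma \<phi>_nonzero: "\<phi> p \<noteq> 0" and \<phi>_smooth: "smooth_fun AP UNIV \<phi>"
  using higgs by (auto simp: higgs_field_def)

lemma gauge_frame_Ggrp: "gauge_frame p \<in> Ggrp"
  unfolding gauge_frame_def by (rule frame_Ggrp[OF v \<phi>_nonzero])

lemma gauge_frame_smooth: "smooth_map AP (sub_atlas Ggrp) UNIV gauge_frame"
  and gauge_frame_smooth_fun: "smooth_fun AP UNIV gauge_frame"
proof -
  have c: "continuous_on UNIV \<phi>" and s: "\<forall>c\<in>AP. smooth_on (snd c ` (fst c \<inter> UNIV)) (\<lambda>u. \<phi> (chart_inv c u))"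
    using \<phi>_smooth smooth_map_sub_atlas[of \<phi> UNIV UNIV AP] by auto
  have 1: "continuous_on UNIV gauge_frame"
    unfolding gauge_frame_def
    by (rule continuous_on_compose2[OF smooth_on_continuous[OF smooth_on_frame] c]) (use \<phi>_nonzero in auto)
  have 2: "\<forall>c\<in>AP. smooth_on (snd c ` (fst c \<inter> UNIV)) (\<lambda>u. gauge_frame (chart_inv c u))"
    unfolding gauge_frame_def
    by (intro ballI smooth_on_compose[OF smooth_on_frame s[rule_format]]) (use \<phi>_nonzero in auto)
  show "smooth_map AP (sub_atlas Ggrp) UNIV gauge_frame"
    using smooth_map_sub_atlas[of gauge_frame UNIV Ggrp AP] 1 2 gauge_frame_Ggrp by blast
  show "smooth_fun AP UNIV gauge_frame"
    using smooth_map_sub_atlas[of gauge_frame UNIV UNIV AP] 1 2 by blast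
qed

lemma \<phi>_eq: "\<phi> p = (norm (\<phi> p) / \<bar>v\<bar>) *\<^sub>R rho (gauge_frame p) (vector [0, of_real v])"
  using rho_frame[OF \<phi>_nonzero, of v p] v \<phi>_nonzero by (simp add: gauge_frame_def)

text \<open>The frame and any representative \<open>h\<close> of the coset map \<open>(0, v)\<close> to positive multiples of the
  same vector. As both are unitary the multiples agree, so that they differ by an element of the
  stabilizer \<open>Kgrp\<close>.\<close>

lemma \<phi>'_eq: "\<phi>' p = coset (gauge_frame p)"
proof -
  let ?v = "vector [0, of_real v] :: complex^2"
  obtain h where h: "h \<in> Ggrp" "\<phi>' p = coset h"
    using polar unfolding polar_decomposition_def by blast
  have "h \<in> \<phi>' p" using h gone_mem_coset by simp
  then have h\<phi>: "\<phi> p = (\<eta> (\<pi> p) / sqrt 2) *\<^sub>R rho h ?v" and \<eta>: "\<eta> (\<pi> p) > 0"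
    using polar by (auto simp: polar_decomposition_def)
  define k where "k = gmult (ginv h) (gauge_frame p)"
  have k: "k \<in> Ggrp" unfolding k_def by (intro Ggrp_gmult Ggrp_ginv h gauge_frame_Ggrp)
  define r where "r = (\<bar>v\<bar> / norm (\<phi> p)) * (\<eta> (\<pi> p) / sqrt 2)"
  have r: "r > 0" using v \<phi>_nonzero \<eta> by (simp add: r_def)
  have "rho k ?v = rho (ginv h) ((\<bar>v\<bar> / norm (\<phi> p)) *\<^sub>R \<phi> p)"
    by (simp add: k_def rho_gmult gauge_frame_def rho_frame[OF \<phi>_nonzero])
  also have "\<dots> = (\<bar>v\<bar> / norm (\<phi> p)) *\<^sub>R rho (ginv h) ((\<eta> (\<pi> p) / sqrt 2) *\<^sub>R rho h ?v)"
    by (simp add: rho_scaleR h\<phi>[symmetric])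
  also have "\<dots> = r *\<^sub>R ?v"
    by (simp add: rho_scaleR rho_ginv(2)[OF h(1)] r_def)
  finally have rk: "rho k ?v = r *\<^sub>R ?v" .
  have e: "snd k * fst k $ 1 $ 2 = 0" "snd k * fst k $ 2 $ 2 = of_real r"
  proof -
    have "rho k ?v $ 1 = (r *\<^sub>R ?v) $ 1" "rho k ?v $ 2 = (r *\<^sub>R ?v) $ 2" by (simp_all only: rk)
    then have "snd k * fst k $ 1 $ 2 * of_real v = 0"
      "snd k * fst k $ 2 $ 2 * of_real v = of_real r * of_real v"
      by (simp_all add: rho_nth scaleR_conv_of_real[where 'a = complex])
    then show "snd k * fst k $ 1 $ 2 = 0" "snd k * fst k $ 2 $ 2 = of_real r" using v by simp_all
  qed
  have sk: "cmod (snd k) = 1" using k by (simp add: Ggrp_iff)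
  have "(adjoint_mat (fst k) ** fst k) $ 2 $ 2 = 1"
    using SU2_adjoint_left[of "fst k"] k by (simp add: Ggrp_iff mat_def)
  then have "cnj (fst k $ 1 $ 2) * fst k $ 1 $ 2 + cnj (fst k $ 2 $ 2) * fst k $ 2 $ 2 = 1"
    by (simp add: mat_mult_2_nth)
  moreover have "fst k $ 1 $ 2 = 0" using e sk by auto
  ultimately have "fst k $ 2 $ 2 * cnj (fst k $ 2 $ 2) = 1" by (simp add: mult.commute)
  then have "cmod (fst k $ 2 $ 2) ^ 2 = 1"
    by (metis complex_norm_square of_real_eq_1_iff)
  then have "cmod (fst k $ 2 $ 2) = 1" using norm_ge_zero[of "fst k $ 2 $ 2"] by (auto simp: power2_eq_1_iff simp del: norm_ge_zero)
  then have "cmod (snd k * fst k $ 2 $ 2) = 1" using sk by (simp add: norm_mult)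
  then have "r = 1" using r e by simp
  then have "k \<in> Kgrp" unfolding Kgrp_stabilizer[OF v] using rk k by simp
  moreover have "gauge_frame p = gmult h k" by (simp add: k_def gmult_ginv_assoc h)
  ultimately show ?thesis using coset_eqI[OF h(1)] h(2) by simp
qed

lemma reduced_iff: "p \<in> reduced_bundle \<phi>' \<longleftrightarrow> gauge_frame p = gone"
proof
  assume "p \<in> reduced_bundle \<phi>'"
  then have "gauge_frame p \<in> coset gone"
    using gone_mem_coset[of "gauge_frame p"] \<phi>'_eq[of p] by (simp add: reduced_bundle_def)
  then have "gauge_frame p \<in> Kgrp" by (simp add: coset_def)
  then show "gauge_frame p = gone" unfolding gauge_frame_def by (rule frame_Kgrp)
qed (simp add: reduced_bundle_def \<phi>'_eq)

lemma gauge_frame_act: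
  assumes g: "g \<in> Ggrp"
  obtains k where "k \<in> Kgrp" "gauge_frame (act p g) = gmult (gmult (ginv g) (gauge_frame p)) k"
proof -
  have "\<phi>' (act p g) = gmult (ginv g) ` \<phi>' p"
    using polar g by (auto simp: polar_decomposition_def)
  then have "gauge_frame (act p g) \<in> gmult (ginv g) ` coset (gauge_frame p)"
    using gone_mem_coset[of "gauge_frame (act p g)"] by (simp add: \<phi>'_eq)
  then show ?thesis using that unfolding coset_def by (auto simp: gmult_assoc)
qed

lemma retr_reduced: "retr p \<in> reduced_bundle \<phi>'"
proof -
  obtain k where k: "k \<in> Kgrp" 
    "gauge_frame (retr p) = gmult (gmult (ginv (gauge_frame p)) (gauge_frame p)) k"
    unfolding retr_def by (rule gauge_frame_act[OF gauge_frame_Ggrp])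
  then have "gauge_frame (retr p) \<in> Kgrp" by (simp add: gmult_ginv[OF gauge_frame_Ggrp])
  then show ?thesis unfolding reduced_iff unfolding gauge_frame_def by (rule frame_Kgrp)
qed

lemma retr_fixed: "p \<in> reduced_bundle \<phi>' \<Longrightarrow> retr p = p"
  by (simp add: retr_def reduced_iff)

lemma retr_smooth: "smooth_map AP AP UNIV retr"
proof -
  have "smooth_map AP AP UNIV (\<lambda>p. (\<lambda>(p, g). act p g) (p, gauge_frame p))"
    by (rule smooth_map_compose_prod[OF AP AP smooth_map_ident[OF AP] _ gauge_frame_smooth _ act_smooth])
      (use gauge_frame_Ggrp in auto)
  then show ?thesis by (simp add: retr_def[abs_def])
qed

lemma mdiff_retr: "mdiff AP AP retr p"
  by (rule smooth_map_mdiff[OF AP AP retr_smooth open_UNIV]) simp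

lemma gauge_frame_curve:
  assumes "smooth_map (sub_atlas UNIV) AP UNIV \<gamma>"
  shows "smooth_on UNIV (\<lambda>t::real. gauge_frame (\<gamma> t))"
  by (rule smooth_on_curve[OF AP assms gauge_frame_smooth_fun])

lemma pushforward_retr_reduced:
  assumes "p \<in> reduced_bundle \<phi>'" "w \<in> sub_tangent_space AP (reduced_bundle \<phi>') p"
  shows "pushforward AP AP retr p w = w"
proof -
  obtain \<gamma> e where w: "w = velocity AP \<gamma> 0" "\<gamma> 0 = p" "e > 0" "\<gamma> ` {-e<..<e} \<subseteq> reduced_bundle \<phi>'"
    "smooth_map (sub_atlas UNIV) AP {-e<..<e} \<gamma>" using assms(2) by (auto simp: sub_tangent_space_def)
  have md: "mdiff (sub_atlas UNIV) AP \<gamma> 0"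
    by (rule smooth_map_mdiff[OF smooth_manifold_euclidean AP w(5)]) (use w in auto)
  have "pushforward AP AP retr p w = velocity AP (\<lambda>t. retr (\<gamma> t)) 0"
    using pushforward_velocity[OF AP md mdiff_retr] w by simp
  also have "\<dots> = w" unfolding w(1)
    by (rule velocity_cong[of "{-e<..<e}"]) (use w(3) retr_fixed[OF w(4)[THEN subsetD, OF imageI]] in auto)
  finally show ?thesis .
qed

text \<open>Tangent vectors of the reduced bundle are velocities of curves in it; the retraction provides as
  many of them as are needed to test a horizontal or connection form everywhere.\<close>

lemma pushforward_retr_sub_tangent:
  assumes "w \<in> tangent_space AP p"
  shows "pushforward AP AP retr p w \<in> sub_tangent_space AP (reduced_bundle \<phi>') (retr p)"
proof -
  obtain \<gamma> where \<gamma>: "smooth_map (sub_atlas UNIV) AP UNIV \<gamma>" "\<gamma> 0 = p" "velocity AP \<gamma> 0 = w"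
    using tangent_curve[OF AP assms open_UNIV] by auto
  have md: "mdiff (sub_atlas UNIV) AP \<gamma> 0"
    by (rule smooth_map_mdiff[OF smooth_manifold_euclidean AP \<gamma>(1) open_UNIV]) simp
  have r: "range (\<lambda>t. gauge_frame (\<gamma> t)) \<subseteq> Ggrp" using gauge_frame_Ggrp by auto
  have "smooth_map (sub_atlas UNIV) AP UNIV (\<lambda>t. (\<lambda>(p, g). act p g) (\<gamma> t, gauge_frame (\<gamma> t)))"
    by (rule smooth_map_compose_prod[OF smooth_manifold_euclidean AP \<gamma>(1) _
          smooth_curve_sub_atlas[OF r gauge_frame_curve[OF \<gamma>(1)]] r act_smooth]) simp
  from smooth_map_subset[OF this subset_UNIV]
  have "smooth_map (sub_atlas UNIV) AP {-1<..<1} (\<lambda>t. retr (\<gamma> t))"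
    by (simp add: retr_def)
  moreover have "pushforward AP AP retr p w = velocity AP (\<lambda>t. retr (\<gamma> t)) 0"
    using pushforward_velocity[OF AP md mdiff_retr] \<gamma> by simp
  moreover have "(\<lambda>t. retr (\<gamma> t)) ` {-1<..<1} \<subseteq> reduced_bundle \<phi>'" using retr_reduced by auto
  ultimately show ?thesis unfolding sub_tangent_space_def
    using \<gamma>(2) by (intro CollectI exI[of _ "\<lambda>t. retr (\<gamma> t)"] conjI exI[of _ 1]) auto
qed

text \<open>The product rule for the action splits the derivative of the retraction into the right
  translation by the frame and a vertical vector, the velocity of an orbit.\<close>

lemma pushforward_retr:
  assumes w: "w \<in> tangent_space AP p"
  obtains \<gamma> c b' where "smooth_map (sub_atlas UNIV) AP UNIV \<gamma>" "\<gamma> 0 = p" "velocity AP \<gamma> 0 = w"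
    "((\<lambda>t. gauge_frame (\<gamma> t)) has_vector_derivative b') (at 0)"
    "smooth_on UNIV c" "range c \<subseteq> Ggrp" "c 0 = gone"
    "(c has_vector_derivative gmult (ginv (gauge_frame p)) b') (at (0::real))"
    "pushforward AP AP retr p w = (\<lambda>d. pushforward AP AP (\<lambda>q. act q (gauge_frame p)) p w d +
       velocity AP (\<lambda>t. act (retr p) (c t)) 0 d)"
proof -
  obtain \<gamma> where \<gamma>: "smooth_map (sub_atlas UNIV) AP UNIV \<gamma>" "\<gamma> 0 = p" "velocity AP \<gamma> 0 = w"
    using tangent_curve[OF AP w open_UNIV] by auto
  have md: "mdiff (sub_atlas UNIV) AP \<gamma> 0"
    by (rule smooth_map_mdiff[OF smooth_manifold_euclidean AP \<gamma>(1) open_UNIV]) simp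
  have r: "range (\<lambda>t. gauge_frame (\<gamma> t)) \<subseteq> Ggrp" using gauge_frame_Ggrp by auto
  define b' where "b' = vector_derivative (\<lambda>t. gauge_frame (\<gamma> t)) (at 0)"
  have b': "((\<lambda>t. gauge_frame (\<gamma> t)) has_vector_derivative b') (at 0)"
    unfolding b'_def vector_derivative_works[symmetric]
    by (rule smooth_on_differentiable[OF gauge_frame_curve[OF \<gamma>(1)]]) auto
  define c where "c t = gmult (ginv (gauge_frame p)) (gauge_frame (\<gamma> t))" for t
  have c: "smooth_on UNIV c" unfolding c_def
    by (rule smooth_on_bilinear[OF bounded_bilinear_gmult smooth_on_const gauge_frame_curve[OF \<gamma>(1)]])
  have c_der: "(c has_vector_derivative gmult (ginv (gauge_frame p)) b') (at 0)" unfolding c_def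
    by (rule bounded_linear.has_vector_derivative[OF bounded_bilinear.bounded_linear_right[OF bounded_bilinear_gmult] b'])
  have cG: "range c \<subseteq> Ggrp"
    unfolding c_def using Ggrp_gmult[OF Ggrp_ginv[OF gauge_frame_Ggrp] gauge_frame_Ggrp] by auto
  have c0: "c 0 = gone" by (simp add: c_def \<gamma> gmult_ginv[OF gauge_frame_Ggrp])
  have orb: "act p (gauge_frame (\<gamma> t)) = act (retr p) (c t)" for t
  proof -
    have "act (retr p) (c t) = act p (gmult (gauge_frame p) (c t))"
      unfolding retr_def by (rule act_act[OF gauge_frame_Ggrp]) (use cG in auto)
    then show ?thesis by (simp add: c_def gmult_ginv_assoc[OF gauge_frame_Ggrp])
  qed
  have "pushforward AP AP retr p w = velocity AP (\<lambda>t. act (\<gamma> t) (gauge_frame (\<gamma> t))) 0"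
    using pushforward_velocity[OF AP md mdiff_retr] \<gamma> by (simp add: retr_def[symmetric])
  also have "\<dots> = (\<lambda>d. velocity AP (\<lambda>t. act (\<gamma> t) (gauge_frame p)) 0 d + velocity AP (\<lambda>t. act p (gauge_frame (\<gamma> t))) 0 d)"
    using velocity_act[OF md r b'] \<gamma> by simp
  also have "velocity AP (\<lambda>t. act (\<gamma> t) (gauge_frame p)) 0 = pushforward AP AP (\<lambda>q. act q (gauge_frame p)) p w"
    using pushforward_velocity[OF AP md mdiff_act[OF gauge_frame_Ggrp]] \<gamma> by simp
  finally show ?thesis using that[OF \<gamma> b' c cG c0 c_der] by (simp add: orb)
qed

text \<open>For horizontal forms the vertical part of the derivative of the retraction is invisible, so that
  the pullback by the retraction is the pullback by the right translation.\<close>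

lemma horizontal_form_retr:
  assumes \<alpha>: "smooth_form AP k \<alpha>" "horizontal_form AM AP \<pi> k \<alpha>" and vs: "vs \<in> tangent_tuples AP k p"
  shows "\<alpha> (retr p) (map (pushforward AP AP retr p) vs) =
    \<alpha> (retr p) (map (pushforward AP AP (\<lambda>q. act q (gauge_frame p)) p) vs)"
proof -
  let ?R = "pushforward AP AP (\<lambda>q. act q (gauge_frame p)) p"
  have "\<exists>n. n \<in> tangent_space AP (retr p) \<and> pushforward AP AM \<pi> (retr p) n = (\<lambda>_. 0) \<and>
      pushforward AP AP retr p w = (\<lambda>d. ?R w d + n d)" if w: "w \<in> tangent_space AP p" for w
  proof -
    obtain \<gamma> c b' where \<gamma>: "smooth_map (sub_atlas UNIV) AP UNIV \<gamma>" "\<gamma> 0 = p" "velocity AP \<gamma> 0 = w"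
      "((\<lambda>t. gauge_frame (\<gamma> t)) has_vector_derivative b') (at 0)"
      and c: "smooth_on UNIV c" "range c \<subseteq> Ggrp" "c 0 = gone"
      "(c has_vector_derivative gmult (ginv (gauge_frame p)) b') (at (0::real))"
      and eq: "pushforward AP AP retr p w = (\<lambda>d. ?R w d + velocity AP (\<lambda>t. act (retr p) (c t)) 0 d)"
      by (rule pushforward_retr[OF w])
    show ?thesis
      using velocity_tangent[OF AP orbit_mdiff[OF c(2,1)], of "retr p" 0] orbit_vertical[OF c(2,1), of "retr p"]
      by (intro exI[of _ "velocity AP (\<lambda>t. act (retr p) (c t)) 0"]) (simp add: c(3) eq)
  qed
  then have "\<forall>w\<in>tangent_space AP p. \<exists>n. n \<in> tangent_space AP (retr p) \<and>
      pushforward AP AM \<pi> (retr p) n = (\<lambda>_. 0) \<and> pushforward AP AP retr p w = (\<lambda>d. ?R w d + n d)"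
    by (rule ballI)
  from bchoice[OF this]
  obtain n where n: "\<And>w. w \<in> tangent_space AP p \<Longrightarrow> n w \<in> tangent_space AP (retr p)"
    "\<And>w. w \<in> tangent_space AP p \<Longrightarrow> pushforward AP AM \<pi> (retr p) (n w) = (\<lambda>_. 0)"
    "\<And>w. w \<in> tangent_space AP p \<Longrightarrow> pushforward AP AP retr p w = (\<lambda>d. ?R w d + n w d)"
    by blast
  have len: "length vs = k" and T: "set vs \<subseteq> tangent_space AP p" using vs by (auto simp: tangent_tuples_def)
  show ?thesis
  proof (rule horizontal_form_cong[OF \<alpha>])
    show "map ?R vs \<in> tangent_tuples AP k (retr p)"
      using len T pushforward_tangent[OF AP AP mdiff_act[OF gauge_frame_Ggrp]]
      by (auto simp: tangent_tuples_def retr_def)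
    show "map n vs \<in> tangent_tuples AP k (retr p)"
      using len T n(1) by (auto simp: tangent_tuples_def)
    show "map (pushforward AP AP retr p) vs \<in> tangent_tuples AP k (retr p)"
      using len T pushforward_tangent[OF AP AP mdiff_retr] by (auto simp: tangent_tuples_def)
    show "pushforward AP AM \<pi> (retr p) x = (\<lambda>_. 0)" if "x \<in> set (map n vs)" for x
      using that n(2) T by auto
    show "map (pushforward AP AP retr p) vs ! i = (\<lambda>c. (map ?R vs ! i) c + (map n vs ! i) c)" if "i < k" for i
      using that len n(3)[of "vs ! i"] T by (simp add: subset_iff)
  qed
qed

end

section \<open>Gauge transformations that fix the Higgs field\<close>

context higgs
begin

text \<open>The gauge transformation that is constantly \<open>kdiag s\<close> on the reduced bundle. Elsewhere its value is
  forced by equivariance.\<close>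

definition kgauge :: "complex \<Rightarrow> 'p \<Rightarrow> mat_pair" where
  "kgauge s p = gmult (gmult (gauge_frame p) (kdiag s)) (ginv (gauge_frame p))"

lemma kgauge_reduced: "p \<in> reduced_bundle \<phi>' \<Longrightarrow> kgauge s p = kdiag s"
  by (simp add: kgauge_def reduced_iff)

lemma kgauge_Ggrp: "cmod s = 1 \<Longrightarrow> kgauge s p \<in> Ggrp"
  unfolding kgauge_def by (intro Ggrp_gmult Ggrp_ginv gauge_frame_Ggrp kdiag_Ggrp)

lemma ginv_kgauge: "ginv (kgauge s p) = kgauge (cnj s) p"
  by (simp add: kgauge_def ginv_gmult ginv_kdiag gmult_assoc)

lemma kgauge_smooth: 
  assumes "cmod s = 1"
  shows "smooth_map AP (sub_atlas Ggrp) UNIV (kgauge s)"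
proof -
  have c: "continuous_on UNIV gauge_frame"
    and s: "\<And>c. c \<in> AP \<Longrightarrow> smooth_on (snd c ` (fst c \<inter> UNIV)) (\<lambda>u. gauge_frame (chart_inv c u))"
    using gauge_frame_smooth_fun smooth_map_sub_atlas[of gauge_frame UNIV UNIV AP] by auto
  have "continuous_on UNIV (kgauge s)" unfolding kgauge_def
    by (intro bounded_bilinear.continuous_on[OF bounded_bilinear_gmult] continuous_on_const c
        bounded_linear.continuous_on[OF bounded_linear_ginv])
  moreover have "smooth_on (snd c ` (fst c \<inter> UNIV)) (\<lambda>u. kgauge s (chart_inv c u))" if "c \<in> AP" for c
  proof -
    have "smooth_on (snd c ` (fst c \<inter> UNIV)) (\<lambda>u. ginv (gauge_frame (chart_inv c u)))"
      by (rule smooth_on_compose[OF smooth_on_linear[OF bounded_linear_ginv] s[OF that] subset_UNIV])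
    then show ?thesis unfolding kgauge_def
      by (intro smooth_on_bilinear[OF bounded_bilinear_gmult] smooth_on_const s[OF that])
  qed
  moreover have "kgauge s ` UNIV \<subseteq> Ggrp" using kgauge_Ggrp[OF assms] by auto
  ultimately show ?thesis using smooth_map_sub_atlas[of "kgauge s" UNIV Ggrp AP] by blast
qed

lemma kgauge_gauge_group:
  assumes "cmod s = 1"
  shows "kgauge s \<in> gauge_group AP act"
proof -
  have "kgauge s (act p g) = gmult (gmult (ginv g) (kgauge s p)) g" if g: "g \<in> Ggrp" for p g
  proof -
    obtain k where k: "k \<in> Kgrp" "gauge_frame (act p g) = gmult (gmult (ginv g) (gauge_frame p)) k"
      by (rule gauge_frame_act[OF g])
    obtain t where t: "cmod t = 1" "k = kdiag t" using k(1) by (auto simp: Kgrp_eq)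
    have "gmult k (gmult (kdiag s) (ginv k)) = kdiag s"
      using unit_mult_cnj[OF t(1)] by (simp add: t(2) ginv_kdiag gmult_kdiag mult.left_commute)
    then have "gmult k (gmult (kdiag s) (gmult (ginv k) x)) = gmult (kdiag s) x" for x
      by (metis gmult_assoc)
    then show ?thesis unfolding kgauge_def k(2) by (simp add: ginv_gmult gmult_assoc)
  qed
  then show ?thesis
    using kgauge_Ggrp[OF assms] kgauge_smooth[OF assms] by (auto simp: gauge_group_def)
qed

lemma kgauge_field: "cmod s = 1 \<Longrightarrow> gauge_field (kgauge s) \<phi> p = \<phi> p"
proof -
  assume "cmod s = 1"
  then have "kdiag s \<in> Kgrp" by (auto simp: Kgrp_eq)
  then have "rho (kdiag s) (vector [0, of_real v]) = vector [0, of_real v]"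
    unfolding Kgrp_stabilizer[OF v] by simp
  then have "rho (kgauge s p) (rho (gauge_frame p) (vector [0, of_real v])) =
      rho (gauge_frame p) (vector [0, of_real v])"
    by (simp add: kgauge_def rho_gmult rho_ginv[OF gauge_frame_Ggrp])
  then show ?thesis unfolding gauge_field_def by (subst (1 2) \<phi>_eq) (simp add: rho_scaleR)
qed

text \<open>A gauge transformation that fixes the Higgs field takes values in \<open>Kgrp\<close> on the reduced bundle, where it is therefore
  determined by its \<open>U(1)\<close> component. This component is invariant along the fibres of the whole
  bundle.\<close>

lemma gauge_eq_kgauge:
  assumes l: "l \<in> gauge_group AP act" and fix_\<phi>: "\<And>p. gauge_field l \<phi> p = \<phi> p"
  shows "l p = kgauge (snd (l p)) p"
proof -
  have G: "l q \<in> Ggrp" for q using l by (auto simp: gauge_group_def)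
  have eq: "l (retr p) = gmult (gmult (ginv (gauge_frame p)) (l p)) (gauge_frame p)"
    using l gauge_frame_Ggrp unfolding retr_def gauge_group_def by blast
  define q where "q = retr p"
  let ?v = "vector [0, of_real v] :: complex^2"
  have "gauge_frame q = gone" using retr_reduced unfolding reduced_iff q_def .
  then have "\<phi> q = (norm (\<phi> q) / \<bar>v\<bar>) *\<^sub>R ?v" using \<phi>_eq[of q] by simp
  moreover have "rho (l q) (\<phi> q) = \<phi> q" using fix_\<phi>[of q] by (simp add: gauge_field_def)
  ultimately have "(norm (\<phi> q) / \<bar>v\<bar>) *\<^sub>R rho (l q) ?v = (norm (\<phi> q) / \<bar>v\<bar>) *\<^sub>R ?v"
    by (metis rho_scaleR)
  then have "rho (l q) ?v = ?v" using v \<phi>_nonzero[of q] by simp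
  then have "l q \<in> Kgrp" unfolding Kgrp_stabilizer[OF v] using G by simp
  then have lq: "l q = kdiag (snd (l q))" by (auto simp: Kgrp_eq)
  have "snd (l q) = snd (l p)"
    using unit_mult_cnj[of "snd (gauge_frame p)"] gauge_frame_Ggrp[of p] unfolding q_def eq
    by (simp add: gmult_def ginv_def Ggrp_iff) (metis mult.commute mult.left_commute mult_1_right)
  then have "gmult (gmult (ginv (gauge_frame p)) (l p)) (gauge_frame p) = kdiag (snd (l p))"
    using lq eq by (simp add: q_def)
  then have "kgauge (snd (l p)) p =
      gmult (gmult (gauge_frame p) (gmult (gmult (ginv (gauge_frame p)) (l p)) (gauge_frame p))) (ginv (gauge_frame p))"
    unfolding kgauge_def by simp
  then show ?thesis
    by (simp add: gmult_assoc gmult_ginv_assoc[OF gauge_frame_Ggrp] gmult_ginv[OF gauge_frame_Ggrp])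
qed

lemma gauge_mdiff_ginv:
  assumes l: "l \<in> gauge_group AP act"
  shows "mdiff AP (sub_atlas UNIV) (\<lambda>q. ginv (l q)) p"
proof -
  have r: "range l \<subseteq> Ggrp" and s: "smooth_map AP (sub_atlas Ggrp) UNIV l"
    using l by (auto simp: gauge_group_def)
  have "smooth_map AP (sub_atlas UNIV) UNIV l"
    using s smooth_map_sub_atlas[OF r, of AP] smooth_map_sub_atlas[of l UNIV UNIV AP] by simp
  then have "mdiff AP (sub_atlas UNIV) l p"
    by (rule smooth_map_mdiff[OF AP smooth_manifold_euclidean _ open_UNIV]) simp
  then show ?thesis by (rule mdiff_bounded_linear(1)[OF AP _ bounded_linear_ginv])
qed

text \<open>Since \<open>U(1)\<close> is abelian, the \<open>U(1)\<close> component of the condition that \<open>l\<close> fixes the connection says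
  that the derivative of the \<open>U(1)\<close> component of \<open>l\<close> vanishes, on the whole bundle.\<close>

lemma gauge_snd_constant:
  assumes conn: "connected (UNIV :: 'm set)" and l: "l \<in> gauge_group AP act"
    and A: "\<And>p w. w \<in> tangent_space AP p \<Longrightarrow> gauge_conn AP l A p [w] = A p [w]"
  shows "snd (l p) = snd (l q)"
proof -
  have G: "l q \<in> Ggrp" for q using l by (auto simp: gauge_group_def)
  have n: "cmod (snd (l q)) = 1" for q using G by (simp add: Ggrp_iff)
  note md = gauge_mdiff_ginv[OF l]
  note sn = mdiff_bounded_linear[OF AP md bounded_linear_snd]
  have "snd (ginv (l p)) = snd (ginv (l q))"
  proof (rule fibre_invariant_constant[OF conn, where f = "\<lambda>q. snd (ginv (l q))"])
    show "mdiff AP (sub_atlas UNIV) (\<lambda>q. snd (ginv (l q))) q" for q by (rule sn(1))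
    show "tderiv AP (\<lambda>q. snd (ginv (l q))) q w = 0" if w: "w \<in> tangent_space AP q" for q w
    proof -
      have "snd (gauge_conn AP l A q [w]) = snd (A q [w])" using A[OF w] by simp
      moreover have "snd (Ad (l q) X) = snd X" for X
        using unit_mult_cnj[OF n] by (simp add: Ad_def gmult_def ginv_def algebra_simps)
      ultimately have "snd (l q) * snd (tderiv AP (\<lambda>q. ginv (l q)) q w) = 0"
        by (simp add: gauge_conn_def gmult_def)
      moreover have "snd (l q) \<noteq> 0" using n[of q] by auto
      ultimately show ?thesis using sn(2) by simp
    qed
    show "snd (ginv (l (act q g))) = snd (ginv (l q))" if g: "g \<in> Ggrp" for q g
    proof -
      have "l (act q g) = gmult (gmult (ginv g) (l q)) g" using l g by (auto simp: gauge_group_def)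
      then show ?thesis using unit_mult_cnj[of "snd g"] g
        by (simp add: gmult_def ginv_def Ggrp_iff)
    qed
  qed
  then show ?thesis by (simp add: ginv_def)
qed

section \<open>Invariance of the connection and the momenta\<close>

text \<open>The pullback of the connection by the retraction is its transform by the frame, and \<open>kgauge s\<close> is
  the constant \<open>kdiag s\<close> in this gauge, so its derivative drops out.\<close>

lemma gauge_conn_kgauge:
  assumes A: "connection_form AP act A" and s: "cmod s = 1" and w: "w \<in> tangent_space AP p"
  defines "Z \<equiv> A (retr p) [pushforward AP AP retr p w]"
  shows "gauge_conn AP (kgauge s) A p [w] - A p [w] = Ad (gauge_frame p) (Ad (kdiag s) Z - Z)"
proof -
  let ?b = "gauge_frame p" and ?k = "kdiag s" and ?R = "pushforward AP AP (\<lambda>q. act q (gauge_frame p)) p w"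
  obtain \<gamma> c b' where \<gamma>: "smooth_map (sub_atlas UNIV) AP UNIV \<gamma>" "\<gamma> 0 = p" "velocity AP \<gamma> 0 = w"
      and b': "((\<lambda>t. gauge_frame (\<gamma> t)) has_vector_derivative b') (at 0)"
      and c: "smooth_on UNIV c" "range c \<subseteq> Ggrp" "c 0 = gone"
      and c': "(c has_vector_derivative gmult (ginv ?b) b') (at (0::real))"
      and eq: "pushforward AP AP retr p w = (\<lambda>d. ?R d + velocity AP (\<lambda>t. act (retr p) (c t)) 0 d)"
    by (rule pushforward_retr[OF w])
  have md: "mdiff (sub_atlas UNIV) AP \<gamma> 0"
    by (rule smooth_map_mdiff[OF smooth_manifold_euclidean AP \<gamma>(1) open_UNIV]) simp
  define Y where "Y = gmult (ginv ?b) b'"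
  note G = gauge_frame_Ggrp[of p]
  have bY: "b' = gmult ?b Y" by (simp add: Y_def gmult_ginv_assoc(1)[OF G])
  let ?V = "velocity AP (\<lambda>t. act (retr p) (c t)) 0"
  have "\<forall>p c. smooth_on UNIV c \<and> range c \<subseteq> Ggrp \<and> c 0 = gone \<longrightarrow>
      A p [velocity AP (\<lambda>t. act p (c t)) 0] = vector_derivative c (at (0::real))"
    using A by (simp add: connection_form_def)
  then have "A (retr p) [?V] = vector_derivative c (at 0)" using c by (elim allE impE) auto
  then have "A (retr p) [?V] = Y" using vector_derivative_at[OF c'] by (simp add: Y_def)
  moreover have "A (retr p) [?R] = Ad (ginv ?b) (A p [w])"
    using A w G unfolding connection_form_def retr_def by blast
  moreover have "A (retr p) [\<lambda>d. ?R d + ?V d] = A (retr p) [?R] + A (retr p) [?V]"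
  proof -
    have "?R \<in> tangent_space AP (retr p)"
      unfolding retr_def by (rule pushforward_tangent[OF AP AP mdiff_act[OF G] w])
    moreover have "?V \<in> tangent_space AP (retr p)"
      using velocity_tangent[OF AP orbit_mdiff[OF c(2,1)], of "retr p" 0] by (simp add: c(3))
    moreover have "smooth_form AP 1 A" using A by (simp add: connection_form_def)
    ultimately show ?thesis
      using smooth_formD(1)[of AP 1 A "[?R]" "retr p" 0 ?R ?V]
        tangent_tuples_1[of "[?R]" AP "retr p"] by simp
  qed
  ultimately have Z: "Z = Ad (ginv ?b) (A p [w]) + Y" by (simp add: Z_def eq)
  have gb': "((\<lambda>t. ginv (gauge_frame (\<gamma> t))) has_vector_derivative ginv b') (at 0)"
    by (rule bounded_linear.has_vector_derivative[OF bounded_linear_ginv b'])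
  have bk: "((\<lambda>t. gmult (gauge_frame (\<gamma> t)) (kdiag (cnj s))) has_vector_derivative gmult b' (kdiag (cnj s))) (at 0)"
    by (rule bounded_linear.has_vector_derivative[OF bounded_bilinear.bounded_linear_left[OF bounded_bilinear_gmult] b'])
  have "((\<lambda>t. ginv (kgauge s (\<gamma> t))) has_vector_derivative
      gmult (gmult ?b (kdiag (cnj s))) (ginv b') + gmult (gmult b' (kdiag (cnj s))) (ginv ?b)) (at 0)"
    unfolding ginv_kgauge unfolding kgauge_def
    using bounded_bilinear.has_vector_derivative[OF bounded_bilinear_gmult bk gb'] by (simp add: \<gamma>)
  moreover have "tderiv AP (\<lambda>q. ginv (kgauge s q)) p w = vector_derivative (\<lambda>t. ginv (kgauge s (\<gamma> t))) (at 0)"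
    using tderiv_velocity[OF AP md gauge_mdiff_ginv[OF kgauge_gauge_group[OF s]]] \<gamma> by simp
  ultimately have td: "tderiv AP (\<lambda>q. ginv (kgauge s q)) p w =
      gmult (gmult ?b (kdiag (cnj s))) (ginv b') + gmult (gmult b' (kdiag (cnj s))) (ginv ?b)"
    using vector_derivative_at by force
  \<comment> \<open>differentiate \<open>gmult b (ginv b) = gone\<close>\<close>
  have "((\<lambda>t. gmult (gauge_frame (\<gamma> t)) (ginv (gauge_frame (\<gamma> t)))) has_vector_derivative
      gmult ?b (ginv b') + gmult b' (ginv ?b)) (at 0)"
    using bounded_bilinear.has_vector_derivative[OF bounded_bilinear_gmult b' gb'] by (simp add: \<gamma>)
  moreover have "((\<lambda>t. gmult (gauge_frame (\<gamma> t)) (ginv (gauge_frame (\<gamma> t)))) has_vector_derivative 0) (at (0::real))"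
    by (simp add: gmult_ginv[OF gauge_frame_Ggrp])
  ultimately have "gmult ?b (ginv b') + gmult b' (ginv ?b) = 0"
    by (rule vector_derivative_unique_at)
  then have inv': "gmult ?b (ginv b') = - Ad ?b Y"
    by (simp add: eq_neg_iff_add_eq_0 Ad_def bY)
  have kk: "gmult ?k (gmult (kdiag (cnj s)) x) = x" for x
    by (simp add: gmult_assoc[symmetric] gmult_kdiag unit_mult_cnj[OF s] kdiag_one)
  have "gmult (kgauge s p) (tderiv AP (\<lambda>q. ginv (kgauge s q)) p w) = gmult ?b (ginv b') + Ad ?b (Ad ?k Y)"
    unfolding td bounded_bilinear.add_right[OF bounded_bilinear_gmult]
    by (simp add: kgauge_def gmult_assoc gmult_ginv_assoc[OF G] kk bY Ad_def ginv_kdiag)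
  then have "gauge_conn AP (kgauge s) A p [w] = Ad ?b (Ad ?k (Ad (ginv ?b) (A p [w]))) - Ad ?b Y + Ad ?b (Ad ?k Y)"
    by (simp add: gauge_conn_def inv' kgauge_def Ad_gmult)
  moreover have add: "Ad g (X + X') = Ad g X + Ad g X'" for g X X'
    using Ad_diff[of g "X + X'" X'] by simp
  ultimately show ?thesis
    by (simp add: Z Ad_diff add Ad_ginv[OF G])
qed

lemma gauge_conn_kgauge_iff:
  assumes A: "connection_form AP act A" and s: "cmod s = 1" and w: "w \<in> tangent_space AP p"
  shows "gauge_conn AP (kgauge s) A p [w] = A p [w] \<longleftrightarrow>
    Ad (kdiag s) (A (retr p) [pushforward AP AP retr p w]) = A (retr p) [pushforward AP AP retr p w]"
proof -
  let ?Z = "A (retr p) [pushforward AP AP retr p w]" and ?b = "gauge_frame p"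
  have inj: "Ad ?b X = 0 \<longleftrightarrow> X = 0" for X
  proof
    assume "Ad ?b X = 0"
    then have "Ad (ginv ?b) (Ad ?b X) = Ad (ginv ?b) 0" by simp
    then show "X = 0" using Ad_ginv(2)[OF gauge_frame_Ggrp] Ad_diff[of "ginv ?b" 0 0] by simp
  qed (use Ad_diff[of ?b 0 0] in simp)
  have "gauge_conn AP (kgauge s) A p [w] = A p [w] \<longleftrightarrow> Ad ?b (Ad (kdiag s) ?Z - ?Z) = 0"
    unfolding gauge_conn_kgauge[OF assms, symmetric] by simp
  also have "\<dots> \<longleftrightarrow> Ad (kdiag s) ?Z = ?Z" by (simp add: inj)
  finally show ?thesis .
qed

lemma connection_lie: "connection_form AP act A \<Longrightarrow> w \<in> tangent_space AP p \<Longrightarrow> A p [w] \<in> lie"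
  by (auto simp: connection_form_def)

text \<open>For \<open>s\<^sup>2 \<noteq> 1\<close>, conjugation by \<open>kdiag s\<close> fixes the value of the connection on a tangent vector of the reduced
  bundle if and only if this value has no component along \<open>t1\<close> and \<open>t2\<close>.\<close>

lemma prop_tminus_1_iff:
  assumes A: "connection_form AP act A" and s: "cmod s = 1" "s^2 \<noteq> 1"
  shows "(\<forall>p. \<forall>w\<in>tangent_space AP p. gauge_conn AP (kgauge s) A p [w] = A p [w]) \<longleftrightarrow>
    prop_tminus_on AP (reduced_bundle \<phi>') 1 (tau A)"
proof -
  have iff: "Ad (kdiag s) X = X \<longleftrightarrow> (\<exists>r. proj_p X = r *\<^sub>R tminus)" if X: "X \<in> lie" for X
  proof -
    obtain a b c d where "X = lie_vec a b c d" using X lie_iff by blast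
    then show ?thesis by (simp only: Ad_kdiag_fixed[OF s(1)] proj_p_tminus s(2) simp_thms)
  qed
  show ?thesis
  proof
    assume inv: "\<forall>p. \<forall>w\<in>tangent_space AP p. gauge_conn AP (kgauge s) A p [w] = A p [w]"
    show "prop_tminus_on AP (reduced_bundle \<phi>') 1 (tau A)"
      unfolding prop_tminus_on_def
    proof (intro ballI allI impI)
      fix p vs assume p: "p \<in> reduced_bundle \<phi>'"
        and "length vs = 1 \<and> set vs \<subseteq> sub_tangent_space AP (reduced_bundle \<phi>') p"
      then obtain w where vs: "vs = [w]" and w: "w \<in> sub_tangent_space AP (reduced_bundle \<phi>') p"
        by (auto simp: length_Suc_conv)
      then have wt: "w \<in> tangent_space AP p" using sub_tangent_space_subset[OF AP] by blast
      have "Ad (kdiag s) (A p [w]) = A p [w]"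
        using inv wt gauge_conn_kgauge_iff[OF A s(1) wt] pushforward_retr_reduced[OF p w] retr_fixed[OF p]
        by simp
      then show "\<exists>r. tau A p vs = r *\<^sub>R tminus"
        using iff[OF connection_lie[OF A wt]] by (simp add: tau_def vs)
    qed
  next
    assume pt: "prop_tminus_on AP (reduced_bundle \<phi>') 1 (tau A)"
    show "\<forall>p. \<forall>w\<in>tangent_space AP p. gauge_conn AP (kgauge s) A p [w] = A p [w]"
    proof (intro allI ballI)
      fix p w assume w: "w \<in> tangent_space AP p"
      let ?w = "pushforward AP AP retr p w"
      have "?w \<in> tangent_space AP (retr p)" by (rule pushforward_tangent[OF AP AP mdiff_retr w])
      moreover have "\<exists>r. tau A (retr p) [?w] = r *\<^sub>R tminus"
        using pt retr_reduced pushforward_retr_sub_tangent[OF w] by (simp add: prop_tminus_on_def)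
      ultimately show "gauge_conn AP (kgauge s) A p [w] = A p [w]"
        using iff[OF connection_lie[OF A]] gauge_conn_kgauge_iff[OF A s(1) w] by (simp add: tau_def)
    qed
  qed
qed

lemma gauge_conn_kgauge_central:
  assumes A: "connection_form AP act A" and s: "cmod s = 1" "s^2 = 1" and w: "w \<in> tangent_space AP p"
  shows "gauge_conn AP (kgauge s) A p [w] = A p [w]"
  using gauge_conn_kgauge_iff[OF A s(1) w] Ad_kdiag_fixed[OF s(1)] s(2)
    connection_lie[OF A pushforward_tangent[OF AP AP mdiff_retr w]] by (auto simp: lie_iff)

lemma retr_tuples:
  assumes "vs \<in> tangent_tuples AP k p"
  shows "map (pushforward AP AP retr p) vs \<in> tangent_tuples AP k (retr p)"
    "set (map (pushforward AP AP retr p) vs) \<subseteq> sub_tangent_space AP (reduced_bundle \<phi>') (retr p)"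
proof -
  have "w \<in> tangent_space AP p" if "w \<in> set vs" for w
    using assms that by (auto simp: tangent_tuples_def)
  then show "map (pushforward AP AP retr p) vs \<in> tangent_tuples AP k (retr p)"
    "set (map (pushforward AP AP retr p) vs) \<subseteq> sub_tangent_space AP (reduced_bundle \<phi>') (retr p)"
    using assms pushforward_tangent[OF AP AP mdiff_retr] pushforward_retr_sub_tangent
    unfolding tangent_tuples_def by auto
qed

lemma retr_tuples_reduced:
  assumes "p \<in> reduced_bundle \<phi>'" "set vs \<subseteq> sub_tangent_space AP (reduced_bundle \<phi>') p"
  shows "map (pushforward AP AP retr p) vs = vs"
  using assms pushforward_retr_reduced by (intro map_idI) blast

lemma D_retr:
  assumes D: "coad_2form AM AP \<pi> act D" and vs: "vs \<in> tangent_tuples AP 2 p" and X: "X \<in> lie"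
  shows "D (retr p) (map (pushforward AP AP retr p) vs) X = D p vs (Ad (gauge_frame p) X)"
proof -
  have "D (retr p) (map (pushforward AP AP retr p) vs) X =
      D (retr p) (map (pushforward AP AP (\<lambda>q. act q (gauge_frame p)) p) vs) X"
    using D X vs by (intro horizontal_form_retr[where \<alpha>="\<lambda>p vs. D p vs X"]) (auto simp: coad_2form_def)
  also have "\<dots> = D p vs (Ad (gauge_frame p) X)"
    using D X vs gauge_frame_Ggrp unfolding coad_2form_def retr_def by blast
  finally show ?thesis .
qed

lemma D_linear:
  assumes D: "coad_2form AM AP \<pi> act D" and vs: "vs \<in> tangent_tuples AP 2 p"
  shows "X \<in> lie \<Longrightarrow> Y \<in> lie \<Longrightarrow> D p vs (X + Y) = D p vs X + D p vs Y"
    "X \<in> lie \<Longrightarrow> D p vs (r *\<^sub>R X) = r * D p vs X"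
  using D vs unfolding coad_2form_def by blast+

text \<open>In the gauge given by the frame, invariance of \<open>D\<close> under \<open>kgauge s\<close> is invariance under the
  constant \<open>kdiag s\<close>. The same argument is used below for the momentum of the Higgs field.\<close>

lemma gauge_D_kgauge_iff:
  assumes D: "coad_2form AM AP \<pi> act D" and s: "cmod s = 1" and vs: "vs \<in> tangent_tuples AP 2 p"
  shows "(\<forall>X\<in>lie. gauge_D (kgauge s) D p vs X = D p vs X) \<longleftrightarrow>
    (\<forall>X\<in>lie. D (retr p) (map (pushforward AP AP retr p) vs) (Ad (ginv (kdiag s)) X) =
      D (retr p) (map (pushforward AP AP retr p) vs) X)"
proof -
  let ?b = "gauge_frame p"
  have k: "kdiag (cnj s) \<in> Ggrp" using s by (intro kdiag_Ggrp) simp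
  note G = gauge_frame_Ggrp[of p]
  have "gauge_D (kgauge s) D p vs X = D p vs (Ad ?b (Ad (kdiag (cnj s)) (Ad (ginv ?b) X)))" for X
    by (simp add: gauge_D_def ginv_kgauge) (simp add: kgauge_def Ad_gmult)
  then have "gauge_D (kgauge s) D p vs (Ad ?b X) = D p vs (Ad ?b (Ad (ginv (kdiag s)) X))" for X
    by (simp add: Ad_ginv[OF G] ginv_kdiag)
  moreover have "(\<forall>X\<in>lie. P X) \<longleftrightarrow> (\<forall>X\<in>lie. P (Ad ?b X))" for P
    using lie_Ad[OF G] lie_Ad[OF Ggrp_ginv[OF G]] Ad_ginv(1)[OF G] by metis
  note this[of "\<lambda>X. gauge_D (kgauge s) D p vs X = D p vs X"]
  ultimately show ?thesis
    using D_retr[OF D vs] lie_Ad[OF k] by (simp add: ginv_kdiag)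
qed

lemma prop_tminus_2_iff:
  assumes D: "coad_2form AM AP \<pi> act D" and s: "cmod s = 1" "s^2 \<noteq> 1"
  shows "(\<forall>p. \<forall>vs\<in>tangent_tuples AP 2 p. \<forall>X\<in>lie. gauge_D (kgauge s) D p vs X = D p vs X) \<longleftrightarrow>
    prop_tminus_on AP (reduced_bundle \<phi>') 2 (D_p D)"
proof -
  have iff: "(\<forall>X\<in>lie. D q us (Ad (ginv (kdiag s)) X) = D q us X) \<longleftrightarrow> (\<exists>r. D_p D q us = r *\<^sub>R tminus)"
    if "us \<in> tangent_tuples AP 2 q" for q us
    unfolding D_p_def by (rule Ad_kdiag_invariant_functional[OF s D_linear[OF D that]])
  show ?thesis
  proof
    assume inv: "\<forall>p. \<forall>vs\<in>tangent_tuples AP 2 p. \<forall>X\<in>lie. gauge_D (kgauge s) D p vs X = D p vs X"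
    show "prop_tminus_on AP (reduced_bundle \<phi>') 2 (D_p D)"
      unfolding prop_tminus_on_def
    proof (intro ballI allI impI)
      fix p vs assume p: "p \<in> reduced_bundle \<phi>'"
        and vs: "length vs = 2 \<and> set vs \<subseteq> sub_tangent_space AP (reduced_bundle \<phi>') p"
      then have vt: "vs \<in> tangent_tuples AP 2 p"
        using sub_tangent_space_subset[OF AP] by (fastforce simp: tangent_tuples_def)
      show "\<exists>r. D_p D p vs = r *\<^sub>R tminus"
        using inv vt gauge_D_kgauge_iff[OF D s(1) vt] iff[OF vt] retr_fixed[OF p]
          retr_tuples_reduced[OF p] vs by simp
    qed
  next
    assume pt: "prop_tminus_on AP (reduced_bundle \<phi>') 2 (D_p D)"
    show "\<forall>p. \<forall>vs\<in>tangent_tuples AP 2 p. \<forall>X\<in>lie. gauge_D (kgauge s) D p vs X = D p vs X"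
    proof (intro allI ballI[of "tangent_tuples _ _ _"])
      fix p vs assume vs: "vs \<in> tangent_tuples AP 2 p"
      let ?us = "map (pushforward AP AP retr p) vs"
      have "length ?us = 2" using vs by (simp add: tangent_tuples_def)
      then have "\<exists>r. D_p D (retr p) ?us = r *\<^sub>R tminus"
        using pt retr_reduced retr_tuples(2)[OF vs] unfolding prop_tminus_on_def by blast
      then show "\<forall>X\<in>lie. gauge_D (kgauge s) D p vs X = D p vs X"
        using iff[OF retr_tuples(1)[OF vs]] gauge_D_kgauge_iff[OF D s(1) vs] by blast
    qed
  qed
qed

lemma gauge_D_kgauge_central:
  assumes D: "coad_2form AM AP \<pi> act D" and s: "cmod s = 1" "s^2 = 1"
    and vs: "vs \<in> tangent_tuples AP 2 p" and X: "X \<in> lie"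
  shows "gauge_D (kgauge s) D p vs X = D p vs X"
proof -
  have "cmod (cnj s) = 1" "(cnj s)^2 = 1" using s by (simp, metis complex_cnj_one complex_cnj_power)
  then have "Ad (ginv (kdiag s)) Y = Y" if "Y \<in> lie" for Y
    using that Ad_kdiag_fixed[of "cnj s"] by (auto simp: lie_iff ginv_kdiag)
  then show ?thesis using gauge_D_kgauge_iff[OF D s(1) vs] X by simp
qed

lemma \<Omega>_retr:
  assumes \<Omega>: "dual_3form AM AP \<pi> act \<Omega>" and vs: "vs \<in> tangent_tuples AP 3 p"
  shows "\<Omega> (retr p) (map (pushforward AP AP retr p) vs) u = \<Omega> p vs (rho (gauge_frame p) u)"
proof -
  have "\<Omega> (retr p) (map (pushforward AP AP retr p) vs) u =
      \<Omega> (retr p) (map (pushforward AP AP (\<lambda>q. act q (gauge_frame p)) p) vs) u"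
    using \<Omega> vs by (intro horizontal_form_retr[where \<alpha>="\<lambda>p vs. \<Omega> p vs u"]) (auto simp: dual_3form_def)
  also have "\<dots> = \<Omega> p vs (rho (gauge_frame p) u)"
    using \<Omega> vs gauge_frame_Ggrp unfolding dual_3form_def retr_def by blast
  finally show ?thesis .
qed

lemma gauge_Pi_kgauge_iff:
  assumes \<Omega>: "dual_3form AM AP \<pi> act \<Omega>" and vs: "vs \<in> tangent_tuples AP 3 p"
  shows "(\<forall>u. gauge_Pi (kgauge s) \<Omega> p vs u = \<Omega> p vs u) \<longleftrightarrow>
    (\<forall>u. \<Omega> (retr p) (map (pushforward AP AP retr p) vs) (rho (ginv (kdiag s)) u) =
      \<Omega> (retr p) (map (pushforward AP AP retr p) vs) u)"
proof -
  let ?b = "gauge_frame p"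
  note G = gauge_frame_Ggrp[of p]
  have "gauge_Pi (kgauge s) \<Omega> p vs u = \<Omega> p vs (rho ?b (rho (kdiag (cnj s)) (rho (ginv ?b) u)))" for u
    by (simp add: gauge_Pi_def ginv_kgauge) (simp add: kgauge_def rho_gmult)
  then have "gauge_Pi (kgauge s) \<Omega> p vs (rho ?b u) = \<Omega> p vs (rho ?b (rho (ginv (kdiag s)) u))" for u
    by (simp add: rho_ginv[OF G] ginv_kdiag)
  moreover have "(\<forall>u. P u) \<longleftrightarrow> (\<forall>u. P (rho ?b u))" for P
    using rho_ginv(1)[OF G] by metis
  note this[of "\<lambda>u. gauge_Pi (kgauge s) \<Omega> p vs u = \<Omega> p vs u"]
  ultimately show ?thesis
    using \<Omega>_retr[OF \<Omega> vs] by simp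
qed

end

section \<open>The momentum as a section\<close>

lemma alternating_trilinear_eq_det:
  fixes f :: "real^3 \<Rightarrow> real^3 \<Rightarrow> real^3 \<Rightarrow> 'b::real_vector"
  assumes add: "\<And>x x' y z. f (x + x') y z = f x y z + f x' y z"
      "\<And>x y y' z. f x (y + y') z = f x y z + f x y' z"
      "\<And>x y z z'. f x y (z + z') = f x y z + f x y z'"
    and scale: "\<And>r x y z. f (r *\<^sub>R x) y z = r *\<^sub>R f x y z"
      "\<And>r x y z. f x (r *\<^sub>R y) z = r *\<^sub>R f x y z"
      "\<And>r x y z. f x y (r *\<^sub>R z) = r *\<^sub>R f x y z"
    and alt: "\<And>x z. f x x z = 0" "\<And>x y. f x y x = 0" "\<And>x y. f x y y = 0"
  shows "f x y z = det (vector [x, y, z] :: real^3^3) *\<^sub>R f (axis 1 1) (axis 2 1) (axis 3 1)"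
proof -
  let ?e1 = "axis 1 1 :: real^3" and ?e2 = "axis 2 1 :: real^3" and ?e3 = "axis 3 1 :: real^3"
  have s12: "f y x z = - f x y z" for x y z
  proof -
    have "f y x z + f x y z = 0" using alt(1)[of "x + y" z] unfolding add by (simp add: alt add.commute)
    then show ?thesis by (simp add: eq_neg_iff_add_eq_0)
  qed
  have s23: "f x z y = - f x y z" for x y z
  proof -
    have "f x z y + f x y z = 0" using alt(3)[of x "y + z"] unfolding add by (simp add: alt add.commute)
    then show ?thesis by (simp add: eq_neg_iff_add_eq_0)
  qed
  have p1: "f ?e1 ?e3 ?e2 = - f ?e1 ?e2 ?e3" by (rule s23)
  have p2: "f ?e2 ?e1 ?e3 = - f ?e1 ?e2 ?e3" by (rule s12)
  have p3: "f ?e2 ?e3 ?e1 = f ?e1 ?e2 ?e3" using s23[of ?e2 ?e1 ?e3] p2 by simp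
  have p4: "f ?e3 ?e1 ?e2 = f ?e1 ?e2 ?e3" using s12[of ?e1 ?e3 ?e2] p1 by simp
  have p5: "f ?e3 ?e2 ?e1 = - f ?e1 ?e2 ?e3" using s23[of ?e3 ?e1 ?e2] p4 by simp
  have rep: "w = w$1 *\<^sub>R ?e1 + w$2 *\<^sub>R ?e2 + w$3 *\<^sub>R ?e3" for w
    by (simp add: vec_eq_iff forall_3 axis_def)
  have "f x y z = f (x$1 *\<^sub>R ?e1 + x$2 *\<^sub>R ?e2 + x$3 *\<^sub>R ?e3) (y$1 *\<^sub>R ?e1 + y$2 *\<^sub>R ?e2 + y$3 *\<^sub>R ?e3)
      (z$1 *\<^sub>R ?e1 + z$2 *\<^sub>R ?e2 + z$3 *\<^sub>R ?e3)"
    by (simp only: rep[symmetric])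
  also have "\<dots> = det (vector [x, y, z] :: real^3^3) *\<^sub>R f ?e1 ?e2 ?e3"
    unfolding add scale alt p1 p2 p3 p4 p5 det_3
    by (simp add: vector_3 scaleR_add_left scaleR_diff_left algebra_simps)
  finally show ?thesis .
qed

definition lincomb3 :: "(3 \<Rightarrow> ('m, 'e::real_vector) tvec) \<Rightarrow> real^3 \<Rightarrow> ('m, 'e) tvec" where
  "lincomb3 E a = (\<lambda>c. a$1 *\<^sub>R E 1 c + a$2 *\<^sub>R E 2 c + a$3 *\<^sub>R E 3 c)"

lemma lincomb3_tangent:
  assumes "smooth_manifold A" "\<And>i. E i \<in> tangent_space A p"
  shows "lincomb3 E a \<in> tangent_space A p"
  unfolding lincomb3_def by (intro tangent_add tangent_scale assms)

lemma lincomb3_add: "lincomb3 E (a + b) = (\<lambda>c. lincomb3 E a c + lincomb3 E b c)"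
  by (simp add: lincomb3_def fun_eq_iff algebra_simps)

lemma lincomb3_scale: "lincomb3 E (r *\<^sub>R a) = (\<lambda>c. r *\<^sub>R lincomb3 E a c)"
  by (simp add: lincomb3_def fun_eq_iff algebra_simps)

lemma lincomb3_axis: "lincomb3 E (axis i 1) = E i"
  using exhaust_3[of i] by (auto simp: lincomb3_def fun_eq_iff axis_def)

lemma pushforward_lincomb3:
  assumes "smooth_manifold A" "smooth_manifold B" "mdiff A B f p"
  shows "pushforward A B f p (lincomb3 E a) = lincomb3 (\<lambda>i. pushforward A B f p (E i)) a"
  unfolding lincomb3_def by (simp add: pushforward_linear[OF assms])

lemma smooth_3form_lincomb3:
  assumes A: "smooth_manifold A" and \<alpha>: "smooth_form A 3 \<alpha>" and E: "\<And>i. E i \<in> tangent_space A p"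
  shows "\<alpha> p [lincomb3 E x, lincomb3 E y, lincomb3 E z] =
    det (vector [x, y, z] :: real^3^3) *\<^sub>R \<alpha> p [E 1, E 2, E 3]"
proof -
  let ?f = "\<lambda>x y z. \<alpha> p [lincomb3 E x, lincomb3 E y, lincomb3 E z]"
  note T = lincomb3_tangent[of A E p, OF A E]
  have t: "[lincomb3 E x, lincomb3 E y, lincomb3 E z] \<in> tangent_tuples A 3 p" for x y z
    using T by (simp add: tangent_tuples_def)
  have i: "(0::nat) < 3" "(1::nat) < 3" "(2::nat) < 3" by simp_all
  have "?f x y z = det (vector [x, y, z] :: real^3^3) *\<^sub>R ?f (axis 1 1) (axis 2 1) (axis 3 1)"
  proof (rule alternating_trilinear_eq_det[of ?f])
    fix x y z w :: "real^3" and r :: real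
    show "?f (x + w) y z = ?f x y z + ?f w y z" "?f (r *\<^sub>R x) y z = r *\<^sub>R ?f x y z"
      using smooth_formD(1)[OF \<alpha> t[of x y z] i(1) T[of x] T[of w]]
        smooth_formD(2)[OF \<alpha> t[of x y z] i(1) T[of x], of r]
      by (simp_all add: lincomb3_add lincomb3_scale)
    show "?f x (y + w) z = ?f x y z + ?f x w z" "?f x (r *\<^sub>R y) z = r *\<^sub>R ?f x y z"
      using smooth_formD(1)[OF \<alpha> t[of x y z] i(2) T[of y] T[of w]]
        smooth_formD(2)[OF \<alpha> t[of x y z] i(2) T[of y], of r]
      by (simp_all add: lincomb3_add lincomb3_scale)
    show "?f x y (z + w) = ?f x y z + ?f x y w" "?f x y (r *\<^sub>R z) = r *\<^sub>R ?f x y z"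
      using smooth_formD(1)[OF \<alpha> t[of x y z] i(3) T[of z] T[of w]]
        smooth_formD(2)[OF \<alpha> t[of x y z] i(3) T[of z], of r]
      by (simp_all add: lincomb3_add lincomb3_scale numeral_2_eq_2)
    show "?f x x z = 0" using smooth_formD(3)[OF \<alpha> t[of x x z] i(1) T[of x] i(2)] by simp
    show "?f x y x = 0" using smooth_formD(3)[OF \<alpha> t[of x y x] i(1) T[of x] i(3)] by simp
    show "?f x y y = 0" using smooth_formD(3)[OF \<alpha> t[of x y y] i(2) T[of x] i(3)] by simp
  qed
  then show ?thesis by (simp only: lincomb3_axis)
qed

text \<open>A vector in the kernel of the Gram matrix is the coordinate vector of a tangent vector of length
  zero.\<close>

lemma gram_det_nonzero:
  fixes A :: "('m::{t2_space,second_countable_topology}, real^3) chart set"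
  assumes A: "smooth_manifold A" and h: "riemannian_metric A h" and c: "c \<in> A" "x \<in> fst c"
  shows "det (\<chi> i j. h x (coord_vec A c x (axis i 1)) (coord_vec A c x (axis j 1)) :: real^3^3) \<noteq> 0"
    (is "det ?G \<noteq> 0")
proof -
  let ?E = "\<lambda>i. coord_vec A c x (axis i (1::real) :: real^3)"
  have E: "?E i \<in> tangent_space A x" for i by (rule coord_vec_tangent(1)[OF A c])
  note T = lincomb3_tangent[of A ?E x, OF A E]
  have sym: "h x u w = h x w u" and addh: "u' \<in> tangent_space A x \<Longrightarrow> h x (\<lambda>c. u c + u' c) w = h x u w + h x u' w"
    and sc: "h x (\<lambda>c. r *\<^sub>R u c) w = r * h x u w" and pos: "u \<noteq> (\<lambda>_. 0) \<Longrightarrow> h x u u > 0"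
    if "u \<in> tangent_space A x" "w \<in> tangent_space A x" for u u' w r
    using h that unfolding riemannian_metric_def by blast+
  have lin: "h x (lincomb3 ?E a) w = a$1 * h x (?E 1) w + a$2 * h x (?E 2) w + a$3 * h x (?E 3) w"
    if "w \<in> tangent_space A x" for a w
    unfolding lincomb3_def using that E
    by (simp add: addh sc tangent_add[OF A] tangent_scale[OF A])
  have "a = 0" if a: "?G *v a = 0" for a
  proof -
    have "h x (lincomb3 ?E a) (?E i) = 0" for i
    proof -
      have "(?G *v a) $ i = 0" using a by simp
      then show ?thesis
        by (simp add: lin[OF E] matrix_vector_mult_def sum_3 sym[OF E E] mult.commute)
    qed
    then have "h x (lincomb3 ?E a) (lincomb3 ?E a) = 0"
      by (simp add: lin[OF T] sym[OF E T])
    then have "lincomb3 ?E a = (\<lambda>_. 0)" using pos[OF T T] by force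
    then have "lincomb3 ?E a c = 0" by simp
    then show ?thesis
      by (simp add: lincomb3_def coord_vec_tangent(2)[OF A c] vec_eq_iff forall_3 axis_def)
  qed
  then have "invertible ?G"
    unfolding invertible_left_inverse matrix_left_invertible_ker by blast
  then show ?thesis by (simp add: invertible_det_nz)
qed

context principal
begin

text \<open>Horizontal 3-forms at a point are multiples of the pulled back volume form, because the tangent
  space of the base is 3-dimensional and every base vector has a lift. Hence the defining equation
  of the momentum section has a unique solution.\<close>

lemma momentum_section:
  assumes h: "riemannian_metric AM h" and \<Omega>: "dual_3form AM AP \<pi> act \<Omega>"
  defines "vol \<equiv> \<lambda>p vs. volume_form AM h (\<pi> p) (map (pushforward AP AM \<pi> p) vs)"
  shows "\<And>vs u. vs \<in> tangent_tuples AP 3 p \<Longrightarrow> \<Omega> p vs u = of_real (vol p vs) *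
      (\<Sum>i\<in>UNIV. cnj (momentum_section AM h AP \<pi> \<Omega> p $ i) * u $ i)"
    "\<exists>vs\<in>tangent_tuples AP 3 p. vol p vs \<noteq> 0"
proof -
  define x where "x = \<pi> p"
  define c where "c = chart_at AM x"
  have c: "c \<in> AM" "x \<in> fst c" unfolding c_def by (rule chart_at[OF AM])+
  let ?E = "\<lambda>i. coord_vec AM c x (axis i (1::real) :: real^3)"
  let ?\<pi> = "pushforward AP AM \<pi> p"
  have "\<exists>w. w \<in> tangent_space AP p \<and> ?\<pi> w = ?E i" for i
    using pushforward_proj_surj[OF coord_vec_tangent(1)[OF AM c, of "axis i 1", unfolded x_def], of thesis]
    by (metis coord_vec_tangent(1)[OF AM c, of "axis i 1", unfolded x_def] pushforward_proj_surj x_def)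
  then obtain e where e: "\<And>i. e i \<in> tangent_space AP p" "\<And>i. ?\<pi> (e i) = ?E i" by metis
  define a where "a w = ?\<pi> w c" for w
  define S where "S = sqrt (det (\<chi> i j. h x (?E i) (?E j) :: real^3^3))"
  have S: "S \<noteq> 0" unfolding S_def using gram_det_nonzero[OF AM h c] by simp
  have \<pi>T: "?\<pi> w \<in> tangent_space AM x" if "w \<in> tangent_space AP p" for w
    unfolding x_def by (rule pushforward_tangent[OF AP AM mdiff_proj that])
  note eT = lincomb3_tangent[of AP e p, OF AP e(1)]
  have ae: "?\<pi> (lincomb3 e b) c = b" for b
    unfolding pushforward_lincomb3[OF AP AM mdiff_proj] e(2)
    by (simp add: lincomb3_def coord_vec_tangent(2)[OF AM c] vec_eq_iff forall_3 axis_def)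
  have vol: "vol p [u, v, w] = S * det (vector [a u, a v, a w] :: real^3^3)" for u v w
    by (simp add: vol_def volume_form_def Let_def x_def[symmetric] c_def[symmetric] S_def a_def)
  define W where "W u = \<Omega> p [e 1, e 2, e 3] u" for u
  have val: "\<Omega> p [v1, v2, v3] u = det (vector [a v1, a v2, a v3] :: real^3^3) *\<^sub>R W u"
    if vs: "[v1, v2, v3] \<in> tangent_tuples AP 3 p" for v1 v2 v3 u
  proof -
    have form: "smooth_form AP 3 (\<lambda>p vs. \<Omega> p vs u)" "horizontal_form AM AP \<pi> 3 (\<lambda>p vs. \<Omega> p vs u)"
      using \<Omega> by (auto simp: dual_3form_def)
    define n where "n w = (\<lambda>d. w d + (-1) *\<^sub>R lincomb3 e (a w) d)" for w
    have nT: "n w \<in> tangent_space AP p" if "w \<in> tangent_space AP p" for w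
      unfolding n_def by (intro tangent_add[OF AP] tangent_scale[OF AP] that eT)
    have nv: "?\<pi> (n w) = (\<lambda>_. 0)" if w: "w \<in> tangent_space AP p" for w
    proof (rule tangent_eqI[OF AM c \<pi>T[OF nT[OF w]] tangent_zero[OF AM]])
      have "?\<pi> (n w) c = ?\<pi> w c + (-1) *\<^sub>R ?\<pi> (lincomb3 e (a w)) c"
        unfolding n_def pushforward_linear[OF AP AM mdiff_proj] ..
      then show "?\<pi> (n w) c = 0" by (simp add: ae a_def)
    qed
    have v: "v1 \<in> tangent_space AP p" "v2 \<in> tangent_space AP p" "v3 \<in> tangent_space AP p"
      using vs by (auto simp: tangent_tuples_def)
    have "\<Omega> p [v1, v2, v3] u = \<Omega> p [lincomb3 e (a v1), lincomb3 e (a v2), lincomb3 e (a v3)] u"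
    proof (rule horizontal_form_cong[OF form _ _ _ vs])
      show "[lincomb3 e (a v1), lincomb3 e (a v2), lincomb3 e (a v3)] \<in> tangent_tuples AP 3 p"
        using eT by (simp add: tangent_tuples_def)
      show "[n v1, n v2, n v3] \<in> tangent_tuples AP 3 p"
        using nT v by (simp add: tangent_tuples_def)
      show "?\<pi> m = (\<lambda>_. 0)" if "m \<in> set [n v1, n v2, n v3]" for m
        using that nv v by auto
      show "[v1, v2, v3] ! i = (\<lambda>c. ([lincomb3 e (a v1), lincomb3 e (a v2), lincomb3 e (a v3)] ! i) c +
          ([n v1, n v2, n v3] ! i) c)" if "i < 3" for i
        using that by (auto simp: less_Suc_eq numeral_3_eq_3 n_def)
    qed
    also have "\<dots> = det (vector [a v1, a v2, a v3] :: real^3^3) *\<^sub>R W u"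
      unfolding W_def by (rule smooth_3form_lincomb3[OF AP form(1) e(1)])
    finally show ?thesis .
  qed
  have e3: "[e 1, e 2, e 3] \<in> tangent_tuples AP 3 p" using e(1) by (simp add: tangent_tuples_def)
  have Wadd: "W (u + u') = W u + W u'" and Wsc: "W (s *s u) = s * W u" for u u' s
    using \<Omega> e3 unfolding dual_3form_def W_def by blast+
  have Wu: "W u = (\<Sum>i\<in>UNIV. W (axis i 1) * u $ i)" for u
  proof -
    have "u = u$1 *s axis 1 1 + u$2 *s axis 2 1" by (simp add: vec_eq_iff forall_2 axis_def)
    then have "W u = W (u$1 *s axis 1 1 + u$2 *s axis 2 1)" by simp
    then show ?thesis by (simp add: Wadd Wsc sum_2 mult.commute)
  qed
  have ve: "vol p [e 1, e 2, e 3] \<noteq> 0"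
  proof -
    have "a (e i) = axis i 1" for i
      using ae[of "axis i 1"] by (simp add: a_def lincomb3_axis)
    then have "det (vector [a (e 1), a (e 2), a (e 3)] :: real^3^3) = 1"
      by (simp add: det_3 vector_3 axis_def)
    then show ?thesis using S by (simp add: vol)
  qed
  then show "\<exists>vs\<in>tangent_tuples AP 3 p. vol p vs \<noteq> 0" using e3 by blast
  define Q where "Q z \<longleftrightarrow> (\<forall>vs\<in>tangent_tuples AP 3 p. \<forall>u.
     \<Omega> p vs u = of_real (vol p vs) * (\<Sum>i\<in>UNIV. cnj (z $ i) * u $ i))" for z :: "complex^2"
  have ms: "momentum_section AM h AP \<pi> \<Omega> p = (THE z. Q z)"
    by (simp add: momentum_section_def Q_def vol_def)
  \<comment> \<open>the volume form is divided out; the Hermitian product is conjugate linear in its first slot\<close>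
  define z0 :: "complex^2" where "z0 = (\<chi> i. cnj (W (axis i 1) / of_real S))"
  have Q0: "Q z0"
    unfolding Q_def
  proof (intro ballI allI)
    fix vs u assume vs: "vs \<in> tangent_tuples AP 3 p"
    then obtain v1 v2 v3 where v: "vs = [v1, v2, v3]"
      by (auto simp: tangent_tuples_def length_Suc_conv numeral_3_eq_3)
    have "of_real S * (\<Sum>i\<in>UNIV. cnj (z0 $ i) * u $ i) = W u"
      using S unfolding Wu[of u] by (simp add: z0_def sum_2 field_simps)
    then show "\<Omega> p vs u = of_real (vol p vs) * (\<Sum>i\<in>UNIV. cnj (z0 $ i) * u $ i)"
      unfolding v vol val[OF vs[unfolded v]]
      by (simp add: scaleR_conv_of_real mult.commute mult.left_commute)
  qed
  have "z = z0" if "Q z" for z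
  proof -
    have "(\<Sum>i\<in>UNIV. cnj (z $ i) * u $ i) = (\<Sum>i\<in>UNIV. cnj (z0 $ i) * u $ i)" for u
    proof -
      have "of_real (vol p [e 1, e 2, e 3]) * (\<Sum>i\<in>UNIV. cnj (z $ i) * u $ i) =
          of_real (vol p [e 1, e 2, e 3]) * (\<Sum>i\<in>UNIV. cnj (z0 $ i) * u $ i)"
        by (rule trans[OF that[unfolded Q_def, rule_format, OF e3, symmetric]
              Q0[unfolded Q_def, rule_format, OF e3]])
      moreover have "complex_of_real (vol p [e 1, e 2, e 3]) \<noteq> 0" using ve by simp
      ultimately show ?thesis using mult_left_cancel by blast
    qed
    from this[of "axis 1 1"] this[of "axis 2 1"] show ?thesis
      by (simp add: sum_2 axis_def vec_eq_iff forall_2)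
  qed
  then have "Q (momentum_section AM h AP \<pi> \<Omega> p)" unfolding ms by (rule theI[of Q, OF Q0])
  then show "\<Omega> p vs u = of_real (vol p vs) *
      (\<Sum>i\<in>UNIV. cnj (momentum_section AM h AP \<pi> \<Omega> p $ i) * u $ i)"
    if "vs \<in> tangent_tuples AP 3 p" for vs u
    using that unfolding Q_def by blast
qed

end

context higgs
begin

text \<open>In the representation on pairs of complex numbers \<open>kdiag s\<close> is \<open>diag (s\<^sup>2, 1)\<close>, so that it fixes a
  functional \<open>\<langle>z, -\<rangle>\<close> exactly if \<open>z\<close> has no first component, unless \<open>s\<^sup>2 = 1\<close>.\<close>

lemma momentum_component_iff:
  assumes h: "riemannian_metric AM h" and \<Omega>: "dual_3form AM AP \<pi> act \<Omega>" and s: "cmod s = 1" "s^2 \<noteq> 1"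
  shows "(\<forall>p. \<forall>vs\<in>tangent_tuples AP 3 p. \<forall>u. gauge_Pi (kgauge s) \<Omega> p vs u = \<Omega> p vs u) \<longleftrightarrow>
    (\<forall>p\<in>reduced_bundle \<phi>'. momentum_section AM h AP \<pi> \<Omega> p $ 1 = 0)"
proof
  have s': "cmod (cnj s) = 1" "(cnj s)^2 \<noteq> 1"
    using s by (simp, metis complex_cnj_cnj complex_cnj_one complex_cnj_power)
  assume inv: "\<forall>p. \<forall>vs\<in>tangent_tuples AP 3 p. \<forall>u. gauge_Pi (kgauge s) \<Omega> p vs u = \<Omega> p vs u"
  show "\<forall>p\<in>reduced_bundle \<phi>'. momentum_section AM h AP \<pi> \<Omega> p $ 1 = 0"
  proof
    fix p assume p: "p \<in> reduced_bundle \<phi>'"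
    obtain vs where vs: "vs \<in> tangent_tuples AP 3 p"
      and vol: "volume_form AM h (\<pi> p) (map (pushforward AP AM \<pi> p) vs) \<noteq> 0"
      using momentum_section(2)[OF h \<Omega>] by blast
    let ?u = "axis 1 1 :: complex^2"
    have "gauge_Pi (kgauge s) \<Omega> p vs ?u = \<Omega> p vs ?u" using inv vs by blast
    then have "\<Omega> p vs (rho (kdiag (cnj s)) ?u) = \<Omega> p vs ?u"
      by (simp add: gauge_Pi_def kgauge_reduced[OF p] ginv_kdiag)
    then have "cnj (momentum_section AM h AP \<pi> \<Omega> p $ 1) * (cnj s)^2 = cnj (momentum_section AM h AP \<pi> \<Omega> p $ 1)"
      unfolding momentum_section(1)[OF h \<Omega> vs] using vol by (simp add: sum_2 rho_kdiag[OF s'(1)] axis_def del: complex_cnj_power)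
    then show "momentum_section AM h AP \<pi> \<Omega> p $ 1 = 0" using s'(2) by simp
  qed
next
  have s': "cmod (cnj s) = 1" using s by simp
  assume z: "\<forall>p\<in>reduced_bundle \<phi>'. momentum_section AM h AP \<pi> \<Omega> p $ 1 = 0"
  have "\<Omega> (retr p) (map (pushforward AP AP retr p) vs) (rho (ginv (kdiag s)) u) =
      \<Omega> (retr p) (map (pushforward AP AP retr p) vs) u" if "vs \<in> tangent_tuples AP 3 p" for p vs u
    unfolding momentum_section(1)[OF h \<Omega> retr_tuples(1)[OF that]]
    using z retr_reduced by (simp add: sum_2 ginv_kdiag rho_kdiag[OF s'])
  then show "\<forall>p. \<forall>vs\<in>tangent_tuples AP 3 p. \<forall>u. gauge_Pi (kgauge s) \<Omega> p vs u = \<Omega> p vs u"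
    using gauge_Pi_kgauge_iff[OF \<Omega>] by blast
qed

lemma gauge_Pi_kgauge_central:
  assumes \<Omega>: "dual_3form AM AP \<pi> act \<Omega>" and s: "cmod s = 1" "s^2 = 1"
    and vs: "vs \<in> tangent_tuples AP 3 p"
  shows "gauge_Pi (kgauge s) \<Omega> p vs u = \<Omega> p vs u"
proof -
  have s': "cmod (cnj s) = 1" "(cnj s)^2 = 1" using s by (simp, metis complex_cnj_one complex_cnj_power)
  have "rho (ginv (kdiag s)) u = u" for u
    using rho_kdiag[OF s'(1)] s'(2) by (simp add: ginv_kdiag vec_eq_iff forall_2)
  then show ?thesis using gauge_Pi_kgauge_iff[OF \<Omega> vs, of s] by simp
qed

section \<open>The stabilizer\<close>

lemma stabilizer_eq_kgauge:
  assumes conn: "connected (UNIV :: 'm set)" and l: "l \<in> stabilizer AP act A \<phi> D \<Omega>"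
  obtains s where "cmod s = 1" "l = kgauge s"
proof -
  have lg: "l \<in> gauge_group AP act" and fix_\<phi>: "\<And>p. gauge_field l \<phi> p = \<phi> p"
    and A: "\<And>p w. w \<in> tangent_space AP p \<Longrightarrow> gauge_conn AP l A p [w] = A p [w]"
  proof -
    show "l \<in> gauge_group AP act" "\<And>p. gauge_field l \<phi> p = \<phi> p" using l by (auto simp: stabilizer_def)
    fix p w assume "w \<in> tangent_space AP p"
    then have "[w] \<in> tangent_tuples AP 1 p" by (simp add: tangent_tuples_def)
    then show "gauge_conn AP l A p [w] = A p [w]" using l by (simp add: stabilizer_def)
  qed
  obtain q :: 'p where True by blast
  have eq: "l p = kgauge (snd (l q)) p" for p
    using gauge_eq_kgauge[OF lg fix_\<phi>, of p] gauge_snd_constant[OF conn lg A, of p q] by simp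
  have "l q \<in> Ggrp" using lg unfolding gauge_group_def by blast
  then have "cmod (snd (l q)) = 1" by (simp add: Ggrp_iff)
  then show ?thesis by (rule that[OF _ ext[OF eq]])
qed

lemma kgauge_stabilizer_iff:
  assumes "cmod s = 1"
  shows "kgauge s \<in> stabilizer AP act A \<phi> D \<Omega> \<longleftrightarrow>
    (\<forall>p. \<forall>w\<in>tangent_space AP p. gauge_conn AP (kgauge s) A p [w] = A p [w]) \<and>
    (\<forall>p. \<forall>vs\<in>tangent_tuples AP 2 p. \<forall>X\<in>lie. gauge_D (kgauge s) D p vs X = D p vs X) \<and>
    (\<forall>p. \<forall>vs\<in>tangent_tuples AP 3 p. \<forall>u. gauge_Pi (kgauge s) \<Omega> p vs u = \<Omega> p vs u)"
proof -
  have "(\<forall>vs\<in>tangent_tuples AP 1 p. P vs) \<longleftrightarrow> (\<forall>w\<in>tangent_space AP p. P [w])" for p P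
    using tangent_tuples_1 by metis
  note this[of _ "\<lambda>vs. gauge_conn AP (kgauge s) A p vs = A p vs" for p]
  then show ?thesis
    using kgauge_gauge_group[OF assms] kgauge_field[OF assms]
    unfolding stabilizer_def by auto
qed

text \<open>At a point of the reduced bundle \<open>kgauge s\<close> has the value \<open>kdiag s\<close>. The elements with
  \<open>s\<^sup>2 = 1\<close> always belong to the stabilizer. Each of the others belongs to it under the
  same three conditions, in which \<open>s\<close> does not occur, so that nothing lies between \<open>Z2grp\<close> and
  \<open>Kgrp\<close>.\<close>

lemma stabilizer_conjugate:
  assumes conn: "connected (UNIV :: 'm set)" and h: "riemannian_metric AM h"
    and pp: "phase_point AM AP \<pi> act A \<phi> D \<Omega>" and p0: "p0 \<in> reduced_bundle \<phi>'"
  shows "conjugate_at p0 (stabilizer AP act A \<phi> D \<Omega>)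
    (if prop_tminus_on AP (reduced_bundle \<phi>') 1 (tau A) \<and>
        prop_tminus_on AP (reduced_bundle \<phi>') 2 (D_p D) \<and>
        (\<forall>p\<in>reduced_bundle \<phi>'. momentum_section AM h AP \<pi> \<Omega> p $ 1 = 0)
     then Kgrp else Z2grp)" (is "conjugate_at p0 ?S (if ?C then _ else _)")
proof -
  have A: "connection_form AP act A" and D: "coad_2form AM AP \<pi> act D" and \<Omega>: "dual_3form AM AP \<pi> act \<Omega>"
    using pp by (auto simp: phase_point_def)
  have mem: "kgauge s \<in> ?S \<longleftrightarrow> s^2 = 1 \<or> ?C" if s: "cmod s = 1" for s
  proof (cases "s^2 = 1")
    case True
    then show ?thesis
      using kgauge_stabilizer_iff[OF s, of A D \<Omega>] gauge_conn_kgauge_central[OF A s True]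
        gauge_D_kgauge_central[OF D s True] gauge_Pi_kgauge_central[OF \<Omega> s True] by blast
  next
    case False
    then show ?thesis
      using kgauge_stabilizer_iff[OF s, of A D \<Omega>] prop_tminus_1_iff[OF A s False]
        prop_tminus_2_iff[OF D s False] momentum_component_iff[OF h \<Omega> s False] by simp
  qed
  have ev: "kgauge s p0 = kdiag s" for s by (rule kgauge_reduced[OF p0])
  have inj: "inj_on (\<lambda>l. l p0) ?S"
  proof (rule inj_onI)
    fix l l' assume "l \<in> ?S" "l' \<in> ?S" and eq: "l p0 = l' p0"
    then obtain s s' where "l = kgauge s" "l' = kgauge s'"
      using stabilizer_eq_kgauge[OF conn] by metis
    with eq ev show "l = l'" by (metis snd_kdiag)
  qed
  have img: "(\<lambda>l. l p0) ` ?S = kdiag ` {s. cmod s = 1 \<and> (s^2 = 1 \<or> ?C)}"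
  proof (intro set_eqI iffI)
    fix g assume "g \<in> (\<lambda>l. l p0) ` ?S"
    then obtain l where l: "l \<in> ?S" "g = l p0" by blast
    obtain s where "cmod s = 1" "l = kgauge s" by (rule stabilizer_eq_kgauge[OF conn l(1)])
    then show "g \<in> kdiag ` {s. cmod s = 1 \<and> (s^2 = 1 \<or> ?C)}" using l mem ev by auto
  next
    fix g assume "g \<in> kdiag ` {s. cmod s = 1 \<and> (s^2 = 1 \<or> ?C)}"
    then obtain s where s: "g = kdiag s" "cmod s = 1" "s^2 = 1 \<or> ?C" by blast
    then show "g \<in> (\<lambda>l. l p0) ` ?S"
      using mem[OF s(2)] ev[of s] by (intro image_eqI[of _ _ "kgauge s"]) auto
  qed
  have grp: "kdiag ` {s. cmod s = 1 \<and> (s^2 = 1 \<or> ?C)} = (if ?C then Kgrp else Z2grp)"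
  proof (cases ?C)
    case True
    then show ?thesis by (simp add: Kgrp_eq)
  next
    case False
    have "{s. cmod s = 1 \<and> (s^2 = 1 \<or> ?C)} = {1, -1}" using False by (auto simp: power2_eq_1_iff)
    then have "kdiag ` {s. cmod s = 1 \<and> (s^2 = 1 \<or> ?C)} = Z2grp" by (simp only: Z2grp_eq image_insert image_empty)
    then show ?thesis unfolding if_not_P[OF False] .
  qed
  have conj: "(\<lambda>k. gmult (gmult gone k) (ginv gone)) ` H = H" for H by simp
  show ?thesis
    unfolding conjugate_at_def
  proof (intro conjI bexI[of _ gone])
    show "(\<lambda>l. l p0) ` ?S = (\<lambda>k. gmult (gmult gone k) (ginv gone)) ` (if ?C then Kgrp else Z2grp)"
      unfolding conj img by (rule grp)
  qed (rule inj, rule Ggrp_gone)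
qed

end

lemma connection_tau_iff_W:
  assumes A: "\<And>p vs. vs \<in> tangent_tuples AP 1 p \<Longrightarrow>
           A p vs = (g * W1 p vs) *\<^sub>R t1 + (g * W2 p vs) *\<^sub>R t2 + (g * W3 p vs) *\<^sub>R t3
                    + (g' * B p vs) *\<^sub>R tU"
    and g: "g \<noteq> 0" and AP: "smooth_manifold AP"
  shows "prop_tminus_on AP S 1 (tau A) \<longleftrightarrow>
    (\<forall>p\<in>S. \<forall>w\<in>sub_tangent_space AP S p. W_plus W1 W2 p [w] = 0 \<and> W_minus W1 W2 p [w] = 0)"
proof -
  have "(\<exists>r. tau A p [w] = r *\<^sub>R tminus) \<longleftrightarrow> W_plus W1 W2 p [w] = 0 \<and> W_minus W1 W2 p [w] = 0"
    if w: "w \<in> sub_tangent_space AP S p" for p w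
  proof -
    have "[w] \<in> tangent_tuples AP 1 p"
      using w sub_tangent_space_subset[OF AP] by (auto simp: tangent_tuples_def)
    from A[OF this] have "A p [w] = lie_vec (g * W1 p [w]) (g * W2 p [w]) (g * W3 p [w]) (g' * B p [w])"
      by (simp add: lie_vec_def)
    then have "(\<exists>r. tau A p [w] = r *\<^sub>R tminus) \<longleftrightarrow> W1 p [w] = 0 \<and> W2 p [w] = 0"
      using g by (simp add: tau_def proj_p_tminus)
    also have "\<dots> \<longleftrightarrow> W_plus W1 W2 p [w] = 0 \<and> W_minus W1 W2 p [w] = 0"
      by (auto simp: W_plus_def W_minus_def complex_eq_iff)
    finally show ?thesis .
  qed
  moreover have "prop_tminus_on AP S 1 (tau A) \<longleftrightarrow>
      (\<forall>p\<in>S. \<forall>w\<in>sub_tangent_space AP S p. \<exists>r. tau A p [w] = r *\<^sub>R tminus)"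
    unfolding prop_tminus_on_def by (auto simp: length_Suc_conv)
  ultimately show ?thesis by simp
qed

theorem proposition5p6p13:
  fixes AM :: "('m::{t2_space,second_countable_topology}, real^3) chart set"
    and h :: "'m \<Rightarrow> ('m, real^3) tvec \<Rightarrow> ('m, real^3) tvec \<Rightarrow> real"
    and AP :: "('p::{t2_space,second_countable_topology}, real^7) chart set"
    and \<pi> :: "'p \<Rightarrow> 'm"
    and act :: "'p \<Rightarrow> mat_pair \<Rightarrow> 'p"
    and A :: "'p \<Rightarrow> ('p, real^7) tvec list \<Rightarrow> mat_pair"
    and \<phi> :: "'p \<Rightarrow> complex^2"
    and D :: "'p \<Rightarrow> ('p, real^7) tvec list \<Rightarrow> mat_pair \<Rightarrow> real"
    and \<Omega> :: "'p \<Rightarrow> ('p, real^7) tvec list \<Rightarrow> complex^2 \<Rightarrow> complex"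
    and v g g' :: real
    and \<eta> :: "'m \<Rightarrow> real"
    and \<phi>' :: "'p \<Rightarrow> mat_pair set"
    and W1 W2 W3 B :: "'p \<Rightarrow> ('p, real^7) tvec list \<Rightarrow> real"
    and p\<^sub>0 :: 'p
  assumes "compact (UNIV :: 'm set)" and "connected (UNIV :: 'm set)"
    and "oriented_atlas AM" and "riemannian_metric AM h"
    and "principal_bundle AM AP \<pi> act"
    and "phase_point AM AP \<pi> act A \<phi> D \<Omega>"
    and "v \<noteq> 0" and "g \<noteq> 0" and "g' \<noteq> 0"
    and "polar_decomposition \<pi> act v \<phi> \<eta> \<phi>'"
    and "p\<^sub>0 \<in> reduced_bundle \<phi>'"
    and "\<And>p vs. vs \<in> tangent_tuples AP 1 p \<Longrightarrow>
           A p vs = (g * W1 p vs) *\<^sub>R t1 + (g * W2 p vs) *\<^sub>R t2 + (g * W3 p vs) *\<^sub>R t3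
                    + (g' * B p vs) *\<^sub>R tU"
  shows "(prop_tminus_on AP (reduced_bundle \<phi>') 1 (tau A) \<longleftrightarrow>
            (\<forall>p\<in>reduced_bundle \<phi>'. \<forall>w\<in>sub_tangent_space AP (reduced_bundle \<phi>') p.
               W_plus W1 W2 p [w] = 0 \<and> W_minus W1 W2 p [w] = 0)) \<and>
         (if prop_tminus_on AP (reduced_bundle \<phi>') 1 (tau A) \<and>
             prop_tminus_on AP (reduced_bundle \<phi>') 2 (D_p D) \<and>
             (\<forall>p\<in>reduced_bundle \<phi>'. momentum_section AM h AP \<pi> \<Omega> p $ 1 = 0)
          then conjugate_at p\<^sub>0 (stabilizer AP act A \<phi> D \<Omega>) Kgrp
          else conjugate_at p\<^sub>0 (stabilizer AP act A \<phi> D \<Omega>) Z2grp)"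
proof -
  interpret higgs AM AP \<pi> act \<phi> v \<eta> \<phi>'
    by unfold_locales (use assms in \<open>auto simp: phase_point_def\<close>)
  have tau: "prop_tminus_on AP (reduced_bundle \<phi>') 1 (tau A) \<longleftrightarrow>
      (\<forall>p\<in>reduced_bundle \<phi>'. \<forall>w\<in>sub_tangent_space AP (reduced_bundle \<phi>') p.
         W_plus W1 W2 p [w] = 0 \<and> W_minus W1 W2 p [w] = 0)"
    using assms(12,8) AP by (rule connection_tau_iff_W)
  note stabilizer_conjugate[OF assms(2,4,6,11)]
  note this[unfolded if_distrib[of "conjugate_at p\<^sub>0 (stabilizer AP act A \<phi> D \<Omega>)"]]
  then show ?thesis
    by (rule conjI[OF tau])
qed

end
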